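(* Let $p$ be a prime, let $n\ge 3$ be an integer, and let $F$ be a subfield of $\bar{\mathbb F}_p$. Let $R$ be an integral domain such that $F[t]\subset R\subsetneq F(t)$, where $t$ is an indeterminate. Then the groups $\mathrm{GL}_n(R)$ and $\mathrm{SL}_n(R)$ both have the $R_\infty$-property.
   Context: $\bar{\mathbb F}_p$ denotes an algebraic closure of the field $\mathbb F_p$ with $p$ elements. $R$ is a subring of the rational function field $F(t)$ containing $F[t]$ and not equal to $F(t)$. For an automorphism $\phi:G\to G$ of a group $G$, elements $x,y\in G$ are $\phi$-twisted conjugate, written $x\sim_\phi y$, if there exists $z\in G$ with $y=zx\phi(z^{-1})$. This is an equivalence relation, and the Reidemeister number $R(\phi)$ is the cardinality of the set of its equivalence classes; one writes $R(\phi)=\infty$ when this set is infinite. The group $G$ has the $R_\infty$-property if $R(\phi)=\infty$ for every (abstract group) automorphism $\phi$ of $G$. *)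

theory Defs
  imports
    "HOL-Algebra.Algebraic_Closure_Type"
    "HOL-Library.Extended_Nat"
    "Jordan_Normal_Form.Determinant"
begin

section \<open>Twisted conjugacy\<close>

definition twisted_conj :: "('g, 'm) monoid_scheme \<Rightarrow> ('g \<Rightarrow> 'g) \<Rightarrow> ('g \<times> 'g) set" where
  "twisted_conj G \<phi> = {(x, y). x \<in> carrier G \<and> y \<in> carrier G \<and>
     (\<exists>z \<in> carrier G. y = z \<otimes>\<^bsub>G\<^esub> x \<otimes>\<^bsub>G\<^esub> \<phi> (inv\<^bsub>G\<^esub> z))}"

definition reidemeister_number :: "('g, 'm) monoid_scheme \<Rightarrow> ('g \<Rightarrow> 'g) \<Rightarrow> enat" where
  "reidemeister_number G \<phi> =
     (if finite (carrier G // twisted_conj G \<phi>)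
      then enat (card (carrier G // twisted_conj G \<phi>)) else \<infinity>)"

definition R_infinity_property :: "('g, 'm) monoid_scheme \<Rightarrow> bool" where
  "R_infinity_property G \<longleftrightarrow> (\<forall>\<phi> \<in> iso G G. reidemeister_number G \<phi> = \<infinity>)"

lemma (in group) equiv_twisted_conj:
  assumes "\<phi> \<in> iso G G"
  shows "equiv (carrier G) (twisted_conj G \<phi>)"
proof -
  have h: "\<phi> \<in> hom G G" using assms by (simp add: iso_def)
  interpret group_hom G G \<phi> by unfold_locales (rule h)
  show ?thesis
  proof (rule equivI)
    show "twisted_conj G \<phi> \<subseteq> carrier G \<times> carrier G"
      by (auto simp: twisted_conj_def)
    show "refl_on (carrier G) (twisted_conj G \<phi>)"
      by (auto simp: refl_on_def twisted_conj_def intro!: bexI[of _ \<one>])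
    show "sym (twisted_conj G \<phi>)"
    proof (rule symI)
      fix x y assume "(x, y) \<in> twisted_conj G \<phi>"
      then obtain z where x: "x \<in> carrier G" and z: "z \<in> carrier G"
        and y: "y = z \<otimes> x \<otimes> \<phi> (inv z)" by (auto simp: twisted_conj_def)
      have "inv z \<otimes> y \<otimes> \<phi> (inv (inv z)) = x"
      proof -
        have "\<phi> (inv z) \<otimes> \<phi> z = \<one>" "inv z \<otimes> (z \<otimes> x) = x"
          using x z by (simp_all add: m_assoc [symmetric])
        then have "inv z \<otimes> y \<otimes> \<phi> z = x"
          using x z by (simp add: y m_assoc del: hom_inv)
        then show ?thesis using z by simp
      qed
      then show "(y, x) \<in> twisted_conj G \<phi>"
        using x z y by (auto simp: twisted_conj_def intro!: bexI[of _ "inv z"])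
    qed
    show "trans (twisted_conj G \<phi>)"
    proof (rule transI)
      fix x y w assume "(x, y) \<in> twisted_conj G \<phi>" "(y, w) \<in> twisted_conj G \<phi>"
      then obtain a b where x: "x \<in> carrier G" and ab: "a \<in> carrier G" "b \<in> carrier G"
        and y: "y = a \<otimes> x \<otimes> \<phi> (inv a)" and w: "w = b \<otimes> y \<otimes> \<phi> (inv b)"
        by (auto simp: twisted_conj_def)
      have "w = (b \<otimes> a) \<otimes> x \<otimes> \<phi> (inv (b \<otimes> a))"
        using x ab by (simp add: w y inv_mult_group m_assoc del: hom_inv)
      then show "(x, w) \<in> twisted_conj G \<phi>"
        using x ab y w by (auto simp: twisted_conj_def intro!: bexI[of _ "b \<otimes> a"])
    qed
  qed
qed


section \<open>Matrix groups over a subring of a commutative ring\<close>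

definition Mat_over :: "nat \<Rightarrow> 'a :: comm_ring_1 set \<Rightarrow> 'a mat monoid" where
  "Mat_over n R = \<lparr>carrier = {A \<in> carrier_mat n n. elements_mat A \<subseteq> R},
                   monoid.mult = (*), one = 1\<^sub>m n\<rparr>"

definition GL :: "nat \<Rightarrow> 'a :: comm_ring_1 set \<Rightarrow> 'a mat monoid" where
  "GL n R = units_of (Mat_over n R)"

definition SL :: "nat \<Rightarrow> 'a :: comm_ring_1 set \<Rightarrow> 'a mat monoid" where
  "SL n R = (Mat_over n R)\<lparr>carrier := {A \<in> carrier (Mat_over n R). det A = 1}\<rparr>"

lemma subring_of_typeD:
  assumes "subring R (ring_of_type_algebra :: 'a :: comm_ring_1 ring)"
  shows "0 \<in> R" "1 \<in> R" "x \<in> R \<Longrightarrow> - x \<in> R"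
    "x \<in> R \<Longrightarrow> y \<in> R \<Longrightarrow> x * y \<in> R" "x \<in> R \<Longrightarrow> y \<in> R \<Longrightarrow> x + y \<in> R"
    "(\<And>i. i \<in> I \<Longrightarrow> f i \<in> R) \<Longrightarrow> sum f I \<in> R"
    "(\<And>i. i \<in> I \<Longrightarrow> f i \<in> R) \<Longrightarrow> prod f I \<in> R"
proof -
  let ?T = "ring_of_type_algebra :: 'a ring"
  interpret T: ring ?T by rule
  note E = subringE[OF assms]
  show z: "0 \<in> R" using E(2) by (simp add: ring_of_type_algebra_def)
  show o: "1 \<in> R" using E(3) by (simp add: ring_of_type_algebra_def)
  show "x \<in> R \<Longrightarrow> - x \<in> R"
  proof -
    assume x: "x \<in> R"
    have "\<ominus>\<^bsub>?T\<^esub> x = - x"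
      by (rule T.minus_equality) (auto simp: ring_of_type_algebra_def)
    then show ?thesis using E(5)[OF x] by simp
  qed
  show m: "x \<in> R \<Longrightarrow> y \<in> R \<Longrightarrow> x * y \<in> R" for x y
    using E(6)[of x y] by (simp add: ring_of_type_algebra_def)
  show a: "x \<in> R \<Longrightarrow> y \<in> R \<Longrightarrow> x + y \<in> R" for x y
    using E(7)[of x y] by (simp add: ring_of_type_algebra_def)
  show "(\<And>i. i \<in> I \<Longrightarrow> f i \<in> R) \<Longrightarrow> sum f I \<in> R"
    by (induction I rule: infinite_finite_induct) (auto simp: z a)
  show "(\<And>i. i \<in> I \<Longrightarrow> f i \<in> R) \<Longrightarrow> prod f I \<in> R"
    by (induction I rule: infinite_finite_induct) (auto simp: o m)
qed

lemma elements_mat_subset_iff: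
  "A \<in> carrier_mat n m \<Longrightarrow> elements_mat A \<subseteq> R \<longleftrightarrow> (\<forall>i<n. \<forall>j<m. A $$ (i, j) \<in> R)"
  by auto

lemma monoid_Mat_over:
  assumes "subring R (ring_of_type_algebra :: 'a :: comm_ring_1 ring)"
  shows "monoid (Mat_over n R)"
proof -
  note S = subring_of_typeD[OF assms]
  show ?thesis
  proof (rule monoidI, goal_cases)
    case (1 A B)
    then have AB: "A \<in> carrier_mat n n" "B \<in> carrier_mat n n"
      and e: "\<forall>i<n. \<forall>j<n. A $$ (i, j) \<in> R" "\<forall>i<n. \<forall>j<n. B $$ (i, j) \<in> R"
      by (auto simp: Mat_over_def elements_mat_subset_iff)
    have "\<forall>i<n. \<forall>j<n. (A * B) $$ (i, j) \<in> R"
      using AB e by (auto simp: scalar_prod_def intro!: S(4,6))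
    then show ?case using AB elements_mat_subset_iff[of "A * B" n n R]
      by (auto simp: Mat_over_def)
  next
    case 2
    have "\<forall>i<n. \<forall>j<n. (1\<^sub>m n :: 'a mat) $$ (i, j) \<in> R" using S(1,2) by auto
    then show ?case using elements_mat_subset_iff[of "1\<^sub>m n :: 'a mat" n n R]
      by (auto simp: Mat_over_def)
  qed (auto simp: Mat_over_def assoc_mult_mat)
qed

lemma group_GL:
  assumes "subring R (ring_of_type_algebra :: 'a :: comm_ring_1 ring)"
  shows "group (GL n R)"
  unfolding GL_def by (rule monoid.units_group[OF monoid_Mat_over[OF assms]])

lemma det_in_subring:
  assumes "subring R (ring_of_type_algebra :: 'a :: comm_ring_1 ring)"
    and "\<And>i j. i < dim_row A \<Longrightarrow> j < dim_col A \<Longrightarrow> A $$ (i, j) \<in> R"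
  shows "det A \<in> R"
proof -
  note S = subring_of_typeD[OF assms(1)]
  have s: "signof p \<in> R" for p :: "nat \<Rightarrow> nat"
    using S(2) S(3)[OF S(2)] by (cases p rule: sign_cases) auto
  show ?thesis
    unfolding det_def using S(1) s assms(2)
    by (auto intro!: S(4,6,7) dest: permutes_in_image)
qed

lemma group_SL:
  assumes "subring R (ring_of_type_algebra :: 'a :: comm_ring_1 ring)"
  shows "group (SL n R)"
proof -
  note S = subring_of_typeD[OF assms]
  interpret M: monoid "Mat_over n R" by (rule monoid_Mat_over[OF assms])
  show ?thesis
  proof (rule groupI, goal_cases)
    case (1 A B)
    then show ?case using M.m_closed[of A B]
      by (auto simp: SL_def) (auto simp: Mat_over_def det_mult[of A n B])
  next
    case 2
    show ?case using M.one_closed by (auto simp: SL_def) (auto simp: Mat_over_def)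
  next
    case (3 A B C)
    then show ?case using M.m_assoc[of A B C] by (auto simp: SL_def)
  next
    case (4 A)
    then show ?case using M.l_one[of A] by (auto simp: SL_def)
  next
    case (5 A)
    then have A: "A \<in> carrier_mat n n" and e: "\<forall>i<n. \<forall>j<n. A $$ (i, j) \<in> R"
      and d: "det A = 1"
      by (auto simp: SL_def Mat_over_def elements_mat_subset_iff)
    let ?B = "adj_mat A"
    have B: "?B \<in> carrier_mat n n" and BA: "?B * A = 1\<^sub>m n"
      using adj_mat[OF A] d by auto
    have "(-1) ^ k \<in> R" for k
      using S(2) S(3)[OF S(2)] by (cases "even k") auto
    then have "cofactor A j i \<in> R" if "i < n" "j < n" for i j
      unfolding cofactor_def using A e that
      by (intro S(4) det_in_subring[OF assms]) (auto simp: mat_delete_def)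
    then have "\<forall>i<n. \<forall>j<n. ?B $$ (i, j) \<in> R"
      using A by (auto simp: adj_mat_def)
    moreover have "det ?B = 1"
      using det_mult[OF B A] d BA by simp
    ultimately show ?case
      using B BA elements_mat_subset_iff[OF B, of R]
      by (auto simp: SL_def Mat_over_def intro!: bexI[of _ ?B])
  qed
qed


section \<open>Polynomials and rational functions over a subfield\<close>

text \<open>For a subfield \<open>F\<close> of a field \<open>'k\<close>, the rings \<open>F[t]\<close> and \<open>F(t)\<close> are realised inside
  the rational function field \<open>'k(t)\<close>, which is the type \<^typ>\<open>'k poly fract\<close>.\<close>

definition polys_over :: "'k :: field set \<Rightarrow> 'k poly fract set" where
  "polys_over F = to_fract ` {f. \<forall>i. Polynomial.coeff f i \<in> F}"

definition ratfuns_over :: "'k :: field set \<Rightarrow> 'k poly fract set" where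
  "ratfuns_over F = {a / b | a b. a \<in> polys_over F \<and> b \<in> polys_over F \<and> b \<noteq> 0}"

end

theory Submission
  imports Defs "HOL-Combinatorics.Transposition"
begin

no_notation fps_nth (infixl \<open>$\<close> 75)

text \<open>In characteristic \<open>p\<close> the elements of order \<open>p\<close> are unipotent. Let \<open>\<phi>\<close> be an automorphism of
  \<open>SL\<^sub>n\<close> or \<open>GL\<^sub>n\<close> over \<open>R\<close>. The image of the group of upper unitriangular matrices is again nilpotent and
  unipotent, so it stabilises a full flag (Kolchin), and its centre, an \<open>(n - 1)\<close>-fold commutator subgroup,
  consists of transvections. Hence \<open>\<phi>\<close> permutes the root subgroups \<open>{1 + r v f\<^sup>T | r \<in> R}\<close>, and the
  commutator relations show that, up to central factors and possibly the contragredient, \<open>\<phi>\<close> is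
  \<open>A \<mapsto> g \<rho>(A) g\<^sup>-\<^sup>1\<close> with \<open>g \<in> GL\<^sub>n(R)\<close> and \<open>\<rho>\<close> an automorphism of \<open>R\<close>, which is Euclidean, being a
  localisation of \<open>F[t]\<close>.

  Every \<open>\<rho>\<close> is locally finite: \<open>F\<close> is a union of finite fields stable under \<open>\<rho>\<close>, and \<open>\<rho>(t)\<close> is a fractional
  linear function of \<open>t\<close>. So there is \<open>s \<in> R\<close> of positive degree with \<open>\<rho>(s) = s\<close>. If \<open>Y = z X \<rho>(z)\<^sup>-\<^sup>1\<close> and \<open>\<rho>\<^sup>m\<close>
  fixes \<open>z\<close>, then the twisted norms \<open>X \<rho>(X) \<dots> \<rho>\<^sup>m\<^sup>-\<^sup>1(X)\<close> and \<open>Y \<rho>(Y) \<dots> \<rho>\<^sup>m\<^sup>-\<^sup>1(Y)\<close> are conjugate; for matrices built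
  from different powers of \<open>s\<close> the degrees of their traces differ.\<close>

section \<open>Subspaces of coordinate space and commuting unipotents\<close>

text \<open>Units are the obstacle. An image \<open>\<phi> A\<close> is known only up to a unit
  \<open>\<chi>\<close> that varies with \<open>A\<close>, so the norms are conjugate only up to a
  unit \<open>e\<close>, and a unit of \<open>R\<close> may have nonzero degree, as \<open>t\<close>
  does when \<open>1 / t\<close> lies in \<open>R\<close>. The test matrices are therefore built so
  that all norms have the same determinant: this gives \<open>e ^ n = 1\<close>, hence degree 0 for
  \<open>e\<close>. They must also lie in \<open>SL\<close>, although \<open>det g\<close> can be
  any unit; so they have the form \<open>M * h\<close> with \<open>h\<close> inverse to
  \<open>g\<close> and \<open>det M = det g\<close>. That determinant sits on the last diagonal
  place, outside the 2 x 2 block with the power of \<open>s\<close>, which is possible as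
  \<open>n\<close> is at least 3; large exponents make the block dominate the orbit of this entry.

  For the contragredient type the relation transposes and inverts \<open>z\<close>, so it cannot be
  iterated directly. Using it twice gives an ordinary relation, twisted by
  \<open>\<rho>\<^sup>2\<close>, for the product of a test matrix with the inverse transpose of its
  image under \<open>\<rho>\<close>. This is the origin of \<open>twist_block\<close>.\<close>

definition vec_subspace :: "nat \<Rightarrow> 'a :: field vec set \<Rightarrow> bool" where
  "vec_subspace n W \<longleftrightarrow> W \<subseteq> carrier_vec n \<and> 0\<^sub>v n \<in> W \<and>
     (\<forall>u \<in> W. \<forall>w \<in> W. u + w \<in> W) \<and> (\<forall>c. \<forall>u \<in> W. c \<cdot>\<^sub>v u \<in> W)"

text \<open>These are the pivot columns of an echelon basis, so their number is the dimension of
  \<open>W\<close>. Counting them replaces the use of bases.\<close>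

definition lead_positions :: "nat \<Rightarrow> 'a :: field vec set \<Rightarrow> nat set" where
  "lead_positions n W = {i. i < n \<and> (\<exists>w \<in> W. w $ i \<noteq> 0 \<and> (\<forall>j<i. w $ j = 0))}"

lemma vec_subspaceD:
  assumes "vec_subspace n W"
  shows "W \<subseteq> carrier_vec n" "w \<in> W \<Longrightarrow> w \<in> carrier_vec n" "0\<^sub>v n \<in> W"
    "u \<in> W \<Longrightarrow> w \<in> W \<Longrightarrow> u + w \<in> W" "u \<in> W \<Longrightarrow> c \<cdot>\<^sub>v u \<in> W"
    "u \<in> W \<Longrightarrow> w \<in> W \<Longrightarrow> u - w \<in> W"
proof -
  show *: "W \<subseteq> carrier_vec n" "w \<in> W \<Longrightarrow> w \<in> carrier_vec n" "0\<^sub>v n \<in> W"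
    "u \<in> W \<Longrightarrow> w \<in> W \<Longrightarrow> u + w \<in> W" "u \<in> W \<Longrightarrow> c \<cdot>\<^sub>v u \<in> W" for u w c
    using assms by (auto simp: vec_subspace_def)
  assume uw: "u \<in> W" "w \<in> W"
  then have "u - w = u + (-1) \<cdot>\<^sub>v w" using *(2)[of u] *(2)[of w] by (intro eq_vecI) auto
  then show "u - w \<in> W" using *(4)[OF uw(1) *(5)[OF uw(2), of "-1"]] by simp
qed

lemma vec_subspaceI:
  assumes "W \<subseteq> carrier_vec n" "0\<^sub>v n \<in> W" "\<And>u w. u \<in> W \<Longrightarrow> w \<in> W \<Longrightarrow> u + w \<in> W"
    "\<And>c u. u \<in> W \<Longrightarrow> c \<cdot>\<^sub>v u \<in> W"
  shows "vec_subspace n W"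
  using assms by (auto simp: vec_subspace_def)

lemma vec_subspace_carrier: "vec_subspace n (carrier_vec n)"
  by (rule vec_subspaceI) auto

lemma vec_subspace_zero: "vec_subspace n {0\<^sub>v n}"
  by (rule vec_subspaceI) auto

lemma finite_lead_positions: "finite (lead_positions n W)" and card_lead_positions_le: "card (lead_positions n W) \<le> n"
proof -
  have "lead_positions n W \<subseteq> {..<n}" by (auto simp: lead_positions_def)
  then show "finite (lead_positions n W)" "card (lead_positions n W) \<le> n"
    using finite_subset[of _ "{..<n}"] card_mono[of "{..<n}"] by auto
qed

lemma lead_positions_mono: "U \<subseteq> W \<Longrightarrow> lead_positions n U \<subseteq> lead_positions n W"
  by (auto simp: lead_positions_def)

text \<open>Backward elimination: a vector of \<open>W\<close> whose first \<open>n - m\<close>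
  entries vanish loses its next entry by subtracting a multiple of a vector of \<open>U\<close> with
  the same leading position. Induction on \<open>m\<close> then puts it into
  \<open>U\<close>.\<close>

lemma eq_if_lead_positions_eq:
  fixes U W :: "'a :: field vec set"
  assumes U: "vec_subspace n U" and W: "vec_subspace n W" and sub: "U \<subseteq> W" and l: "lead_positions n W \<subseteq> lead_positions n U"
  shows "U = W"
proof -
  have "w \<in> W \<Longrightarrow> \<forall>j<n - m. w $ j = 0 \<Longrightarrow> w \<in> U" if "m \<le> n" for m w
    using that
  proof (induction m arbitrary: w)
    case 0
    then have "w = 0\<^sub>v n" using vec_subspaceD(2)[OF W] by (intro eq_vecI) auto
    then show ?case using vec_subspaceD(3)[OF U] by simp
  next
    case (Suc m)
    let ?k = "n - Suc m"
    have k: "?k < n" "n - m = Suc ?k" using Suc by auto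
    show ?case
    proof (cases "w $ ?k = 0")
      case True
      then have "\<forall>j<n - m. w $ j = 0" using Suc.prems k by (auto simp: less_Suc_eq)
      then show ?thesis using Suc by auto
    next
      case False
      then have "?k \<in> lead_positions n W" unfolding lead_positions_def using Suc.prems k by blast
      then have "?k \<in> lead_positions n U" using l by blast
      then obtain u :: "'a vec" where u: "u \<in> U" "u $ ?k \<noteq> 0" "\<forall>j<?k. u $ j = 0" by (auto simp: lead_positions_def)
      define c where "c = w $ ?k / u $ ?k"
      have cu: "c \<cdot>\<^sub>v u \<in> U" using vec_subspaceD(5)[OF U] u by auto
      have c: "w \<in> carrier_vec n" "u \<in> carrier_vec n" using vec_subspaceD(2)[OF W] vec_subspaceD(2)[OF U] Suc u by auto
      have "w - c \<cdot>\<^sub>v u \<in> W" using vec_subspaceD(6)[OF W] cu sub Suc by auto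
      moreover have "\<forall>j<n - m. (w - c \<cdot>\<^sub>v u) $ j = 0"
        using c u Suc.prems k by (auto simp: less_Suc_eq c_def)
      ultimately have "w - c \<cdot>\<^sub>v u \<in> U" using Suc by auto
      then have "(w - c \<cdot>\<^sub>v u) + c \<cdot>\<^sub>v u \<in> U" using vec_subspaceD(4)[OF U] cu by auto
      moreover have "(w - c \<cdot>\<^sub>v u) + c \<cdot>\<^sub>v u = w" using c by (intro eq_vecI) auto
      ultimately show ?thesis by simp
    qed
  qed
  from this[of n] sub show ?thesis by auto
qed

lemma card_lead_positions_less:
  assumes U: "vec_subspace n U" and W: "vec_subspace n W" and sub: "U \<subset> W"
  shows "card (lead_positions n U) < card (lead_positions n W)"
proof -
  have "lead_positions n U \<subseteq> lead_positions n W" using lead_positions_mono sub by blast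
  moreover have "lead_positions n U \<noteq> lead_positions n W" using eq_if_lead_positions_eq[OF U W] sub by blast
  ultimately show ?thesis using finite_lead_positions psubset_card_mono by blast
qed

lemma vec_subspace_line: "v \<in> carrier_vec n \<Longrightarrow> vec_subspace n {c \<cdot>\<^sub>v v | c. True}"
proof (rule vec_subspaceI, goal_cases)
  case 2 then show ?case by (auto intro!: exI[of _ 0])
next
  case (3 u w) then show ?case by (auto simp: add_smult_distrib_vec[symmetric])
qed (auto simp: smult_smult_assoc)

text \<open>The line through \<open>v\<close> already has a leading position, so a strict inclusion
  in \<open>W\<close> would give \<open>W\<close> at least two.\<close>

lemma line_if_card_lead_positions_le_1:
  assumes W: "vec_subspace n W" and c: "card (lead_positions n W) \<le> 1" and v: "v \<in> W" "v \<noteq> 0\<^sub>v n"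
    and w: "w \<in> W"
  shows "\<exists>c. w = c \<cdot>\<^sub>v v"
proof -
  let ?L = "{c \<cdot>\<^sub>v v | c. True}"
  have vc: "v \<in> carrier_vec n" using vec_subspaceD(2)[OF W v(1)] .
  have L: "vec_subspace n ?L" by (rule vec_subspace_line[OF vc])
  have "v \<in> ?L" by (auto intro!: exI[of _ 1])
  then have "{0\<^sub>v n} \<subset> ?L" using v(2) vec_subspaceD(3)[OF L] by blast
  from card_lead_positions_less[OF vec_subspace_zero L this] have "card (lead_positions n ?L) \<ge> 1" by simp
  moreover have "?L \<subseteq> W" using vec_subspaceD(5)[OF W v(1)] by auto
  ultimately have "?L = W"
    using card_lead_positions_less[OF L W] c by fastforce
  then show ?thesis using w by blast
qed

lemma vec_subspace_add_line:
  assumes W: "vec_subspace n W" and e: "e \<in> carrier_vec n"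
  shows "vec_subspace n {w + c \<cdot>\<^sub>v e | w c. w \<in> W}"
proof (rule vec_subspaceI, goal_cases)
  case 1 then show ?case using vec_subspaceD(2)[OF W] e by auto
next
  case 2
  have "0\<^sub>v n = 0\<^sub>v n + 0 \<cdot>\<^sub>v e" using e by auto
  then show ?case using vec_subspaceD(3)[OF W] by blast
next
  case (3 u w)
  then obtain u' c w' d where *: "u = u' + c \<cdot>\<^sub>v e" "w = w' + d \<cdot>\<^sub>v e" "u' \<in> W" "w' \<in> W" by auto
  have "u + w = (u' + w') + (c + d) \<cdot>\<^sub>v e"
    using * vec_subspaceD(2)[OF W] e by (auto intro!: eq_vecI simp: algebra_simps dest!: vec_subspaceD(2)[OF W])
  then show ?case using * vec_subspaceD(4)[OF W] by blast
next
  case (4 c u)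
  then obtain u' d where *: "u = u' + d \<cdot>\<^sub>v e" "u' \<in> W" by auto
  have "c \<cdot>\<^sub>v u = c \<cdot>\<^sub>v u' + (c * d) \<cdot>\<^sub>v e"
    using * e by (auto intro!: eq_vecI simp: algebra_simps dest!: vec_subspaceD(2)[OF W])
  then show ?case using * vec_subspaceD(5)[OF W] by blast
qed

text \<open>The count says that \<open>W\<close> has codimension at most one, so adding any vector
  outside \<open>W\<close> exhausts the space.\<close>

lemma complement_line:
  assumes W: "vec_subspace n W" and c: "n \<le> Suc (card (lead_positions n W))" and e: "e \<in> carrier_vec n" "e \<notin> W"
    and v: "v \<in> carrier_vec n"
  shows "\<exists>w c. w \<in> W \<and> v = w + c \<cdot>\<^sub>v e"
proof -
  let ?L = "{w + c \<cdot>\<^sub>v e | w c. w \<in> W}"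
  have L: "vec_subspace n ?L" by (rule vec_subspace_add_line[OF W e(1)])
  have "W \<subseteq> ?L"
  proof
    fix w assume w: "w \<in> W"
    have "w = w + 0 \<cdot>\<^sub>v e" using e w vec_subspaceD(2)[OF W] by (auto intro!: eq_vecI)
    then show "w \<in> ?L" using w by blast
  qed
  moreover have "e = 0\<^sub>v n + 1 \<cdot>\<^sub>v e" using e by auto
  then have "e \<in> ?L" using vec_subspaceD(3)[OF W] by blast
  ultimately have "W \<subset> ?L" using e by blast
  from card_lead_positions_less[OF W L this] have "n \<le> card (lead_positions n ?L)" using c by simp
  then have "\<not> ?L \<subset> carrier_vec n"
    using card_lead_positions_less[OF L vec_subspace_carrier] card_lead_positions_le[of n "carrier_vec n :: 'a vec set"] by fastforce
  then have "?L = carrier_vec n" using vec_subspaceD(1)[OF L] by blast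
  then show ?thesis using v by blast
qed

section \<open>Finite differences, unipotent matrices and common fixed vectors\<close>

abbreviation vdiff :: "'a :: field mat \<Rightarrow> 'a vec \<Rightarrow> 'a vec" where
  "vdiff x v \<equiv> x *\<^sub>v v - v"

text \<open>Pascal's rule gives the induction step. The sign is \<open>(-1) ^ (m + j)\<close>, equal
  to the usual \<open>(-1) ^ (m - j)\<close> but free of truncated subtraction.\<close>

lemma iterated_difference:
  fixes a :: "nat \<Rightarrow> 'a :: comm_ring_1"
  shows "((\<lambda>b k. b (Suc k) - b k) ^^ m) a k =
    (\<Sum>j\<le>m. of_nat (m choose j) * (-1) ^ (m + j) * a (k + j))"
proof (induction m arbitrary: k)
  case (Suc m)
  let ?f = "\<lambda>j. of_nat (m choose j) * (-1) ^ (m + j) * a (Suc k + j)"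
  let ?g = "\<lambda>j. of_nat (m choose j) * (-1) ^ (m + j) * a (k + j)"
  have "(\<Sum>j\<le>Suc m. of_nat (Suc m choose j) * (-1) ^ (Suc m + j) * a (k + j)) =
     (-1) ^ Suc m * a k + (\<Sum>j\<le>m. of_nat (Suc m choose Suc j) * (-1) ^ (m + j) * a (Suc k + j))"
    by (subst sum.atMost_Suc_shift) (simp add: algebra_simps)
  also have "(\<Sum>j\<le>m. of_nat (Suc m choose Suc j) * (-1) ^ (m + j) * a (Suc k + j)) =
     sum ?f {..m} + (\<Sum>j\<le>m. of_nat (m choose Suc j) * (-1) ^ (m + j) * a (Suc k + j))"
    by (simp add: algebra_simps sum.distrib)
  also have "(\<Sum>j\<le>m. of_nat (m choose Suc j) * (-1) ^ (m + j) * a (Suc k + j)) =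
     (-1) ^ m * a k - sum ?g {..Suc m}"
    using sum.atMost_Suc_shift[of ?g m] by (simp add: sum_negf del: sum.atMost_Suc)
  also have "sum ?g {..Suc m} = sum ?g {..m}" by (simp add: binomial_eq_0)
  finally show ?case by (simp add: Suc.IH)
qed auto

text \<open>With the shift operator \<open>E\<close> this is \<open>(E - 1) ^ p = E ^ p - 1\<close>:
  the inner binomial coefficients are multiples of \<open>p\<close>, and
  \<open>(-1) ^ p = -1\<close> holds for \<open>p = 2\<close> as well, because then
  \<open>1 + 1 = 0\<close>. Working with sequences serves matrices and scalars alike.\<close>

lemma iterated_difference_char:
  fixes a :: "nat \<Rightarrow> 'a :: comm_ring_1"
  assumes "prime p" "of_nat p = (0 :: 'a)"
  shows "((\<lambda>b k. b (Suc k) - b k) ^^ p) a k = a (k + p) - a k"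
proof -
  have p0: "p > 0" using assms prime_gt_0_nat by auto
  have "of_nat (p choose j) = (0 :: 'a)" if "0 < j" "j < p" for j
  proof -
    have "p dvd (p choose j)" using dvd_choose_prime[of j p] that assms by auto
    then show ?thesis using assms(2) by (auto elim!: dvdE)
  qed
  then have "(\<Sum>j\<le>p. of_nat (p choose j) * (-1) ^ (p + j) * a (k + j)) =
     (\<Sum>j\<in>{0,p}. of_nat (p choose j) * (-1) ^ (p + j) * a (k + j))"
    by (intro sum.mono_neutral_right) auto
  also have "\<dots> = (-1) ^ p * a k + a (k + p)"
    using p0 by (simp add: power_add[symmetric] mult_2[symmetric])
  also have "(-1) ^ p = (-1 :: 'a)"
  proof (cases "p = 2")
    case True
    then have "1 + 1 = (0 :: 'a)" using assms(2) by simp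
    then show ?thesis using True by (simp add: eq_neg_iff_add_eq_0)
  next
    case False
    then have "odd p" using assms prime_odd_nat[of p] prime_gt_1_nat[of p] by auto
    then show ?thesis by simp
  qed
  finally show ?thesis by (simp add: iterated_difference)
qed

text \<open>In effect \<open>(x - 1) ^ p = x ^ p - 1 = 0\<close>. Along the vectors
  \<open>x ^ k w\<close> the map \<open>vdiff x\<close> is the forward difference in
  \<open>k\<close>, so the result on sequences applies to each coordinate.\<close>

lemma vdiff_nilpotent:
  fixes x :: "'a :: field mat"
  assumes p: "prime p" "of_nat p = (0 :: 'a)" and x: "x \<in> carrier_mat n n" and xp: "x ^\<^sub>m p = 1\<^sub>m n"
    and w: "w \<in> carrier_vec n"
  shows "(vdiff x ^^ p) w = 0\<^sub>v n"
proof -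
  have pw: "x ^\<^sub>m k \<in> carrier_mat n n" for k using x by simp
  have eq: "(vdiff x ^^ m) (x ^\<^sub>m k *\<^sub>v w) =
     vec n (\<lambda>i. ((\<lambda>b k. b (Suc k) - b k) ^^ m) (\<lambda>k. (x ^\<^sub>m k *\<^sub>v w) $ i) k)" for m k
  proof (induction m arbitrary: k)
    case 0
    then show ?case using x by (intro eq_vecI) auto
  next
    case (Suc m)
    \<comment> \<open>Linearity of the iterates lets the innermost difference be taken
      first.\<close>
    have lin: "(vdiff x ^^ m) (u - v) = (vdiff x ^^ m) u - (vdiff x ^^ m) v \<and> (vdiff x ^^ m) u \<in> carrier_vec n"
      if "u \<in> carrier_vec n" "v \<in> carrier_vec n" for u v m
      using that
    proof (induction m arbitrary: u v)
      case (Suc m)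
      have "vdiff x (u - v) = vdiff x u - vdiff x v"
        using Suc.prems x by (simp add: mult_minus_distrib_mat_vec) (intro eq_vecI, auto)
      moreover have "vdiff x u \<in> carrier_vec n" "vdiff x v \<in> carrier_vec n" using Suc.prems x by auto
      ultimately show ?case using Suc.IH[of "vdiff x u" "vdiff x v"]
        by (simp add: funpow_Suc_right del: funpow.simps)
    qed auto
    have c: "x ^\<^sub>m k *\<^sub>v w \<in> carrier_vec n" for k by (rule mult_mat_vec_carrier[OF pw w])
    have "x ^\<^sub>m Suc k = x * x ^\<^sub>m k"
      using x by (induction k) (auto simp: assoc_mult_mat[of _ n n _ n _ n])
    then have "x *\<^sub>v (x ^\<^sub>m k *\<^sub>v w) = x ^\<^sub>m Suc k *\<^sub>v w"
      using assoc_mult_mat_vec[OF x pw w] by simp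
    then have "(vdiff x ^^ Suc m) (x ^\<^sub>m k *\<^sub>v w) =
      (vdiff x ^^ m) (x ^\<^sub>m Suc k *\<^sub>v w) - (vdiff x ^^ m) (x ^\<^sub>m k *\<^sub>v w)"
      using lin[OF c c, of m "Suc k" k] by (simp add: funpow_Suc_right del: funpow.simps pow_mat.simps)
    then show ?case unfolding Suc.IH by (auto intro!: eq_vecI)
  qed
  have "(vdiff x ^^ p) (x ^\<^sub>m 0 *\<^sub>v w) = 0\<^sub>v n"
    unfolding eq iterated_difference_char[OF p] using xp x w by (auto intro!: eq_vecI)
  then show ?thesis using x w by simp
qed

text \<open>\<open>S j\<close> models a descending central filtration: commutators of
  \<open>S j\<close> with \<open>S 0\<close> fall into \<open>S (Suc j)\<close>. Among the invariant
  subspaces not contained in \<open>W\<close>, one of least dimension turns out to be fixed modulo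
  \<open>W\<close> by all of \<open>S 0\<close>.\<close>

lemma kolchin_step:
  fixes S :: "nat \<Rightarrow> 'a :: field mat set"
  assumes S: "\<And>j. S (Suc j) \<subseteq> S j" "S 0 \<subseteq> carrier_mat n n" "S m = {}"
    and nilp: "\<And>x w. x \<in> S 0 \<Longrightarrow> w \<in> carrier_vec n \<Longrightarrow> (vdiff x ^^ q) w = 0\<^sub>v n"
    and comm: "\<And>j x h. x \<in> S j \<Longrightarrow> h \<in> S 0 \<Longrightarrow>
      \<exists>c. (c = 1\<^sub>m n \<or> c \<in> S (Suc j)) \<and> x * h = h * x * c"
    and W: "vec_subspace n W" "W \<noteq> carrier_vec n"
    and inv: "\<And>x w. x \<in> S 0 \<Longrightarrow> w \<in> W \<Longrightarrow> x *\<^sub>v w \<in> W"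
  shows "\<exists>v \<in> carrier_vec n. v \<notin> W \<and> (\<forall>x \<in> S 0. vdiff x v \<in> W)"
proof -
  define P where "P M \<longleftrightarrow> vec_subspace n M \<and> (\<forall>x \<in> S 0. \<forall>w \<in> M. x *\<^sub>v w \<in> M) \<and> \<not> M \<subseteq> W" for M
  have "P (carrier_vec n)"
    using W vec_subspace_carrier vec_subspaceD(1)[OF W(1)] S(2) unfolding P_def by auto
  then obtain M where M: "P M" and Mmin: "\<And>M'. P M' \<Longrightarrow> card (lead_positions n M) \<le> card (lead_positions n M')"
    using ex_has_least_nat[of P "carrier_vec n" "\<lambda>M. card (lead_positions n M)"] by blast
  have M': "vec_subspace n M" "\<And>x w. x \<in> S 0 \<Longrightarrow> w \<in> M \<Longrightarrow> x *\<^sub>v w \<in> M" "\<not> M \<subseteq> W"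
    using M by (auto simp: P_def)
  have S0: "x \<in> S j \<Longrightarrow> x \<in> S 0" for x j using S(1) by (induction j) auto
  note Mc = vec_subspaceD(2)[OF M'(1)] and Wc = vec_subspaceD(2)[OF W(1)]
  \<comment> \<open>The deepest layer comes first. Once the next deeper layer acts trivially on
    \<open>M\<close> modulo \<open>W\<close>, the vectors \<open>M'\<close> of \<open>M\<close>
    fixed modulo \<open>W\<close> by an element \<open>x\<close> of the present layer form an
    invariant subspace, and minimality gives \<open>M' = M\<close>.\<close>
  have triv: "\<forall>x \<in> S (m - j). \<forall>w \<in> M. vdiff x w \<in> W" if "j \<le> m" for j
    using that
  proof (induction j)
    case 0 then show ?case using S(3) by simp
  next
    case (Suc j)
    have IH: "\<And>c w. c \<in> S (Suc (m - Suc j)) \<Longrightarrow> w \<in> M \<Longrightarrow> vdiff c w \<in> W"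
      using Suc by (auto simp: Suc_diff_Suc)
    show ?case
    proof
      fix x assume x: "x \<in> S (m - Suc j)"
      then have x0: "x \<in> S 0" by (rule S0)
      then have xc: "x \<in> carrier_mat n n" using S by auto
      define M' where "M' = {w \<in> M. vdiff x w \<in> W}"
      have "vec_subspace n M'"
      proof (rule vec_subspaceI)
        show "M' \<subseteq> carrier_vec n" using Mc by (auto simp: M'_def)
        have "vdiff x (0\<^sub>v n) = 0\<^sub>v n" using xc by auto
        then show "0\<^sub>v n \<in> M'" using vec_subspaceD(3)[OF M'(1)] vec_subspaceD(3)[OF W(1)] by (auto simp: M'_def)
      next
        fix u w assume "u \<in> M'" "w \<in> M'"
        then have a: "u \<in> M" "w \<in> M" "vdiff x u \<in> W" "vdiff x w \<in> W" by (auto simp: M'_def)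
        have "vdiff x (u + w) = vdiff x u + vdiff x w"
          using xc Mc[OF a(1)] Mc[OF a(2)] by (simp add: mult_add_distrib_mat_vec) (intro eq_vecI, auto)
        then show "u + w \<in> M'" using a vec_subspaceD(4)[OF W(1)] vec_subspaceD(4)[OF M'(1)] by (auto simp: M'_def)
      next
        fix c u assume "u \<in> M'"
        then have a: "u \<in> M" "vdiff x u \<in> W" by (auto simp: M'_def)
        have "vdiff x (c \<cdot>\<^sub>v u) = c \<cdot>\<^sub>v vdiff x u"
          using xc Mc[OF a(1)] by (simp add: mult_mat_vec[of _ n n]) (intro eq_vecI, auto simp: algebra_simps)
        then show "c \<cdot>\<^sub>v u \<in> M'" using a vec_subspaceD(5)[OF W(1)] vec_subspaceD(5)[OF M'(1)] by (auto simp: M'_def)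
      qed
      moreover have "h *\<^sub>v w \<in> M'" if h: "h \<in> S 0" and w: "w \<in> M'" for h w
      proof -
        have w: "w \<in> M" "vdiff x w \<in> W" using w by (auto simp: M'_def)
        note wc = Mc[OF w(1)]
        have hc: "h \<in> carrier_mat n n" using h S by auto
        \<comment> \<open>Rewriting \<open>x * h\<close> as \<open>h * x * c\<close> brings
          \<open>h\<close> to the outside; the defect of \<open>c\<close> on \<open>w\<close> lies
          in \<open>W\<close> by the induction hypothesis.\<close>
        obtain c where c: "c = 1\<^sub>m n \<or> c \<in> S (Suc (m - Suc j))" "x * h = h * x * c"
          using comm[OF x h] by auto
        then have cc: "c \<in> carrier_mat n n" using S0 S(2) by auto
        have cw: "vdiff c w \<in> W"
          using c(1) IH[of c w] w vec_subspaceD(3)[OF W(1)] wc by auto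
        have cwc: "vdiff c w \<in> carrier_vec n" using Wc cw by auto
        have "x *\<^sub>v (h *\<^sub>v w) = (x * h) *\<^sub>v w" using xc hc wc by (simp add: assoc_mult_mat_vec)
        also have "\<dots> = h *\<^sub>v (x *\<^sub>v (c *\<^sub>v w))"
          unfolding c(2) using xc hc wc cc by (simp add: assoc_mult_mat_vec[of _ n n _ n])
        also have "c *\<^sub>v w = vdiff c w + w" using cc wc by (intro eq_vecI) auto
        also have "x *\<^sub>v (vdiff c w + w) = x *\<^sub>v vdiff c w + (vdiff x w + w)"
          unfolding mult_add_distrib_mat_vec[OF xc cwc wc] using xc wc by (intro arg_cong2[where f="(+)"] eq_vecI) auto
        also have "h *\<^sub>v \<dots> = h *\<^sub>v (x *\<^sub>v vdiff c w) + (h *\<^sub>v vdiff x w + h *\<^sub>v w)"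
          using hc xc wc cwc by (simp add: mult_add_distrib_mat_vec[of _ n n])
        finally have "vdiff x (h *\<^sub>v w) = h *\<^sub>v (x *\<^sub>v vdiff c w) + h *\<^sub>v vdiff x w"
          using hc xc wc cwc by (simp del: assoc_mult_mat_vec minus_mult_distrib_mat_vec mult_minus_distrib_mat_vec) (intro eq_vecI, auto)
        moreover have "h *\<^sub>v (x *\<^sub>v vdiff c w) \<in> W" "h *\<^sub>v vdiff x w \<in> W"
          using inv h x0 cw w by auto
        ultimately have "vdiff x (h *\<^sub>v w) \<in> W" using vec_subspaceD(4)[OF W(1)] by auto
        then show ?thesis using M'(2)[OF h w(1)] by (auto simp: M'_def)
      qed
      moreover have "\<not> M' \<subseteq> W"
      proof -
        obtain w where w: "w \<in> M" "w \<notin> W" using M'(3) by auto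
        have inM: "(vdiff x ^^ k) w \<in> M" for k
          using w(1) M'(2)[OF x0] vec_subspaceD(6)[OF M'(1)] by (induction k) auto
        have ex: "(vdiff x ^^ q) w \<in> W" using nilp[OF x0 Mc[OF w(1)]] vec_subspaceD(3)[OF W(1)] by simp
        \<comment> \<open>The iterates of \<open>w\<close> enter \<open>W\<close> at a first index;
          the one just before lies outside \<open>W\<close> and is fixed by \<open>x\<close> modulo
          \<open>W\<close>.\<close>
        define k where "k = (LEAST k. (vdiff x ^^ k) w \<in> W)"
        have k: "(vdiff x ^^ k) w \<in> W" unfolding k_def using ex by (rule LeastI)
        then have "k \<noteq> 0" using w(2) by (intro notI) auto
        then obtain k' where k': "k = Suc k'" by (cases k) auto
        then have "(vdiff x ^^ k') w \<notin> W"
          using not_less_Least[of k' "\<lambda>k. (vdiff x ^^ k) w \<in> W"] k_def by simp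
        moreover have "(vdiff x ^^ k') w \<in> M'" using inM k k' by (auto simp: M'_def)
        ultimately show ?thesis by blast
      qed
      ultimately have "P M'" by (auto simp: P_def)
      then have "card (lead_positions n M) \<le> card (lead_positions n M')" by (rule Mmin)
      moreover have "M' \<subseteq> M" by (auto simp: M'_def)
      ultimately have "M' = M" using card_lead_positions_less[OF \<open>vec_subspace n M'\<close> M'(1)] by fastforce
      then show "\<forall>w \<in> M. vdiff x w \<in> W" by (auto simp: M'_def)
    qed
  qed
  obtain v where v: "v \<in> M" "v \<notin> W" using M'(3) by auto
  have "\<forall>x \<in> S 0. vdiff x v \<in> W" using triv[of m] v by auto
  then show ?thesis using v Mc by blast
qed

section \<open>Transvections and the central root of a unitriangular group\<close>

unbundle no fps_syntax

text \<open>The scalar is kept apart from the two vectors so that a root subgroup is the range over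
  \<open>c\<close>. Orthogonality of \<open>f\<close> and \<open>v\<close> is not built in: it is
  derived later from the order \<open>p\<close>.\<close>

definition transvec :: "nat \<Rightarrow> 'a :: field \<Rightarrow> 'a vec \<Rightarrow> 'a vec \<Rightarrow> 'a mat" where
  "transvec n c v f = mat n n (\<lambda>(i, j). (if i = j then 1 else 0) + c * v $ i * f $ j)"

lemma transvec_carrier [simp]: "transvec n c v f \<in> carrier_mat n n"
  and transvec_dim [simp]: "dim_row (transvec n c v f) = n" "dim_col (transvec n c v f) = n"
  and transvec_index: "i < n \<Longrightarrow> j < n \<Longrightarrow> transvec n c v f $$ (i, j) = (if i = j then 1 else 0) + c * v $ i * f $ j"
  by (auto simp: transvec_def)

lemma transvec_zero: "transvec n 0 v f = 1\<^sub>m n"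
  by (auto simp: transvec_def)

lemma transvec_mult:
  assumes A: "A \<in> carrier_mat n n" and f: "f \<in> carrier_vec n" and ij: "i < n" "j < n"
  shows "(transvec n c v f * A) $$ (i, j) = A $$ (i, j) + c * v $ i * (\<Sum>k<n. f $ k * A $$ (k, j))"
proof -
  have "(transvec n c v f * A) $$ (i, j) = (\<Sum>k<n. ((if i = k then 1 else 0) + c * v $ i * f $ k) * A $$ (k, j))"
    using A ij by (auto simp: scalar_prod_def transvec_def lessThan_atLeast0)
  also have "\<dots> = (\<Sum>k<n. (if i = k then A $$ (k, j) else 0) + c * v $ i * (f $ k * A $$ (k, j)))"
    by (intro sum.cong) (auto simp: algebra_simps)
  finally show ?thesis using ij by (simp add: sum.distrib sum_distrib_left)
qed

lemma mult_transvec: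
  assumes A: "A \<in> carrier_mat n n" and v: "v \<in> carrier_vec n" and ij: "i < n" "j < n"
  shows "(A * transvec n c v f) $$ (i, j) = A $$ (i, j) + c * (\<Sum>k<n. A $$ (i, k) * v $ k) * f $ j"
proof -
  have "(A * transvec n c v f) $$ (i, j) = (\<Sum>k<n. A $$ (i, k) * ((if k = j then 1 else 0) + c * v $ k * f $ j))"
    using A ij by (auto simp: scalar_prod_def transvec_def lessThan_atLeast0)
  also have "\<dots> = (\<Sum>k<n. (if k = j then A $$ (i, k) else 0) + A $$ (i, k) * v $ k * (c * f $ j))"
    by (intro sum.cong) (auto simp: algebra_simps)
  finally show ?thesis using ij by (simp add: sum.distrib sum_distrib_right[symmetric])
qed

lemma vdiff_unit_vec:
  "Y \<in> carrier_mat n n \<Longrightarrow> i < n \<Longrightarrow> j < n \<Longrightarrow>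
    vdiff Y (unit_vec n j) $ i = Y $$ (i, j) - (if i = j then 1 else 0)"
  by (auto simp: index_unit_vec)

lemma scalar_prod_lessThan: "w \<in> carrier_vec n \<Longrightarrow> scalar_prod f w = (\<Sum>k<n. f $ k * w $ k)"
  by (auto simp: scalar_prod_def lessThan_atLeast0)

lemma transvec_transvec:
  assumes "f \<in> carrier_vec n" "w \<in> carrier_vec n" and ij: "i < n" "j < n"
  shows "(transvec n c v f * transvec n d w g) $$ (i, j) =
    (if i = j then 1 else 0) + c * v $ i * f $ j + d * w $ i * g $ j + c * d * scalar_prod f w * v $ i * g $ j"
proof -
  have eq: "(\<Sum>k<n. transvec n c v f $$ (i, k) * w $ k) =
    w $ i + c * v $ i * scalar_prod f w"
  proof -
    have "(\<Sum>k<n. transvec n c v f $$ (i, k) * w $ k) =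
    (\<Sum>k<n. (if i = k then w $ k else 0) + c * v $ i * (f $ k * w $ k))"
    using ij by (intro sum.cong) (auto simp: transvec_index algebra_simps)
    also have "\<dots> = w $ i + c * v $ i * scalar_prod f w"
      using ij assms by (simp add: sum.distrib sum_distrib_left scalar_prod_lessThan)
    finally show ?thesis .
  qed
  show ?thesis
    unfolding mult_transvec[OF transvec_carrier assms(2) ij] eq using ij by (simp add: transvec_index algebra_simps)
qed

lemma transvec_add:
  assumes "f \<in> carrier_vec n" "v \<in> carrier_vec n" "scalar_prod f v = 0"
  shows "transvec n c v f * transvec n d v f = transvec n (c + d) v f"
  using assms by (intro eq_matI) (auto simp: transvec_transvec transvec_index algebra_simps simp del: index_mult_mat(1))

text \<open>\<open>Z a b r\<close> plays the role of the elementary matrix with entry \<open>r\<close> at \<open>(a, b)\<close>, in an arbitrary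
  representation of the group of upper unitriangular matrices. The fixed spaces \<open>Wk\<close> form a full
  flag, so an element of the centre, being an iterated commutator of length \<open>n - 1\<close>, shifts the
  flag by \<open>n - 1\<close> steps and hence has rank one.\<close>

lemma central_root_rank_one:
  fixes Z :: "nat \<Rightarrow> nat \<Rightarrow> 'a :: field \<Rightarrow> 'a mat"
  assumes n: "n \<ge> 2" and p: "prime p" "of_nat p = (0 :: 'a)"
    and R: "1 \<in> R" "\<And>r. r \<in> R \<Longrightarrow> - r \<in> R" "\<And>r s. r \<in> R \<Longrightarrow> s \<in> R \<Longrightarrow> r * s \<in> R"
    and Z: "\<And>a b r. a < b \<Longrightarrow> b < n \<Longrightarrow> r \<in> R \<Longrightarrow> Z a b r \<in> carrier_mat n n"
    and inv: "\<And>a b r. a < b \<Longrightarrow> b < n \<Longrightarrow> r \<in> R \<Longrightarrow> Z a b r * Z a b (- r) = 1\<^sub>m n"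
    and pow: "\<And>a b r. a < b \<Longrightarrow> b < n \<Longrightarrow> r \<in> R \<Longrightarrow> Z a b r ^\<^sub>m p = 1\<^sub>m n"
    and comm1: "\<And>a b c r s. a < b \<Longrightarrow> b < c \<Longrightarrow> c < n \<Longrightarrow> r \<in> R \<Longrightarrow> s \<in> R \<Longrightarrow>
      Z a b r * Z b c s = Z b c s * Z a b r * Z a c (r * s)"
    and comm2: "\<And>a b c d r s. a < b \<Longrightarrow> b < n \<Longrightarrow> c < d \<Longrightarrow> d < n \<Longrightarrow> b \<noteq> c \<Longrightarrow> a \<noteq> d \<Longrightarrow>
      r \<in> R \<Longrightarrow> s \<in> R \<Longrightarrow> Z a b r * Z c d s = Z c d s * Z a b r"
    and rr: "rr \<in> R" "Z 0 (n - 1) rr \<noteq> 1\<^sub>m n"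
  shows "\<exists>v \<in> carrier_vec n. \<exists>f \<in> carrier_vec n. \<forall>r \<in> R. \<exists>c. Z 0 (n - 1) r = transvec n c v f"
proof -
  \<comment> \<open>\<open>b - a\<close> is the height of a positive root, and \<open>S j\<close>
    collects the root elements of height above \<open>j\<close>.\<close>
  define S where "S j = {Z a b r | a b r. a < b \<and> b < n \<and> j < b - a \<and> r \<in> R}" for j
  \<comment> \<open>The ascending series of fixed spaces: each consists of the vectors fixed modulo
    the preceding one.\<close>
  define Wk where "Wk = rec_nat {0\<^sub>v n} (\<lambda>_ W. {v \<in> carrier_vec n. \<forall>x \<in> S 0. vdiff x v \<in> W})"
  have Wk0: "Wk 0 = {0\<^sub>v n}"
    and WkS: "Wk (Suc k) = {v \<in> carrier_vec n. \<forall>x \<in> S 0. vdiff x v \<in> Wk k}" for k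
    by (auto simp: Wk_def)
  have Sc: "S 0 \<subseteq> carrier_mat n n" using Z by (auto simp: S_def)
  have inS: "Z a b r \<in> S 0" if "a < b" "b < n" "r \<in> R" for a b r
    using that by (auto simp: S_def)
  have dist: "vdiff x (u + w) = vdiff x u + vdiff x w" "vdiff x (c \<cdot>\<^sub>v u) = c \<cdot>\<^sub>v vdiff x u"
    if "x \<in> carrier_mat n n" "u \<in> carrier_vec n" "w \<in> carrier_vec n" for x u w c
    using that by (simp_all add: mult_add_distrib_mat_vec mult_mat_vec[of _ n n])
      ((intro eq_vecI, auto simp: algebra_simps)[1])+
  have dist0: "vdiff x (0\<^sub>v n) = 0\<^sub>v n" if "x \<in> carrier_mat n n" for x :: "'a mat"
    using that by auto
  have W: "vec_subspace n (Wk k)" for k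
  proof (induction k)
    case 0 show ?case unfolding Wk0 by (rule vec_subspace_zero)
  next
    case (Suc k)
    show ?case unfolding WkS
    proof (rule vec_subspaceI, goal_cases)
      case 2 show ?case using dist0 Sc vec_subspaceD(3)[OF Suc] by auto
    next
      case (3 u w)
      have "vdiff x (u + w) \<in> Wk k" if "x \<in> S 0" for x
        using 3 that dist(1)[of x u w] Sc vec_subspaceD(4)[OF Suc, of "vdiff x u" "vdiff x w"] by auto
      then show ?case using 3 by auto
    next
      case (4 c u) then show ?case using dist(2)[of _ u u] Sc vec_subspaceD(5)[OF Suc] by auto
    qed auto
  qed
  note Wc = vec_subspaceD(2)[OF W]
  have mono1: "Wk k \<subseteq> Wk (Suc k)" for k
  proof (induction k)
    case 0 show ?case unfolding WkS Wk0 using dist0 Sc by auto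
  next
    case (Suc k)
    then show ?case unfolding WkS[of "Suc k"] using WkS[of k] by auto
  qed
  have mono: "k \<le> l \<Longrightarrow> Wk k \<subseteq> Wk l" for k l
    using mono1 by (rule lift_Suc_mono_le)
  have inv_W: "x *\<^sub>v v \<in> Wk k" if "x \<in> S 0" "v \<in> Wk k" for x v k
  proof -
    have "vdiff x v \<in> Wk k" using that mono1 WkS by blast
    then have "vdiff x v + v \<in> Wk k" using vec_subspaceD(4)[OF W] that by auto
    moreover have "x \<in> carrier_mat n n" "v \<in> carrier_vec n" using that Sc Wc by auto
    then have "vdiff x v + v = x *\<^sub>v v" by (intro eq_vecI) auto
    ultimately show ?thesis by simp
  qed
  have strict: "Wk k \<subset> Wk (Suc k)" if "Wk k \<noteq> carrier_vec n" for k
  proof -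
    have "\<exists>v \<in> carrier_vec n. v \<notin> Wk k \<and> (\<forall>x \<in> S 0. vdiff x v \<in> Wk k)"
    proof (rule kolchin_step[where S = S and m = n and q = p, OF _ Sc _ _ _ W that])
      show "x *\<^sub>v w \<in> Wk k" if "x \<in> S 0" "w \<in> Wk k" for x w using inv_W that .
      show "S (Suc j) \<subseteq> S j" for j using Suc_lessD unfolding S_def by blast
      show "S n = {}" by (auto simp: S_def)
      show "(vdiff x ^^ p) w = 0\<^sub>v n" if "x \<in> S 0" "w \<in> carrier_vec n" for x w
        using that vdiff_nilpotent[OF p, of x n w] Z pow by (auto simp: S_def)
      show "\<exists>c. (c = 1\<^sub>m n \<or> c \<in> S (Suc j)) \<and> x * h = h * x * c" if x: "x \<in> S j" and h: "h \<in> S 0" for j x h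
      proof -
        obtain a b r where ab: "x = Z a b r" "a < b" "b < n" "j < b - a" "r \<in> R" using x by (auto simp: S_def)
        obtain c d s where cd: "h = Z c d s" "c < d" "d < n" "s \<in> R" using h by (auto simp: S_def)
        consider "b = c" | "a = d" | "b \<noteq> c" "a \<noteq> d" by blast
        then show ?thesis
        proof cases
          case 1
          then have "Z a d (r * s) \<in> S (Suc j)" unfolding S_def using ab cd R by fastforce
          then show ?thesis using comm1[of a b d r s] ab cd 1 by blast
        next
          case 2
          \<comment> \<open>The commutator relation is available in one order only, so here the
            correction is the inverse of the root element that it supplies.\<close>
          have m: "Z c b (- (s * r)) \<in> S (Suc j)" unfolding S_def using ab cd R 2 by fastforce
          have i: "Z c b (s * r) * Z c b (- (s * r)) = 1\<^sub>m n" using inv ab cd 2 R by auto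
          have car: "x \<in> carrier_mat n n" "h \<in> carrier_mat n n" "Z c b (s * r) \<in> carrier_mat n n"
            "Z c b (- (s * r)) \<in> carrier_mat n n" using Z ab cd 2 R by auto
          have "h * x = x * h * Z c b (s * r)" using comm1[of c a b s r] ab cd 2 by auto
          then have "h * x * Z c b (- (s * r)) = x * h * (Z c b (s * r) * Z c b (- (s * r)))"
            using car by (simp add: assoc_mult_mat[of _ n n _ n _ n])
          then have "x * h = h * x * Z c b (- (s * r))" using i car by simp
          then show ?thesis using m by blast
        next
          case 3
          then have "x * h = h * x" using comm2[of a b c d r s] ab cd by auto
          moreover have "x \<in> carrier_mat n n" "h \<in> carrier_mat n n" using Z ab cd by auto
          ultimately show ?thesis by (intro exI[of _ "1\<^sub>m n"]) auto
        qed
      qed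
    qed
    then obtain v where "v \<in> carrier_vec n" "v \<notin> Wk k" "\<forall>x \<in> S 0. vdiff x v \<in> Wk k" by blast
    then have "v \<in> Wk (Suc k)" "v \<notin> Wk k" using WkS by auto
    then show ?thesis using mono1 by blast
  qed
  \<comment> \<open>A root of height \<open>Suc h\<close> moves vectors down the flag by
    \<open>Suc h\<close> steps. If \<open>c\<close> is the commutator of \<open>x\<close> and
    \<open>y\<close>, the additive commutator of \<open>x - 1\<close> and \<open>y - 1\<close> is
    \<open>x y - y x = y x (c - 1)\<close>; the inverses of \<open>y\<close> and \<open>x\<close>
    then isolate \<open>c - 1\<close>.\<close>
  have height: "vdiff (Z a b r) v \<in> Wk k"
    if "b = a + Suc h" "b < n" "r \<in> R" "v \<in> Wk (k + Suc h)" for a b r v k h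
    using that
  proof (induction h arbitrary: a b r v k)
    case 0
    then show ?case using WkS[of k] inS[of a b r] by auto
  next
    case (Suc h)
    let ?b = "a + Suc h"
    let ?x = "Z a ?b r" and ?y = "Z ?b b 1" and ?c = "Z a b r"
    let ?x' = "Z a ?b (- r)" and ?y' = "Z ?b b (- 1)"
    have lt: "a < ?b" "?b < b" "?b < n" using Suc.prems by auto
    have car: "?x \<in> carrier_mat n n" "?y \<in> carrier_mat n n" "?c \<in> carrier_mat n n"
      "?x' \<in> carrier_mat n n" "?y' \<in> carrier_mat n n"
      using Z lt Suc.prems R by auto
    have vc: "v \<in> carrier_vec n" using Suc.prems Wc by auto
    have y0: "?y \<in> S 0" using inS lt Suc.prems R by auto
    have rel: "?x * ?y = ?y * ?x * ?c" using comm1[of a ?b b r 1] lt Suc.prems R by auto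
    have i: "?x' * ?x = 1\<^sub>m n" "?y' * ?y = 1\<^sub>m n"
      using inv[of a ?b "- r"] inv[of ?b b "-1"] lt Suc.prems R by auto
    define u where "u = vdiff ?x (vdiff ?y v) - vdiff ?y (vdiff ?x v)"
    have vy: "vdiff ?y v \<in> Wk (k + Suc h)"
      using Suc.prems y0 WkS[of "k + Suc h"] by auto
    have "vdiff ?x (vdiff ?y v) \<in> Wk k"
      by (rule Suc.IH[OF refl lt(3) Suc.prems(3) vy])
    moreover have "vdiff ?x v \<in> Wk (Suc k)"
      by (rule Suc.IH[OF refl lt(3) Suc.prems(3)]) (use Suc.prems in simp)
    then have "vdiff ?y (vdiff ?x v) \<in> Wk k" using y0 WkS[of k] by auto
    ultimately have u: "u \<in> Wk k" unfolding u_def by (rule vec_subspaceD(6)[OF W])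
    have xv: "?x *\<^sub>v v \<in> carrier_vec n" "?y *\<^sub>v v \<in> carrier_vec n" "?c *\<^sub>v v \<in> carrier_vec n"
      using car vc by auto
    have "u = ?x *\<^sub>v (?y *\<^sub>v v) - ?y *\<^sub>v (?x *\<^sub>v v)"
      unfolding u_def using car vc xv
      by (simp add: mult_minus_distrib_mat_vec[of _ n n] del: assoc_mult_mat_vec) (intro eq_vecI, auto)
    also have "?x *\<^sub>v (?y *\<^sub>v v) = (?x * ?y) *\<^sub>v v" using car vc by simp
    also have "\<dots> = ?y *\<^sub>v (?x *\<^sub>v (?c *\<^sub>v v))"
      unfolding rel using car vc by (simp add: assoc_mult_mat_vec[of _ n n _ n])
    also have "\<dots> - ?y *\<^sub>v (?x *\<^sub>v v) = ?y *\<^sub>v (?x *\<^sub>v vdiff ?c v)"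
      using car vc xv by (simp add: mult_minus_distrib_mat_vec[of _ n n] del: assoc_mult_mat_vec)
    finally have "?x' *\<^sub>v (?y' *\<^sub>v u) = ?x' *\<^sub>v (?y' *\<^sub>v (?y *\<^sub>v (?x *\<^sub>v vdiff ?c v)))" by simp
    also have "\<dots> = vdiff ?c v"
    proof -
      have d: "vdiff ?c v \<in> carrier_vec n" using xv vc by auto
      have "?y' *\<^sub>v (?y *\<^sub>v w) = w" if "w \<in> carrier_vec n" for w
        using assoc_mult_mat_vec[OF car(5,2) that] i that by simp
      moreover have "?x' *\<^sub>v (?x *\<^sub>v w) = w" if "w \<in> carrier_vec n" for w
        using assoc_mult_mat_vec[OF car(4,1) that] i that by simp
      ultimately show ?thesis using d car by auto
    qed
    finally have "vdiff ?c v = ?x' *\<^sub>v (?y' *\<^sub>v u)" by simp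
    moreover have "?x' \<in> S 0" "?y' \<in> S 0" using inS lt Suc.prems R by auto
    ultimately show ?case using inv_W u by simp
  qed
  have height': "vdiff (Z 0 (n - 1) r) v \<in> Wk k" if "r \<in> R" "v \<in> Wk (k + (n - 1))" for r v k
    using height[of "n - 1" 0 "n - 2" r v k] that n by (simp add: Suc_diff_Suc numeral_2_eq_2)
  \<comment> \<open>If the flag were complete after \<open>n - 1\<close> steps, every highest root
    element would act trivially, contrary to the choice of \<open>rr\<close>.\<close>
  have ne: "Wk (n - 1) \<noteq> carrier_vec n"
  proof
    assume eq: "Wk (n - 1) = carrier_vec n"
    let ?Y = "Z 0 (n - 1) rr"
    have Yc: "?Y \<in> carrier_mat n n" using Z n rr by auto
    have "?Y $$ (i, j) = 1\<^sub>m n $$ (i, j)" if "i < n" "j < n" for i j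
    proof -
      have "vdiff ?Y (unit_vec n j) \<in> Wk 0" using height'[of rr "unit_vec n j" 0] rr eq by auto
      then have "vdiff ?Y (unit_vec n j) = 0\<^sub>v n" using Wk0 by auto
      then have "vdiff ?Y (unit_vec n j) $ i = 0" using that by simp
      then show ?thesis using that vdiff_unit_vec[OF Yc that] by (auto split: if_splits)
    qed
    then have "?Y = 1\<^sub>m n" using Yc by (intro eq_matI) auto
    then show False using rr by simp
  qed
  have nej: "Wk j \<noteq> carrier_vec n" if "j \<le> n - 1" for j
    using ne mono[OF that] vec_subspaceD(1)[OF W, of "n - 1"] by auto
  \<comment> \<open>\<open>Wk 0, ..., Wk n\<close> grow strictly inside dimension \<open>n\<close>,
    so the dimension of \<open>Wk k\<close> is exactly \<open>k\<close>: \<open>Wk 1\<close> is a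
    line and \<open>Wk (n - 1)\<close> a hyperplane.\<close>
  have grow: "card (lead_positions n (Wk 1)) + m \<le> card (lead_positions n (Wk (Suc m)))" if "m \<le> n - 1" for m
    using that
  proof (induction m)
    case (Suc m)
    have "card (lead_positions n (Wk (Suc m))) < card (lead_positions n (Wk (Suc (Suc m))))"
      by (rule card_lead_positions_less[OF W W strict[OF nej]]) (use Suc in simp)
    then show ?case using Suc by simp
  qed auto
  have pos: "card (lead_positions n (Wk 1)) \<ge> 1"
    using card_lead_positions_less[OF W W strict[OF nej], of 0] by simp
  have full: "Wk n = carrier_vec n"
  proof (rule ccontr)
    assume "Wk n \<noteq> carrier_vec n"
    then have "Wk n \<subset> carrier_vec n" using vec_subspaceD(1)[OF W] by blast
    from card_lead_positions_less[OF W vec_subspace_carrier this] have "card (lead_positions n (Wk n)) < n"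
      using card_lead_positions_le[of n "carrier_vec n :: 'a vec set"] by simp
    then show False using grow[of "n - 1"] pos n by simp
  qed
  have one: "card (lead_positions n (Wk 1)) \<le> 1"
    using grow[of "n - 1"] card_lead_positions_le[of n "Wk (Suc (n - 1))"] n by simp
  have hyp: "n \<le> Suc (card (lead_positions n (Wk (n - 1))))"
  proof -
    have *: "n - 2 \<le> n - 1" "Suc (n - 2) = n - 1" using n by auto
    show ?thesis using grow[OF *(1), unfolded *(2)] pos n by linarith
  qed
  obtain l where l: "l \<in> Wk 1" "l \<noteq> 0\<^sub>v n" using strict[OF nej, of 0] Wk0 by auto
  have lc: "l \<in> carrier_vec n" using Wc l by blast
  obtain e where e: "e \<in> carrier_vec n" "e \<notin> Wk (n - 1)"
    using ne vec_subspaceD(1)[OF W, of "n - 1"] by auto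
  have "\<forall>j. \<exists>c w. w \<in> Wk (n - 1) \<and> unit_vec n j = w + c \<cdot>\<^sub>v e"
    using complement_line[OF W hyp e unit_vec_carrier] by metis
  then obtain cc ww where cw: "\<And>j. ww j \<in> Wk (n - 1)" "\<And>j. unit_vec n j = ww j + cc j \<cdot>\<^sub>v e"
    by metis
  \<comment> \<open>\<open>f\<close> is the functional with kernel \<open>Wk (n - 1)\<close> that
    takes the value 1 at \<open>e\<close>; its coordinates are the coefficients of \<open>e\<close>
    in the unit vectors.\<close>
  define f where "f = vec n cc"
  show ?thesis
  proof (rule bexI[of _ l], rule bexI[of _ f], rule ballI)
    show "l \<in> carrier_vec n" "f \<in> carrier_vec n" using lc by (auto simp: f_def)
    fix r assume r: "r \<in> R"
    let ?Y = "Z 0 (n - 1) r"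
    have Yc: "?Y \<in> carrier_mat n n" using Z n r by auto
    have "vdiff ?Y e \<in> Wk 1" using height'[of r e 1] r e full n by auto
    then obtain k where k: "vdiff ?Y e = k \<cdot>\<^sub>v l"
      using line_if_card_lead_positions_le_1[OF W one l] by blast
    have "?Y = transvec n k l f"
    proof (rule eq_matI)
      fix i j assume "i < dim_row (transvec n k l f)" "j < dim_col (transvec n k l f)"
      then have ij: "i < n" "j < n" by auto
      have "vdiff ?Y (ww j) \<in> Wk 0" using height'[of r "ww j" 0] r cw by auto
      then have "vdiff ?Y (ww j) = 0\<^sub>v n" using Wk0 by auto
      moreover have "cc j \<cdot>\<^sub>v e \<in> carrier_vec n" using e by simp
      note dist(1)[OF Yc Wc[OF cw(1)[of j]] this]
      ultimately have "vdiff ?Y (unit_vec n j) = cc j \<cdot>\<^sub>v (k \<cdot>\<^sub>v l)"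
        unfolding cw(2) using dist(2)[OF Yc e(1) e(1)] k lc by simp
      then have "vdiff ?Y (unit_vec n j) $ i = cc j * k * l $ i" using ij lc by simp
      then show "?Y $$ (i, j) = transvec n k l f $$ (i, j)"
        using ij vdiff_unit_vec[OF Yc ij] by (auto simp: transvec_index f_def algebra_simps split: if_splits)
    qed (use Yc in auto)
    then show "\<exists>c. ?Y = transvec n c l f" by blast
  qed
qed

section \<open>Unimodular vectors and elementary matrices\<close>

text \<open>Taking \<open>m\<close> differences of the sequence \<open>(1 + x) ^ k\<close>
  multiplies it by \<open>x ^ m\<close>, so \<open>x ^ p = (1 + x) ^ p - 1\<close>. Thus
  characteristic \<open>p\<close> has no nontrivial \<open>p\<close>-th roots of unity.\<close>

lemma frobenius_zero:
  fixes x :: "'a :: idom"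
  assumes p: "prime p" "of_nat p = (0 :: 'a)" and x: "(1 + x) ^ p = 1"
  shows "x = 0"
proof -
  have "((\<lambda>b k. b (Suc k) - b k) ^^ m) (\<lambda>k. (1 + x) ^ k) k = x ^ m * (1 + x) ^ k" for m k
    by (induction m arbitrary: k) (auto simp: algebra_simps)
  from this[of p 0] have "x ^ p = (1 + x) ^ p - 1"
    using iterated_difference_char[OF p, of "\<lambda>k. (1 + x) ^ k" 0] by simp
  then show ?thesis using x by auto
qed

lemma det_pow: "A \<in> carrier_mat n n \<Longrightarrow> det (A ^\<^sub>m k) = det A ^ k"
  by (induction k) (auto simp: det_mult[of _ n])

lemma unit_vec_index: "k < n \<Longrightarrow> unit_vec n i $ k = (if k = i then 1 else 0)"
  by (simp add: unit_vec_def)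

lemma sum_unit_vec:
  assumes "i < n"
  shows "(\<Sum>k<n. g k * unit_vec n i $ k) = (g i :: 'a :: semiring_1)"
    "(\<Sum>k<n. unit_vec n i $ k * g k) = g i"
proof -
  have "(\<Sum>k<n. g k * unit_vec n i $ k) = (\<Sum>k<n. if k = i then g k else 0)"
    "(\<Sum>k<n. unit_vec n i $ k * g k) = (\<Sum>k<n. if k = i then g k else 0)"
    by ((rule sum.cong, simp, simp add: unit_vec_index)+)
  then show "(\<Sum>k<n. g k * unit_vec n i $ k) = g i" "(\<Sum>k<n. unit_vec n i $ k * g k) = g i"
    using assms by simp_all
qed

lemma nonzero_vec_index:
  assumes "v \<in> carrier_vec n" "v \<noteq> 0\<^sub>v n"
  shows "\<exists>i<n. v $ i \<noteq> 0"
proof (rule ccontr)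
  assume "\<not> ?thesis"
  then have "v = 0\<^sub>v n" using assms(1) by (intro eq_vecI) auto
  then show False using assms(2) by simp
qed

section \<open>Elementary matrices and their commutators\<close>

definition elem_mat :: "nat \<Rightarrow> nat \<Rightarrow> nat \<Rightarrow> 'a :: field \<Rightarrow> 'a mat" where
  "elem_mat n i j r = transvec n r (unit_vec n i) (unit_vec n j)"

lemma elem_mat_carrier [simp]: "elem_mat n i j r \<in> carrier_mat n n"
  and elem_mat_dim [simp]: "dim_row (elem_mat n i j r) = n" "dim_col (elem_mat n i j r) = n"
  by (auto simp: elem_mat_def)

lemma elem_mat_index: "a < n \<Longrightarrow> b < n \<Longrightarrow> elem_mat n i j r $$ (a, b) =
    (if a = b then 1 else 0) + (if a = i \<and> b = j then r else 0)"
  by (auto simp: elem_mat_def transvec_index unit_vec_index)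

lemma elem_mat_zero: "elem_mat n i j 0 = 1\<^sub>m n"
  by (simp add: elem_mat_def transvec_zero)

lemma elem_mat_eq_addrow: "i \<noteq> j \<Longrightarrow> elem_mat n i j r = addrow_mat n r i j"
  by (intro eq_matI) (auto simp: elem_mat_index)

lemma det_elem_mat: "i \<noteq> j \<Longrightarrow> det (elem_mat n i j r) = 1"
  by (simp add: elem_mat_eq_addrow det_addrow_mat)

lemma scalar_prod_unit_vecs:
  "i < n \<Longrightarrow> scalar_prod (unit_vec n i) (unit_vec n j) = (if i = j then 1 else (0 :: 'a :: field))"
  using scalar_prod_left_unit[of "unit_vec n j" n i] by (simp add: unit_vec_index)

lemma elem_mat_add:
  assumes "i < n" "j < n" "i \<noteq> j"
  shows "elem_mat n i j r * elem_mat n i j s = elem_mat n i j (r + s)"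
  unfolding elem_mat_def using assms by (intro transvec_add) (auto simp: scalar_prod_unit_vecs)

lemma elem_mat_mult_index:
  assumes "a < n" "b < n" "j < n"
  shows "(elem_mat n i j r * elem_mat n k l s) $$ (a, b) = (if a = b then 1 else 0) +
    (if a = i \<and> b = j then r else 0) + (if a = k \<and> b = l then s else 0) +
    (if j = k \<and> a = i \<and> b = l then r * s else 0)"
  unfolding elem_mat_def using assms by (subst transvec_transvec) (auto simp: scalar_prod_unit_vecs unit_vec_index)

lemma elem_mat_commute:
  assumes "i < n" "j < n" "k < n" "l < n" "j \<noteq> k" "i \<noteq> l"
  shows "elem_mat n i j r * elem_mat n k l s = elem_mat n k l s * elem_mat n i j r"
  using assms by (intro eq_matI) (auto simp: elem_mat_mult_index simp del: index_mult_mat(1))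

text \<open>Stated as \<open>x y = y x c\<close>, without inverses, so that a multiplicative map
  carries it over as it stands.\<close>

lemma elem_mat_commutator:
  assumes "i < n" "j < n" "k < n" "i \<noteq> j" "j \<noteq> k" "i \<noteq> k"
  shows "elem_mat n i j r * elem_mat n j k s = elem_mat n j k s * elem_mat n i j r * elem_mat n i k (r * s)"
proof -
  have m: "(A * elem_mat n i k t) $$ (a, b) = A $$ (a, b) + (if b = k then A $$ (a, i) * t else 0)"
    if "A \<in> carrier_mat n n" "a < n" "b < n" for A a b and t :: 'a
    unfolding elem_mat_def mult_transvec[OF that(1) unit_vec_carrier that(2,3)] sum_unit_vec(1)[OF assms(1)]
    using that by (simp add: unit_vec_index)
  have P: "elem_mat n j k s * elem_mat n i j r \<in> carrier_mat n n"
    by (rule mult_carrier_mat[OF elem_mat_carrier elem_mat_carrier])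
  show ?thesis
    using assms by (intro eq_matI) (auto simp: m[OF P] elem_mat_mult_index simp del: index_mult_mat(1))
qed

text \<open>\<open>R\<close> is a set inside a field rather than a type: vectors and matrices live
  over the field, where linear algebra is available, and integrality is a separate condition
  (\<open>RV\<close>, \<open>RM\<close>). \<open>dl\<close> is the Euclidean function.\<close>

locale euclidean_subring =
  fixes R :: "'a :: field set" and dl :: "'a \<Rightarrow> nat" and n p :: nat
  assumes R_zero [simp]: "0 \<in> R" and R_one [simp]: "1 \<in> R"
    and R_uminus [simp]: "x \<in> R \<Longrightarrow> - x \<in> R"
    and R_add [simp]: "x \<in> R \<Longrightarrow> y \<in> R \<Longrightarrow> x + y \<in> R"
    and R_mult [simp]: "x \<in> R \<Longrightarrow> y \<in> R \<Longrightarrow> x * y \<in> R"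
    and R_div: "x \<in> R \<Longrightarrow> y \<in> R \<Longrightarrow> y \<noteq> 0 \<Longrightarrow> \<exists>q \<in> R. x - q * y = 0 \<or> dl (x - q * y) < dl y"
    and p: "prime p" and char: "of_nat p = (0 :: 'a)" and n: "n \<ge> 3"
begin

lemma R_diff [simp]: "x \<in> R \<Longrightarrow> y \<in> R \<Longrightarrow> x - y \<in> R"
  using R_add[of x "- y"] R_uminus[of y] by simp

lemma R_sum: "(\<And>i. i \<in> I \<Longrightarrow> f i \<in> R) \<Longrightarrow> sum f I \<in> R"
  by (induction I rule: infinite_finite_induct) auto

lemma R_power [simp]: "x \<in> R \<Longrightarrow> x ^ k \<in> R"
  by (induction k) auto

definition RM :: "'a mat set" where
  "RM = {A \<in> carrier_mat n n. \<forall>i<n. \<forall>j<n. A $$ (i, j) \<in> R}"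

definition RV :: "'a vec set" where
  "RV = {v \<in> carrier_vec n. \<forall>i<n. v $ i \<in> R}"

text \<open>The entries generate the unit ideal. Such vectors are normalised representatives of
  lines, determined up to units of \<open>R\<close>.\<close>

definition unimodular :: "'a vec \<Rightarrow> bool" where
  "unimodular v \<longleftrightarrow> v \<in> RV \<and> (\<exists>w \<in> RV. scalar_prod w v = 1)"

lemma RM_carrier: "A \<in> RM \<Longrightarrow> A \<in> carrier_mat n n" by (auto simp: RM_def)
lemma RV_carrier: "v \<in> RV \<Longrightarrow> v \<in> carrier_vec n" by (auto simp: RV_def)
lemma unimodular_RV: "unimodular v \<Longrightarrow> v \<in> RV" by (auto simp: unimodular_def)
lemma unimodular_carrier: "unimodular v \<Longrightarrow> v \<in> carrier_vec n" by (auto simp: unimodular_def RV_def)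

lemma unit_vec_RV: "unit_vec n i \<in> RV" by (auto simp: RV_def unit_vec_def)

lemma scalar_prod_RV: "v \<in> RV \<Longrightarrow> w \<in> RV \<Longrightarrow> scalar_prod v w \<in> R"
  by (auto simp: RV_def scalar_prod_def intro!: R_sum)

lemma unimodular_unit_vec: "i < n \<Longrightarrow> unimodular (unit_vec n i)"
  unfolding unimodular_def using unit_vec_RV by (auto intro!: bexI[of _ "unit_vec n i"])

lemma unimodular_nonzero: "unimodular v \<Longrightarrow> v \<noteq> 0\<^sub>v n"
  by (auto simp: unimodular_def RV_def)

lemma unimodular_scale:
  assumes "unimodular u" "c \<cdot>\<^sub>v u \<in> RV"
  shows "c \<in> R"
proof -
  obtain w where w: "w \<in> RV" "scalar_prod w u = 1" using assms by (auto simp: unimodular_def)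
  have "scalar_prod w (c \<cdot>\<^sub>v u) = c"
    using w assms by (simp add: unimodular_def RV_def scalar_prod_smult_distrib[of w n u])
  then show ?thesis using scalar_prod_RV[OF w(1) assms(2)] by simp
qed

text \<open>\<open>d\<close> is a greatest common divisor of the entries: an element of least
  \<open>dl\<close> in the ideal generated by them divides each entry, since a nonzero remainder
  would have smaller \<open>dl\<close>.\<close>

lemma unimodular_decomp:
  assumes v: "v \<in> RV" "v \<noteq> 0\<^sub>v n"
  shows "\<exists>d u. d \<in> R \<and> d \<noteq> 0 \<and> unimodular u \<and> v = d \<cdot>\<^sub>v u"
proof -
  have vc: "v \<in> carrier_vec n" using v RV_carrier by blast
  define I where "I = {scalar_prod w v | w. w \<in> RV}"
  have vi: "v $ i \<in> I" if "i < n" for i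
    unfolding I_def using that vc unit_vec_RV[of i]
    by (auto intro!: exI[of _ "unit_vec n i"] simp: scalar_prod_left_unit)
  have "\<exists>i<n. v $ i \<noteq> 0" using nonzero_vec_index[OF vc v(2)] .
  then obtain d0 where "d0 \<in> I \<and> d0 \<noteq> 0" using vi by blast
  then obtain d where d: "d \<in> I" "d \<noteq> 0" and dmin: "\<And>y. y \<in> I \<and> y \<noteq> 0 \<Longrightarrow> dl d \<le> dl y"
    using ex_has_least_nat[of "\<lambda>d. d \<in> I \<and> d \<noteq> 0" d0 dl] by blast
  obtain w where w: "w \<in> RV" "d = scalar_prod w v" using d by (auto simp: I_def)
  have dR: "d \<in> R" using scalar_prod_RV[OF w(1) v(1)] w by simp
  have "\<exists>q \<in> R. v $ i = q * d" if i: "i < n" for i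
  proof -
    have "v $ i \<in> R" using v i by (auto simp: RV_def)
    then obtain q where q: "q \<in> R" "v $ i - q * d = 0 \<or> dl (v $ i - q * d) < dl d"
      using R_div dR d by blast
    have "v $ i - q * d = scalar_prod (unit_vec n i - q \<cdot>\<^sub>v w) v"
      using i vc RV_carrier[OF w(1)] unfolding w(2)
      by (simp add: minus_scalar_prod_distrib[of _ n] smult_scalar_prod_distrib[of _ n])
    moreover have "unit_vec n i - q \<cdot>\<^sub>v w \<in> RV"
      using w(1) q unit_vec_RV[of i] by (auto simp: RV_def)
    ultimately have "v $ i - q * d \<in> I" by (auto simp: I_def)
    then have "v $ i - q * d = 0" using dmin q by fastforce
    then show ?thesis using q by (intro bexI[of _ q]) auto
  qed
  then obtain q where q: "\<And>i. i < n \<Longrightarrow> q i \<in> R" "\<And>i. i < n \<Longrightarrow> v $ i = q i * d" by metis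
  define u where "u = vec n q"
  have u: "u \<in> RV" using q by (auto simp: u_def RV_def)
  have eq: "v = d \<cdot>\<^sub>v u" using q vc by (auto simp: u_def intro!: eq_vecI)
  have "d * scalar_prod w u = d * 1"
    using w u unfolding eq by (simp add: RV_def scalar_prod_smult_distrib[of w n u])
  then have "scalar_prod w u = 1" using d by simp
  then show ?thesis using u w eq d dR unfolding unimodular_def by blast
qed

text \<open>\<open>unimodular_scale\<close> is used twice: in each row it removes \<open>g\<close>,
  and then it removes \<open>u\<close>.\<close>

lemma transvec_RM_scale:
  assumes u: "unimodular u" and g: "unimodular g" and A: "transvec n c u g \<in> RM"
  shows "c \<in> R"
proof -
  have "c * u $ i \<in> R" if i: "i < n" for i
  proof (rule unimodular_scale[OF g])
    have "c * u $ i * g $ j \<in> R" if j: "j < n" for j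
    proof -
      have "transvec n c u g $$ (i, j) - (if i = j then 1 else 0) \<in> R"
        using A i j by (intro R_diff) (auto simp: RM_def)
      then show ?thesis using i j by (simp add: transvec_index)
    qed
    then show "(c * u $ i) \<cdot>\<^sub>v g \<in> RV" using unimodular_carrier[OF g] by (auto simp: RV_def)
  qed
  then have "c \<cdot>\<^sub>v u \<in> RV" using unimodular_carrier[OF u] by (auto simp: RV_def)
  then show ?thesis by (rule unimodular_scale[OF u])
qed

lemma transvec_RM: "c \<in> R \<Longrightarrow> u \<in> RV \<Longrightarrow> g \<in> RV \<Longrightarrow> transvec n c u g \<in> RM"
  by (auto simp: RM_def RV_def transvec_index intro!: R_add)

lemma elem_mat_RM: "r \<in> R \<Longrightarrow> elem_mat n i j r \<in> RM"
  unfolding elem_mat_def by (intro transvec_RM unit_vec_RV)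

lemma one_RM: "1\<^sub>m n \<in> RM" by (auto simp: RM_def)

lemma mult_RM: "A \<in> RM \<Longrightarrow> B \<in> RM \<Longrightarrow> A * B \<in> RM"
  by (auto simp: RM_def scalar_prod_def intro!: R_sum)

text \<open>The vectors of a central root element are known only over the field. A nonzero column
  and a nonzero row of the rank one part are integral; dividing each by its common divisor gives
  unimodular vectors, with one change of parameter that serves all \<open>c\<close>.\<close>

lemma transvec_unimodular_form:
  assumes l: "l \<in> carrier_vec n" and f: "f \<in> carrier_vec n"
    and A: "transvec n k l f \<in> RM" "transvec n k l f \<noteq> 1\<^sub>m n"
  shows "\<exists>u g. unimodular u \<and> unimodular g \<and> (\<forall>c. \<exists>c'. transvec n c l f = transvec n c' u g)"
proof -
  have N: "k * l $ i * f $ j \<in> R" if "i < n" "j < n" for i j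
  proof -
    have "transvec n k l f $$ (i, j) - (if i = j then 1 else 0) \<in> R"
      using A that by (intro R_diff) (auto simp: RM_def)
    then show ?thesis using that by (simp add: transvec_index)
  qed
  have "\<exists>a<n. \<exists>b<n. k * l $ a * f $ b \<noteq> 0"
  proof (rule ccontr)
    assume "\<not> ?thesis"
    then have "transvec n k l f = 1\<^sub>m n" by (intro eq_matI) (auto simp: transvec_index)
    then show False using A by simp
  qed
  then obtain a b where ab: "a < n" "b < n" "k * l $ a * f $ b \<noteq> 0" by blast
  define col where "col = vec n (\<lambda>i. k * l $ i * f $ b)"
  define row where "row = vec n (\<lambda>j. k * l $ a * f $ j)"
  have "col $ a \<noteq> 0" "row $ b \<noteq> 0" using ab by (auto simp: col_def row_def)
  then have ne: "col \<noteq> 0\<^sub>v n" "row \<noteq> 0\<^sub>v n" using ab by auto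
  have rv: "col \<in> RV" "row \<in> RV" using N ab by (auto simp: RV_def col_def row_def)
  obtain d u where u: "d \<noteq> 0" "unimodular u" "col = d \<cdot>\<^sub>v u" using unimodular_decomp[OF rv(1) ne(1)] by blast
  obtain e g where g: "e \<noteq> 0" "unimodular g" "row = e \<cdot>\<^sub>v g" using unimodular_decomp[OF rv(2) ne(2)] by blast
  have li: "l $ i = d / (k * f $ b) * u $ i" if "i < n" for i
  proof -
    have "col $ i = d * u $ i" using u that unimodular_carrier[of u] by auto
    then show ?thesis using ab that by (simp add: col_def field_simps)
  qed
  have fj: "f $ j = e / (k * l $ a) * g $ j" if "j < n" for j
  proof -
    have "row $ j = e * g $ j" using g that unimodular_carrier[of g] by auto
    then show ?thesis using ab that by (simp add: row_def field_simps)
  qed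
  have "transvec n c l f = transvec n (c * (d / (k * f $ b)) * (e / (k * l $ a))) u g" for c
    by (intro eq_matI) (auto simp: transvec_index li fj simp del: times_divide_eq_left times_divide_eq_right)
  then show ?thesis using u g by blast
qed

lemma transvec_pow:
  fixes v f :: "'a vec"
  assumes "f \<in> carrier_vec n" "v \<in> carrier_vec n" "scalar_prod f v = 0"
  shows "transvec n c v f ^\<^sub>m m = transvec n (of_nat m * c) v f"
proof (induction m)
  case 0 then show ?case by (simp add: transvec_zero)
next
  case (Suc m) then show ?case using transvec_add[OF assms] by (simp add: algebra_simps)
qed

lemma transvec_pow_p:
  fixes v f :: "'a vec"
  assumes "f \<in> carrier_vec n" "v \<in> carrier_vec n" "scalar_prod f v = 0"
  shows "transvec n c v f ^\<^sub>m p = 1\<^sub>m n"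
  unfolding transvec_pow[OF assms] char by (simp add: transvec_zero)

lemma eigenvalue_one_if_pow_p:
  fixes A :: "'a mat"
  assumes A: "A \<in> carrier_mat n n" and v: "v \<in> carrier_vec n" "v \<noteq> 0\<^sub>v n"
    and Av: "A *\<^sub>v v = t \<cdot>\<^sub>v v" and pow: "A ^\<^sub>m p = 1\<^sub>m n"
  shows "t = 1"
proof -
  have "A ^\<^sub>m m *\<^sub>v v = t ^ m \<cdot>\<^sub>v v" for m
  proof (induction m)
    case 0 then show ?case using v A by simp
  next
    case (Suc m)
    have Am: "A ^\<^sub>m m \<in> carrier_mat n n" using A by simp
    have "A ^\<^sub>m Suc m *\<^sub>v v = A ^\<^sub>m m *\<^sub>v (t \<cdot>\<^sub>v v)"
      using assoc_mult_mat_vec[OF Am A v(1)] Av by simp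
    also have "\<dots> = t \<cdot>\<^sub>v (A ^\<^sub>m m *\<^sub>v v)"
      using Am v by (simp add: mult_mat_vec[of _ n n])
    finally show ?case unfolding Suc by (simp add: smult_smult_assoc)
  qed
  from this[of p] have *: "v = t ^ p \<cdot>\<^sub>v v" using v pow by simp
  obtain i where i: "i < n" "v $ i \<noteq> 0" using nonzero_vec_index[OF v] by blast
  have "v $ i = t ^ p * v $ i" using i v by (subst *) simp
  then have "(1 + (t - 1)) ^ p = 1" using i by simp
  then have "t - 1 = 0" by (rule frobenius_zero[OF p char])
  then show ?thesis by simp
qed

lemma transvec_mult_vec:
  fixes v f :: "'a vec"
  assumes v: "v \<in> carrier_vec n" and w: "w \<in> carrier_vec n"
  shows "transvec n c v f *\<^sub>v w = w + (c * scalar_prod f w) \<cdot>\<^sub>v v"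
proof (rule eq_vecI)
  fix i assume i: "i < dim_vec (w + (c * scalar_prod f w) \<cdot>\<^sub>v v)"
  have "(transvec n c v f *\<^sub>v w) $ i = (\<Sum>k<n. (if i = k then w $ k else 0) + c * v $ i * (f $ k * w $ k))"
    using i v w by (auto simp: scalar_prod_def transvec_index lessThan_atLeast0 algebra_simps intro!: sum.cong)
  then show "(transvec n c v f *\<^sub>v w) $ i = (w + (c * scalar_prod f w) \<cdot>\<^sub>v v) $ i"
    using i v w by (simp add: sum.distrib scalar_prod_lessThan[of w n] sum_distrib_left algebra_simps)
qed (use v in auto)

text \<open>\<open>v\<close> is an eigenvector with eigenvalue
  \<open>1 + c * scalar_prod f v\<close>, and \<open>p\<close>-torsion leaves only the eigenvalue
  1.\<close>

lemma scalar_prod_zero_if_pow_p: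
  fixes v f :: "'a vec"
  assumes v: "v \<in> carrier_vec n" "v \<noteq> 0\<^sub>v n" and c: "c \<noteq> 0"
    and pow: "transvec n c v f ^\<^sub>m p = 1\<^sub>m n"
  shows "scalar_prod f v = 0"
proof -
  have "transvec n c v f *\<^sub>v v = (1 + c * scalar_prod f v) \<cdot>\<^sub>v v"
    unfolding transvec_mult_vec[OF v(1) v(1)] using v by (intro eq_vecI) (auto simp: algebra_simps)
  from eigenvalue_one_if_pow_p[OF transvec_carrier v this pow] show ?thesis using c by simp
qed

lemma transvec_nonzero:
  assumes "unimodular v" "unimodular f" "transvec n c v f = transvec n d v f"
  shows "c = d"
proof -
  obtain i where i: "i < n" "v $ i \<noteq> 0"
    using nonzero_vec_index[OF unimodular_carrier[OF assms(1)] unimodular_nonzero[OF assms(1)]] by blast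
  obtain j where j: "j < n" "f $ j \<noteq> 0"
    using nonzero_vec_index[OF unimodular_carrier[OF assms(2)] unimodular_nonzero[OF assms(2)]] by blast
  have "transvec n c v f $$ (i, j) = transvec n d v f $$ (i, j)" using assms by simp
  then show ?thesis using i j by (simp add: transvec_index)
qed

lemma double_centralizer:
  fixes Z :: "'a mat"
  assumes Z: "Z \<in> carrier_mat n n" and ij: "i < n" "j < n" "i \<noteq> j"
    and comm: "\<And>k l. k < n \<Longrightarrow> l < n \<Longrightarrow> k \<noteq> l \<Longrightarrow> k \<noteq> j \<Longrightarrow> l \<noteq> i \<Longrightarrow> Z * elem_mat n k l 1 = elem_mat n k l 1 * Z"
  shows "\<exists>c. Z = c \<cdot>\<^sub>m 1\<^sub>m n + Z $$ (i, j) \<cdot>\<^sub>m (elem_mat n i j 1 - 1\<^sub>m n)"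
proof -
  have *: "(if b = l then Z $$ (a, k) else 0) = (if a = k then Z $$ (l, b) else 0)"
    if kl: "k < n" "l < n" "k \<noteq> l" "k \<noteq> j" "l \<noteq> i" and ab: "a < n" "b < n" for k l a b
  proof -
    have "(Z * elem_mat n k l 1) $$ (a, b) = Z $$ (a, b) + (if b = l then Z $$ (a, k) else 0)"
      unfolding elem_mat_def mult_transvec[OF Z unit_vec_carrier ab] using kl ab
      by (auto simp: unit_vec_def if_distrib cong: if_cong)
    moreover have "(elem_mat n k l 1 * Z) $$ (a, b) = Z $$ (a, b) + (if a = k then Z $$ (l, b) else 0)"
      unfolding elem_mat_def transvec_mult[OF Z unit_vec_carrier ab] using kl ab
      by (auto simp: unit_vec_def if_distrib[of "\<lambda>x. x * _"] cong: if_cong)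
    ultimately show ?thesis using comm[OF kl] by simp
  qed
  have off: "Z $$ (a, k) = 0" if a: "a < n" "k < n" "a \<noteq> k" "(a, k) \<noteq> (i, j)" for a k
  proof (cases "k = j")
    case False
    have "\<exists>l<n. l \<noteq> k \<and> l \<noteq> i" using n by (intro exI[of _ "if k \<noteq> 0 \<and> i \<noteq> 0 then 0 else if k \<noteq> 1 \<and> i \<noteq> 1 then 1 else 2"]) auto
    then obtain l where l: "l < n" "l \<noteq> k" "l \<noteq> i" by blast
    then show ?thesis using *[of k l a l] a False by auto
  next
    case True
    then have ai: "a \<noteq> i" using a by auto
    have "\<exists>l<n. l \<noteq> a \<and> l \<noteq> j" using n by (intro exI[of _ "if a \<noteq> 0 \<and> j \<noteq> 0 then 0 else if a \<noteq> 1 \<and> j \<noteq> 1 then 1 else 2"]) auto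
    then obtain l where l: "l < n" "l \<noteq> a" "l \<noteq> j" by blast
    then show ?thesis using *[of l a l k] a ai by auto
  qed
  have d: "Z $$ (k, k) = Z $$ (l, l)" if "k < n" "l < n" "k \<noteq> l" "k \<noteq> j" "l \<noteq> i" for k l
    using *[of k l k l] that by auto
  have diag: "Z $$ (l, l) = Z $$ (i, i)" if "l < n" for l
    using d[of i l] that ij by (cases "l = i") auto
  have "Z = Z $$ (i, i) \<cdot>\<^sub>m 1\<^sub>m n + Z $$ (i, j) \<cdot>\<^sub>m (elem_mat n i j 1 - 1\<^sub>m n)"
    (is "_ = ?B")
  proof (rule eq_matI)
    fix a b assume "a < dim_row ?B" "b < dim_col ?B"
    then have ab: "a < n" "b < n" by auto
    show "Z $$ (a, b) = ?B $$ (a, b)"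
    proof (cases "a = b")
      case True
      then show ?thesis using ab ij diag[OF ab(1)] by (auto simp: elem_mat_index)
    next
      case False
      then show ?thesis using ab ij off[OF ab] by (auto simp: elem_mat_index)
    qed
  qed (use Z in auto)
  then show ?thesis by blast
qed

lemma third_index: "\<exists>k<n. k \<noteq> i \<and> k \<noteq> j"
  using n by (intro exI[of _ "if i \<noteq> 0 \<and> j \<noteq> 0 then 0 else if i \<noteq> 1 \<and> j \<noteq> 1 then 1 else 2"]) auto

end

text \<open>Renumbering turns an arbitrary root \<open>(i, j)\<close> into the highest root
  \<open>(0, n - 1)\<close>. Here \<open>j'\<close> is the index that the transposition of 0 and
  \<open>i\<close> sends to \<open>j\<close>.\<close>

lemma ex_bij_endpoints:
  fixes i j n :: nat
  assumes "i < n" "j < n" "i \<noteq> j"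
  shows "\<exists>\<pi>. inj \<pi> \<and> (\<forall>a<n. \<pi> a < n) \<and> \<pi> 0 = i \<and> \<pi> (n - 1) = j"
proof -
  define j' where "j' = transpose 0 i j"
  have j': "j' \<noteq> 0" "j' < n" using assms by (auto simp: j'_def transpose_def)
  define \<pi> where "\<pi> = transpose 0 i \<circ> transpose (n - 1) j'"
  have "inj \<pi>" unfolding \<pi>_def by (intro inj_compose) auto
  moreover have "\<forall>a<n. \<pi> a < n" using assms j' by (auto simp: \<pi>_def transpose_def)
  moreover have "\<pi> 0 = i" using assms j' by (auto simp: \<pi>_def transpose_def)
  moreover have "\<pi> (n - 1) = j" by (simp add: \<pi>_def j'_def)
  ultimately show ?thesis by blast
qed

section \<open>Images of root subgroups\<close>

definition parallel :: "'a :: field vec \<Rightarrow> 'a vec \<Rightarrow> bool" where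
  "parallel u v \<longleftrightarrow> (\<exists>c. c \<noteq> 0 \<and> u = c \<cdot>\<^sub>v v)"

lemma parallel_refl: "parallel u u"
  unfolding parallel_def by (intro exI[of _ 1]) simp

lemma parallel_sym: "parallel u v \<Longrightarrow> parallel v u"
  unfolding parallel_def by (metis (no_types, lifting) inverse_nonzero_iff_nonzero left_inverse one_smult_vec smult_smult_assoc)

lemma parallel_trans: "parallel u v \<Longrightarrow> parallel v w \<Longrightarrow> parallel u w"
  unfolding parallel_def by (metis no_zero_divisors smult_smult_assoc)

lemma add_zero_smult_vec:
  "w \<in> carrier_vec n \<Longrightarrow> v \<in> carrier_vec n \<Longrightarrow> w + (0 :: 'a :: field) \<cdot>\<^sub>v v = w"
  by (intro eq_vecI) auto

text \<open>\<open>G\<close> is any group between \<open>SL\<close> and \<open>GL\<close> over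
  \<open>R\<close>, given as a set of matrices, so that both cases share one proof.\<close>

locale matrix_aut = euclidean_subring R dl n p for R :: "'a :: field set" and dl and n p :: nat +
  fixes G :: "'a mat set" and \<phi> :: "'a mat \<Rightarrow> 'a mat"
  assumes G_RM: "A \<in> G \<Longrightarrow> A \<in> RM" and SL_G: "A \<in> RM \<Longrightarrow> det A = 1 \<Longrightarrow> A \<in> G"
    and G_mult: "A \<in> G \<Longrightarrow> B \<in> G \<Longrightarrow> A * B \<in> G"
    and G_inv: "A \<in> G \<Longrightarrow> \<exists>B \<in> G. A * B = 1\<^sub>m n \<and> B * A = 1\<^sub>m n"
    and phi_bij: "bij_betw \<phi> G G"
    and phi_mult: "A \<in> G \<Longrightarrow> B \<in> G \<Longrightarrow> \<phi> (A * B) = \<phi> A * \<phi> B"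
begin

lemma G_carrier: "A \<in> G \<Longrightarrow> A \<in> carrier_mat n n"
  using G_RM RM_carrier by blast

lemma one_G: "1\<^sub>m n \<in> G"
  using SL_G[OF one_RM] by simp

lemma pow_G: "A \<in> G \<Longrightarrow> A ^\<^sub>m k \<in> G"
  by (induction k) (use one_G G_mult G_carrier in auto)

lemma elem_mat_G: "i \<noteq> j \<Longrightarrow> r \<in> R \<Longrightarrow> elem_mat n i j r \<in> G"
  by (intro SL_G elem_mat_RM det_elem_mat)

lemma phi_G: "A \<in> G \<Longrightarrow> \<phi> A \<in> G"
  using phi_bij by (auto simp: bij_betw_def)

lemma phi_inj: "A \<in> G \<Longrightarrow> B \<in> G \<Longrightarrow> \<phi> A = \<phi> B \<Longrightarrow> A = B"
  using phi_bij by (auto simp: bij_betw_def inj_on_def)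

lemma phi_surj: "B \<in> G \<Longrightarrow> \<exists>A \<in> G. \<phi> A = B"
  using phi_bij unfolding bij_betw_def by (metis imageE)

lemma phi_one: "\<phi> (1\<^sub>m n) = 1\<^sub>m n"
proof -
  let ?e = "\<phi> (1\<^sub>m n)"
  have e: "?e \<in> G" using phi_G one_G by auto
  have ee: "?e * ?e = ?e" using phi_mult[OF one_G one_G] by simp
  obtain B where B: "B \<in> G" "?e * B = 1\<^sub>m n" using G_inv[OF e] by blast
  have c: "?e \<in> carrier_mat n n" "B \<in> carrier_mat n n" using G_carrier e B by auto
  have "?e * (?e * B) = ?e * ?e * B" using c by (simp add: assoc_mult_mat[of _ n n _ n _ n])
  then show ?thesis unfolding ee B(2) using c by simp
qed

lemma phi_pow: "A \<in> G \<Longrightarrow> \<phi> (A ^\<^sub>m k) = \<phi> A ^\<^sub>m k"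
proof (induction k)
  case 0
  then show ?case using phi_one G_carrier[OF 0] G_carrier[OF phi_G[OF 0]] by simp
next
  case (Suc k)
  then show ?case using phi_mult[OF pow_G] by simp
qed

text \<open>The determinant is a \<open>p\<close>-th root of unity, hence 1, so \<open>A\<close>
  lies in \<open>G\<close> even if \<open>G\<close> is only \<open>SL\<close>.\<close>

lemma pow_p_G:
  assumes A: "A \<in> RM" "A ^\<^sub>m p = 1\<^sub>m n"
  shows "A \<in> G"
proof (rule SL_G[OF A(1)])
  have "det A ^ p = 1" using det_pow[OF RM_carrier[OF A(1)], of p] A by simp
  then show "det A = 1" using frobenius_zero[OF p char, of "det A - 1"] by simp
qed

lemma elem_mat_pow_p:
  fixes r :: 'a
  assumes "i < n" "j < n" "i \<noteq> j"
  shows "elem_mat n i j r ^\<^sub>m p = 1\<^sub>m n"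
  unfolding elem_mat_def using assms by (intro transvec_pow_p) (auto simp: scalar_prod_unit_vecs)

lemma elem_mat_neq_one:
  assumes "i < n" "j < n" "i \<noteq> j" "r \<noteq> 0"
  shows "elem_mat n i j r \<noteq> 1\<^sub>m n"
proof
  assume "elem_mat n i j r = 1\<^sub>m n"
  then have "elem_mat n i j r $$ (i, j) = 1\<^sub>m n $$ (i, j)" by simp
  then show False using assms by (simp add: elem_mat_index)
qed

text \<open>Commuting with \<open>1 + k N\<close> for one nonzero \<open>k\<close> means commuting
  with \<open>N\<close>, hence with every \<open>1 + c N\<close>.\<close>

lemma commute_transvec_scale:
  assumes B: "B \<in> carrier_mat n n" and v: "v \<in> carrier_vec n" and f: "f \<in> carrier_vec n"
    and k: "k \<noteq> 0" and comm: "B * transvec n k v f = transvec n k v f * B"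
  shows "B * transvec n c v f = transvec n c v f * B"
proof (rule eq_matI)
  fix i j assume "i < dim_row (transvec n c v f * B)" "j < dim_col (transvec n c v f * B)"
  then have ij: "i < n" "j < n" using B by auto
  have "(B * transvec n k v f) $$ (i, j) = (transvec n k v f * B) $$ (i, j)" using comm by simp
  then have "(\<Sum>l<n. B $$ (i, l) * v $ l) * f $ j = v $ i * (\<Sum>l<n. f $ l * B $$ (l, j))"
    unfolding mult_transvec[OF B v ij] transvec_mult[OF B f ij] using k by (simp add: algebra_simps)
  then show "(B * transvec n c v f) $$ (i, j) = (transvec n c v f * B) $$ (i, j)"
    unfolding mult_transvec[OF B v ij] transvec_mult[OF B f ij] by (simp add: algebra_simps)
qed (use B in auto)

text \<open>After renumbering, the root is central in a unitriangular group, so its images are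
  transvections with common vectors. Conversely, a preimage \<open>Z\<close> of such a transvection
  commutes with all elementary matrices that commute with the root; so \<open>Z\<close> is a scalar
  plus a multiple of the nilpotent part of the root element, and \<open>Z ^ p = 1\<close> makes the
  scalar 1.\<close>

lemma root_image:
  assumes ij: "i < n" "j < n" "i \<noteq> j"
  shows "\<exists>v f. unimodular v \<and> unimodular f \<and> scalar_prod f v = 0 \<and>
    (\<lambda>r. \<phi> (elem_mat n i j r)) ` R = (\<lambda>c. transvec n c v f) ` R"
proof -
  obtain \<pi> where pi: "inj \<pi>" "\<forall>a<n. \<pi> a < n" "\<pi> 0 = i" "\<pi> (n - 1) = j"
    using ex_bij_endpoints[OF ij] by blast
  have pne: "a \<noteq> b \<Longrightarrow> \<pi> a \<noteq> \<pi> b" for a b using pi(1) by (auto simp: inj_def)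
  have plt: "a < n \<Longrightarrow> \<pi> a < n" for a using pi by blast
  have e1: "\<phi> (elem_mat n i j 1) \<noteq> 1\<^sub>m n"
  proof
    assume "\<phi> (elem_mat n i j 1) = 1\<^sub>m n"
    then have "elem_mat n i j (1 :: 'a) = 1\<^sub>m n"
      by (rule phi_inj[OF elem_mat_G[OF ij(3) R_one] one_G, unfolded phi_one])
    then show False using elem_mat_neq_one[OF ij, of "1 :: 'a"] by simp
  qed
  have ex0: "\<exists>v \<in> carrier_vec n. \<exists>f \<in> carrier_vec n. \<forall>r \<in> R. \<exists>c.
    \<phi> (elem_mat n (\<pi> 0) (\<pi> (n - 1)) r) = transvec n c v f"
  proof (rule central_root_rank_one[where R = R and Z = "\<lambda>a b r. \<phi> (elem_mat n (\<pi> a) (\<pi> b) r)" and rr = 1, OF _ p char])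
    fix a b r assume ab: "a < b" "b < n" and r: "r \<in> R"
    have E: "elem_mat n (\<pi> a) (\<pi> b) r \<in> G" "elem_mat n (\<pi> a) (\<pi> b) (- r) \<in> G"
      using elem_mat_G pne[of a b] ab r by auto
    show "\<phi> (elem_mat n (\<pi> a) (\<pi> b) r) \<in> carrier_mat n n" using E phi_G G_carrier by blast
    show "\<phi> (elem_mat n (\<pi> a) (\<pi> b) r) * \<phi> (elem_mat n (\<pi> a) (\<pi> b) (- r)) = 1\<^sub>m n"
      unfolding phi_mult[OF E, symmetric]
      using ab plt pne[of a b] phi_one by (simp add: elem_mat_add elem_mat_zero)
    show "\<phi> (elem_mat n (\<pi> a) (\<pi> b) r) ^\<^sub>m p = 1\<^sub>m n"
      unfolding phi_pow[OF E(1), symmetric] using ab plt pne[of a b] phi_one by (simp add: elem_mat_pow_p)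
  next
    fix a b c r s assume abc: "a < b" "b < c" "c < n" and rs: "r \<in> R" "s \<in> R"
    have E: "elem_mat n (\<pi> a) (\<pi> b) r \<in> G" "elem_mat n (\<pi> b) (\<pi> c) s \<in> G" "elem_mat n (\<pi> a) (\<pi> c) (r * s) \<in> G"
      using elem_mat_G pne[of a b] pne[of a c] pne[of b c] abc rs by auto
    show "\<phi> (elem_mat n (\<pi> a) (\<pi> b) r) * \<phi> (elem_mat n (\<pi> b) (\<pi> c) s) =
      \<phi> (elem_mat n (\<pi> b) (\<pi> c) s) * \<phi> (elem_mat n (\<pi> a) (\<pi> b) r) * \<phi> (elem_mat n (\<pi> a) (\<pi> c) (r * s))"
      using E abc plt pne[of a b] pne[of a c] pne[of b c]
      by (simp add: phi_mult[symmetric] G_mult elem_mat_commutator)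
  next
    fix a b c d r s assume *: "a < b" "b < n" "c < d" "d < n" "b \<noteq> c" "a \<noteq> d" and rs: "r \<in> R" "s \<in> R"
    have E: "elem_mat n (\<pi> a) (\<pi> b) r \<in> G" "elem_mat n (\<pi> c) (\<pi> d) s \<in> G"
      using elem_mat_G pne[of a b] pne[of c d] * rs by auto
    have "elem_mat n (\<pi> a) (\<pi> b) r * elem_mat n (\<pi> c) (\<pi> d) s = elem_mat n (\<pi> c) (\<pi> d) s * elem_mat n (\<pi> a) (\<pi> b) r"
      using * plt pne[of b c] pne[of a d] by (intro elem_mat_commute) auto
    from arg_cong[OF this, of \<phi>]
    show "\<phi> (elem_mat n (\<pi> a) (\<pi> b) r) * \<phi> (elem_mat n (\<pi> c) (\<pi> d) s) =
      \<phi> (elem_mat n (\<pi> c) (\<pi> d) s) * \<phi> (elem_mat n (\<pi> a) (\<pi> b) r)"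
      unfolding phi_mult[OF E] phi_mult[OF E(2,1)] .
  qed (use n e1 pi in simp_all)
  from ex0 obtain l h where lh: "l \<in> carrier_vec n" "h \<in> carrier_vec n"
    and ex: "\<And>r. r \<in> R \<Longrightarrow> \<exists>c. \<phi> (elem_mat n i j r) = transvec n c l h"
    unfolding pi by blast
  have rm: "r \<in> R \<Longrightarrow> \<phi> (elem_mat n i j r) \<in> RM" for r
    using phi_G[OF elem_mat_G] G_RM ij by blast
  obtain k where k: "\<phi> (elem_mat n i j 1) = transvec n k l h" using ex[of 1] by auto
  obtain v f where vf: "unimodular v" "unimodular f" "\<And>c. \<exists>c'. transvec n c l h = transvec n c' v f"
    using transvec_unimodular_form[OF lh, of k] rm[of 1] e1 k by force
  note vfc = unimodular_carrier[OF vf(1)] unimodular_carrier[OF vf(2)]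
  have sub: "\<exists>c \<in> R. \<phi> (elem_mat n i j r) = transvec n c v f" if "r \<in> R" for r
    using ex[OF that] vf(3) transvec_RM_scale[OF vf(1,2)] rm[OF that] by metis
  obtain k where k: "\<phi> (elem_mat n i j 1) = transvec n k v f" using sub[of 1] by auto
  have k0: "k \<noteq> 0" using e1 k by (auto simp: transvec_zero)
  have "transvec n k v f ^\<^sub>m p = 1\<^sub>m n"
    unfolding k[symmetric] phi_pow[OF elem_mat_G[OF ij(3) R_one], symmetric] elem_mat_pow_p[OF ij] by (rule phi_one)
  then have fv: "scalar_prod f v = 0"
    using scalar_prod_zero_if_pow_p[OF vfc(1) unimodular_nonzero[OF vf(1)] k0] by blast
  have "\<exists>r \<in> R. transvec n c v f = \<phi> (elem_mat n i j r)" if c: "c \<in> R" for c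
  proof -
    let ?y = "transvec n c v f"
    have yp: "?y ^\<^sub>m p = 1\<^sub>m n" by (rule transvec_pow_p[OF vfc(2,1) fv])
    have "?y \<in> G" by (rule pow_p_G[OF transvec_RM[OF c unimodular_RV[OF vf(1)] unimodular_RV[OF vf(2)]] yp])
    then obtain Z where Z: "Z \<in> G" "\<phi> Z = ?y" using phi_surj by blast
    \<comment> \<open>The image of \<open>elem_mat n a b 1\<close> commutes with the transvection of
      parameter \<open>k\<close>, hence with that of parameter \<open>c\<close>; injectivity pulls
      this back to \<open>Z\<close>.\<close>
    have comm: "Z * elem_mat n a b 1 = elem_mat n a b 1 * Z"
      if ab: "a < n" "b < n" "a \<noteq> b" "a \<noteq> j" "b \<noteq> i" for a b
    proof -
      have E: "elem_mat n a b 1 \<in> G" "elem_mat n i j 1 \<in> G" using elem_mat_G ab ij by auto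
      have "elem_mat n a b 1 * elem_mat n i j 1 = elem_mat n i j 1 * elem_mat n a b (1 :: 'a)"
        using ab ij by (intro elem_mat_commute) auto
      from arg_cong[OF this, of \<phi>]
      have "\<phi> (elem_mat n a b 1) * \<phi> (elem_mat n i j 1) = \<phi> (elem_mat n i j 1) * \<phi> (elem_mat n a b 1)"
        unfolding phi_mult[OF E] phi_mult[OF E(2,1)] .
      then have "\<phi> (elem_mat n a b 1) * ?y = ?y * \<phi> (elem_mat n a b 1)"
        unfolding k by (rule commute_transvec_scale[OF G_carrier[OF phi_G[OF E(1)]] vfc k0])
      then have "\<phi> (Z * elem_mat n a b 1) = \<phi> (elem_mat n a b 1 * Z)"
        unfolding phi_mult[OF Z(1) E(1)] phi_mult[OF E(1) Z(1)] Z(2) by (rule sym)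
      then show ?thesis by (rule phi_inj[OF G_mult[OF Z(1) E(1)] G_mult[OF E(1) Z(1)]])
    qed
    have Zc: "Z \<in> carrier_mat n n" using Z G_carrier by blast
    let ?a = "Z $$ (i, j)"
    obtain t where t: "Z = t \<cdot>\<^sub>m 1\<^sub>m n + ?a \<cdot>\<^sub>m (elem_mat n i j 1 - 1\<^sub>m n)"
      using double_centralizer[OF Zc ij comm] by blast
    have Zent: "Z $$ (a, b) = (if a = b then t else 0) + (if a = i \<and> b = j then ?a else 0)"
      if "a < n" "b < n" for a b
      using that ij by (subst t) (auto simp: elem_mat_index)
    have aR: "?a \<in> R" using G_RM[OF Z(1)] ij by (auto simp: RM_def)
    have "\<phi> (Z ^\<^sub>m p) = \<phi> (1\<^sub>m n)" using phi_pow[OF Z(1)] Z yp phi_one by simp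
    then have Zp: "Z ^\<^sub>m p = 1\<^sub>m n" by (rule phi_inj[OF pow_G[OF Z(1)] one_G])
    have "Z *\<^sub>v unit_vec n i = t \<cdot>\<^sub>v unit_vec n i"
    proof (rule eq_vecI)
      fix a assume a: "a < dim_vec (t \<cdot>\<^sub>v unit_vec n i)"
      then have "(Z *\<^sub>v unit_vec n i) $ a = Z $$ (a, i)" using Zc ij by auto
      then show "(Z *\<^sub>v unit_vec n i) $ a = (t \<cdot>\<^sub>v unit_vec n i) $ a"
        using Zent[of a i] a ij by (auto simp: unit_vec_index)
    qed (use Zc in auto)
    from eigenvalue_one_if_pow_p[OF Zc unit_vec_carrier unimodular_nonzero[OF unimodular_unit_vec[OF ij(1)]] this Zp]
    have "t = 1" .
    then have "Z = elem_mat n i j ?a"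
      using Zc Zent by (intro eq_matI) (auto simp: elem_mat_index)
    then show ?thesis using Z aR by metis
  qed
  then have "(\<lambda>r. \<phi> (elem_mat n i j r)) ` R = (\<lambda>c. transvec n c v f) ` R"
    using sub by (auto simp: image_iff)
  then show ?thesis using vf fv by blast
qed

text \<open>Subtracting \<open>y x\<close> from both sides of the relation leaves a combination of
  the rank one matrices of \<open>v, f'\<close> and of \<open>v', f\<close>, with coefficients
  proportional to \<open>?al\<close> and \<open>?be\<close>, equal to \<open>d\<close> times the
  rank one matrix of \<open>h, f''\<close>, where \<open>h = y x v''\<close>. Rank one forces
  exactly one of \<open>?al\<close> and \<open>?be\<close> to be nonzero.\<close>

lemma unipotent_commutator:
  assumes a: "a \<noteq> 0" and b: "b \<noteq> 0" and d: "d \<noteq> 0"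
    and v: "v \<in> carrier_vec n" "v \<noteq> 0\<^sub>v n" and f: "f \<in> carrier_vec n" "f \<noteq> 0\<^sub>v n"
    and v': "v' \<in> carrier_vec n" "v' \<noteq> 0\<^sub>v n" and f': "f' \<in> carrier_vec n" "f' \<noteq> 0\<^sub>v n"
    and v'': "v'' \<in> carrier_vec n" "v'' \<noteq> 0\<^sub>v n" and f'': "f'' \<in> carrier_vec n" "f'' \<noteq> 0\<^sub>v n"
    and orth: "scalar_prod f v = 0" "scalar_prod f' v' = 0"
    and G: "transvec n a v f \<in> G" "transvec n b v' f' \<in> G"
    and rel: "transvec n a v f * transvec n b v' f' = transvec n b v' f' * transvec n a v f * transvec n d v'' f''"
  shows "(scalar_prod f v' \<noteq> 0 \<and> scalar_prod f' v = 0 \<and> parallel v'' v \<and> parallel f'' f') \<or>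
    (scalar_prod f v' = 0 \<and> scalar_prod f' v \<noteq> 0 \<and> parallel v'' v' \<and> parallel f'' f)"
proof -
  let ?x = "transvec n a v f" and ?y = "transvec n b v' f'"
  let ?al = "scalar_prod f v'" and ?be = "scalar_prod f' v"
  define h where "h = (?y * ?x) *\<^sub>v v''"
  have yx: "?y * ?x \<in> G" by (intro G_mult G)
  note yxc = G_carrier[OF yx]
  have hc: "h \<in> carrier_vec n" using yxc v'' by (simp add: h_def)
  obtain W where W: "W \<in> G" "W * (?y * ?x) = 1\<^sub>m n" using G_inv[OF yx] by blast
  have inj: "u = w" if "(?y * ?x) *\<^sub>v u = (?y * ?x) *\<^sub>v w" "u \<in> carrier_vec n" "w \<in> carrier_vec n" for u w
  proof -
    have "W *\<^sub>v ((?y * ?x) *\<^sub>v u) = W *\<^sub>v ((?y * ?x) *\<^sub>v w)" using that by simp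
    then show ?thesis
      using assoc_mult_mat_vec[OF G_carrier[OF W(1)] yxc] W that by (metis one_mult_mat_vec)
  qed
  have h0: "h \<noteq> 0\<^sub>v n"
  proof
    assume "h = 0\<^sub>v n"
    then have "(?y * ?x) *\<^sub>v v'' = (?y * ?x) *\<^sub>v 0\<^sub>v n" using yxc by (auto simp: h_def)
    then show False using inj[OF _ v''(1)] v'' by auto
  qed
  have hi: "(\<Sum>k<n. (?y * ?x) $$ (i, k) * v'' $ k) = h $ i" if "i < n" for i
    using that v''(1) unfolding h_def by (auto simp: scalar_prod_def lessThan_atLeast0 simp del: index_mult_mat(1) intro!: sum.cong)
  have E: "a * b * ?al * v $ i * f' $ j - a * b * ?be * v' $ i * f $ j = d * h $ i * f'' $ j"
    if "i < n" "j < n" for i j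
  proof -
    have "(?x * ?y) $$ (i, j) = (?y * ?x) $$ (i, j) + d * h $ i * f'' $ j"
      unfolding rel mult_transvec[OF yxc v''(1) that] hi[OF that(1)] by simp
    then show ?thesis
      unfolding transvec_transvec[OF f(1) v'(1) that] transvec_transvec[OF f'(1) v(1) that] by (simp add: algebra_simps)
  qed
  have act: "(?y * ?x) *\<^sub>v w = ?y *\<^sub>v (?x *\<^sub>v w)" if "w \<in> carrier_vec n" for w
    using that by (intro assoc_mult_mat_vec[OF transvec_carrier transvec_carrier])
  have rank_one: "parallel h w \<and> parallel f'' g"
    if w: "w \<in> carrier_vec n" and g: "g \<in> carrier_vec n"
      and t: "t \<noteq> 0" and eq: "\<And>i j. i < n \<Longrightarrow> j < n \<Longrightarrow> t * w $ i * g $ j = d * h $ i * f'' $ j" for w g t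
  proof -
    obtain i0 where i0: "i0 < n" "h $ i0 \<noteq> 0" using nonzero_vec_index[OF hc h0] by blast
    obtain j0 where j0: "j0 < n" "f'' $ j0 \<noteq> 0" using nonzero_vec_index[OF f''] by blast
    have n0: "w $ i0 \<noteq> 0" "g $ j0 \<noteq> 0" using eq[OF i0(1) j0(1)] i0 j0 d by auto
    have "h = (t * g $ j0 / (d * f'' $ j0)) \<cdot>\<^sub>v w"
      using hc w eq[OF _ j0(1)] j0 d by (intro eq_vecI) (auto simp: field_simps)
    moreover have "f'' = (t * w $ i0 / (d * h $ i0)) \<cdot>\<^sub>v g"
      using f'' g eq[OF i0(1)] i0 d by (intro eq_vecI) (auto simp: field_simps)
    ultimately show ?thesis unfolding parallel_def using n0 t d i0 j0 by (metis divide_eq_0_iff no_zero_divisors)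
  qed
  \<comment> \<open>\<open>h\<close> is the image of \<open>v''\<close> under the invertible matrix
    \<open>y x\<close>; if \<open>h\<close> is parallel to a fixed vector \<open>w\<close>, so is
    \<open>v''\<close>.\<close>
  have pull: "parallel v'' w" if hw: "parallel h w" and that: "w \<in> carrier_vec n" "(?y * ?x) *\<^sub>v w = w" for w
  proof -
    obtain t where t: "t \<noteq> 0" "h = t \<cdot>\<^sub>v w" using hw by (auto simp: parallel_def)
    have "(?y * ?x) *\<^sub>v (t \<cdot>\<^sub>v w) = t \<cdot>\<^sub>v w"
      using mult_mat_vec[OF yxc that(1)] that(2) by simp
    then have "v'' = t \<cdot>\<^sub>v w" using inj[of v'' "t \<cdot>\<^sub>v w"] v'' that(1) t by (simp add: h_def)
    then show ?thesis using t by (auto simp: parallel_def)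
  qed
  consider "?al \<noteq> 0" "?be = 0" | "?al = 0" "?be \<noteq> 0" | "?al = 0" "?be = 0" | "?al \<noteq> 0" "?be \<noteq> 0" by blast
  then show ?thesis
  proof cases
    case 1
    have "(?y * ?x) *\<^sub>v v = v"
      unfolding act[OF v(1)] using transvec_mult_vec v v' f f' orth 1 by (simp add: add_zero_smult_vec)
    moreover have "parallel h v \<and> parallel f'' f'"
      by (rule rank_one[OF v(1) f'(1), of "a * b * ?al"]) (use E 1 a b in auto)
    ultimately show ?thesis using pull[OF _ v(1)] 1 by blast
  next
    case 2
    have "(?y * ?x) *\<^sub>v v' = v'"
      unfolding act[OF v'(1)] using transvec_mult_vec v v' f f' orth 2 by (simp add: add_zero_smult_vec)
    moreover have "parallel h v' \<and> parallel f'' f"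
      by (rule rank_one[OF v'(1) f(1), of "- (a * b * ?be)"]) (use E 2 a b in auto)
    ultimately show ?thesis using pull[OF _ v'(1)] 2 by blast
  next
    case 3
    obtain i0 where i0: "i0 < n" "h $ i0 \<noteq> 0" using nonzero_vec_index[OF hc h0] by blast
    obtain j0 where j0: "j0 < n" "f'' $ j0 \<noteq> 0" using nonzero_vec_index[OF f''] by blast
    from E[OF i0(1) j0(1)] show ?thesis using 3 i0 j0 d by simp
  next
    case 4
    \<comment> \<open>Pairing the identity \<open>E\<close> with \<open>v\<close> and with
      \<open>v'\<close> makes both vectors multiples of \<open>h\<close>, so they are parallel; then
      \<open>scalar_prod f v = 0\<close> contradicts \<open>?al \<noteq> 0\<close>.\<close>
    have Ew: "a * b * ?al * v $ i * scalar_prod f' w - a * b * ?be * v' $ i * scalar_prod f w =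
      d * h $ i * scalar_prod f'' w" if i: "i < n" and w: "w \<in> carrier_vec n" for i w
    proof -
      have "(\<Sum>j<n. (a * b * ?al * v $ i * f' $ j - a * b * ?be * v' $ i * f $ j) * w $ j) =
        (\<Sum>j<n. (d * h $ i * f'' $ j) * w $ j)" using E i by (intro sum.cong) auto
      then show ?thesis
        unfolding scalar_prod_lessThan[OF w]
        by (simp add: left_diff_distrib sum_subtractf sum_distrib_left mult.assoc)
    qed
    let ?t = "a * b * ?al * ?be"
    have t0: "?t \<noteq> 0" using 4 a b by simp
    have 1: "?t * v $ i = d * h $ i * scalar_prod f'' v" if "i < n" for i
      using Ew[OF that v(1)] orth by (simp add: algebra_simps)
    have 2: "- ?t * v' $ i = d * h $ i * scalar_prod f'' v'" if "i < n" for i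
      using Ew[OF that v'(1)] orth by (simp add: algebra_simps)
    let ?s = "scalar_prod f'' v" and ?s' = "scalar_prod f'' v'"
    have "?s \<noteq> 0"
    proof
      assume "?s = 0"
      then have "v = 0\<^sub>v n" using 1 t0 v by (intro eq_vecI) auto
      then show False using v by simp
    qed
    then have "v' $ i = (- ?s' / ?s) * v $ i" if "i < n" for i
    proof -
      have "?t * (?s * v' $ i) = - (?s * (- ?t * v' $ i))" by simp
      also have "\<dots> = - (?s' * (d * h $ i * ?s))" unfolding 2[OF that] by simp
      also have "\<dots> = ?t * (- ?s' * v $ i)" unfolding 1[OF that, symmetric] by simp
      finally have "?t * (?s * v' $ i) = ?t * (- ?s' * v $ i)" .
      then have "?s * v' $ i = - ?s' * v $ i" using t0 by (metis mult_left_cancel)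
      then show ?thesis using \<open>?s \<noteq> 0\<close> by (simp add: field_simps)
    qed
    then have "v' = (- ?s' / ?s) \<cdot>\<^sub>v v" using v v' by (intro eq_vecI) auto
    then have "?al = (- ?s' / ?s) * scalar_prod f v"
      using scalar_prod_smult_distrib[OF f(1) v(1)] by metis
    then show ?thesis using orth 4 by simp
  qed
qed

end

text \<open>\<open>L i j\<close> and \<open>H i j\<close> are the centre and the axis of the image of the \<open>(i, j)\<close>-th root
  subgroup, \<open>I h l\<close> means incidence. The two alternatives are the types of \<open>A \<mapsto> A\<close> and of
  \<open>A \<mapsto> (A\<^sup>-\<^sup>1)\<^sup>T\<close>.\<close>

lemma uniform_type:
  fixes L H :: "nat \<Rightarrow> nat \<Rightarrow> 'b" and n :: nat and I :: "'b \<Rightarrow> 'b \<Rightarrow> bool"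
  assumes n: "n \<ge> 3" and I: "\<And>i j. i < n \<Longrightarrow> j < n \<Longrightarrow> i \<noteq> j \<Longrightarrow> I (H i j) (L i j)"
    and alt: "\<And>i j k. i < n \<Longrightarrow> j < n \<Longrightarrow> k < n \<Longrightarrow> i \<noteq> j \<Longrightarrow> j \<noteq> k \<Longrightarrow> i \<noteq> k \<Longrightarrow>
      (\<not> I (H i j) (L j k) \<and> I (H j k) (L i j) \<and> L i k = L i j \<and> H i k = H j k) \<or>
      (I (H i j) (L j k) \<and> \<not> I (H j k) (L i j) \<and> L i k = L j k \<and> H i k = H i j)"
  shows "(\<forall>i<n. \<forall>j<n. \<forall>k<n. i \<noteq> j \<longrightarrow> j \<noteq> k \<longrightarrow> i \<noteq> k \<longrightarrow>
      \<not> I (H i j) (L j k) \<and> I (H j k) (L i j) \<and> L i k = L i j \<and> H i k = H j k) \<or>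
    (\<forall>i<n. \<forall>j<n. \<forall>k<n. i \<noteq> j \<longrightarrow> j \<noteq> k \<longrightarrow> i \<noteq> k \<longrightarrow>
      I (H i j) (L j k) \<and> \<not> I (H j k) (L i j) \<and> L i k = L j k \<and> H i k = H i j)"
proof -
  define D where "D i j k \<longleftrightarrow> i < n \<and> j < n \<and> k < n \<and> i \<noteq> j \<and> j \<noteq> k \<and> i \<noteq> k" for i j k
  \<comment> \<open>\<open>P\<close> marks the triples of identity type; the aim is that one such
    triple forces all.\<close>
  define P where "P i j k \<longleftrightarrow> \<not> I (H i j) (L j k)" for i j k
  have pos: "I (H j k) (L i j)" "L i k = L i j" "H i k = H j k" if "D i j k" "P i j k" for i j k
    using alt[of i j k] that by (auto simp: D_def P_def)
  have neg: "I (H i j) (L j k)" "\<not> I (H j k) (L i j)" "L i k = L j k" "H i k = H i j"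
    if "D i j k" "\<not> P i j k" for i j k
    using alt[of i j k] that by (auto simp: D_def P_def)
  have inc: "I (H i j) (L i j)" "I (H i k) (L i k)" "I (H j k) (L j k)" if "D i j k" for i j k
    using I that by (auto simp: D_def)
  have perm: "D i k j" "D j i k" if "D i j k" for i j k using that by (auto simp: D_def)
  \<comment> \<open>The type survives reordering of the triple (\<open>s1\<close>,
    \<open>s2\<close>) and replacement of its last index (\<open>s3\<close>). These moves lead from
    one triple to every other.\<close>
  have s1: "P i k j" if "D i j k" "P i j k" for i j k
    using pos[OF that] neg[OF perm(1)[OF that(1)]] that inc[OF that(1)] by (metis P_def)
  have s2: "P j i k" if "D i j k" "P i j k" for i j k
    using pos[OF that] neg[OF perm(2)[OF that(1)]] that inc[OF that(1)] by (metis P_def)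
  have s3: "P i j l" if d: "D i j k" and P: "P i j k" and d': "D i j l" and kl: "k \<noteq> l" for i j k l
  proof (rule ccontr)
    assume nP: "\<not> P i j l"
    have dd: "D i l j" "D l j k" "D j l k" "D j k l" "D k j l" using d d' kl by (auto simp: D_def)
    have "\<not> P i l j" using s1[OF dd(1)] nP by blast
    then have e: "L i j = L l j" using neg[OF dd(1)] by simp
    then have "I (H j k) (L l j)" using pos[OF d P] by simp
    then have "P l j k" using neg[OF dd(2)] by blast
    then have "P j l k" using s2[OF dd(2)] by blast
    then have "L j l = L j k" using pos[OF dd(3)] by simp
    moreover have "I (H i j) (L j l)" using neg[OF d' nP] by simp
    ultimately show False using P by (simp add: P_def)
  qed
  show ?thesis
  proof (cases "\<exists>i j k. D i j k \<and> P i j k")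
    case False
    then have "I (H i j) (L j k) \<and> \<not> I (H j k) (L i j) \<and> L i k = L j k \<and> H i k = H i j"
      if "D i j k" for i j k
      using neg[of i j k] that by metis
    then show ?thesis unfolding D_def by simp
  next
    case True
    then obtain i j k where ijk: "D i j k" "P i j k" by blast
    have r: "P j k i \<and> D j k i" "P k i j \<and> D k i j" if "D i j k" "P i j k" for i j k
      using that s1 s2 perm by meson+
    have c1: "\<exists>b c. D a b c \<and> P a b c" if a: "a < n" for a
    proof (cases "a = i \<or> a = j \<or> a = k")
      case True
      then show ?thesis using ijk r[OF ijk] by blast
    next
      case False
      then have "D i j a" using ijk a by (auto simp: D_def)
      then show ?thesis using s3[OF ijk] r(2)[of i j a] False by blast
    qed
    have c2: "\<exists>e. D a d e \<and> P a d e" if a: "a < n" and d: "d < n" "d \<noteq> a" for a d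
    proof -
      obtain b c where bc: "D a b c" "P a b c" using c1[OF a] by blast
      consider "d = b" | "d = c" | "d \<noteq> b" "d \<noteq> c" by blast
      then show ?thesis
      proof cases
        case 3
        then have "D a b d" using bc d by (auto simp: D_def)
        then show ?thesis using s3[OF bc] s1 perm 3 by blast
      qed (use bc s1[OF bc] perm in blast)+
    qed
    have "P a d g" if D: "D a d g" for a d g
    proof -
      obtain e where e: "D a d e" "P a d e" using c2[of a d] D by (auto simp: D_def)
      show ?thesis using s3[OF e D] e by (cases "e = g") auto
    qed
    then have "\<not> I (H a d) (L d g) \<and> I (H d g) (L a d) \<and> L a g = L a d \<and> H a g = H d g" if "D a d g" for a d g
      using pos[of a d g] that by (metis P_def)
    then show ?thesis unfolding D_def by simp
  qed
qed

section \<open>Coordinates for the image of a root system\<close>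

lemma parallel_scalar_prod_zero:
  assumes "parallel u u'" "parallel w w'" "u' \<in> carrier_vec n" "w' \<in> carrier_vec n"
  shows "scalar_prod u w = 0 \<longleftrightarrow> scalar_prod u' w' = 0"
  using assms by (auto simp: parallel_def)

text \<open>\<open>scalar_prod f w\<close> is the structure constant. It is 1 for elementary
  matrices; for the image frame it will be a unit that rescaling absorbs.\<close>

lemma transvec_commutator:
  assumes c: "v \<in> carrier_vec n" "w \<in> carrier_vec n" "f \<in> carrier_vec n" "g \<in> carrier_vec n"
    and orth: "scalar_prod f v = 0" "scalar_prod g v = 0"
  shows "transvec n a v f * transvec n b w g = transvec n b w g * transvec n a v f * transvec n (a * b * scalar_prod f w) v g"
proof (rule eq_matI)
  let ?yx = "transvec n b w g * transvec n a v f"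
  fix i j assume "i < dim_row (?yx * transvec n (a * b * scalar_prod f w) v g)"
    "j < dim_col (?yx * transvec n (a * b * scalar_prod f w) v g)"
  then have ij: "i < n" "j < n" by auto
  have yx: "?yx \<in> carrier_mat n n" by (rule mult_carrier_mat[OF transvec_carrier transvec_carrier])
  have "(\<Sum>k<n. ?yx $$ (i, k) * v $ k) =
    (\<Sum>k<n. (if i = k then v $ k else 0) + b * w $ i * (g $ k * v $ k) +
      a * v $ i * (f $ k * v $ k) + b * a * scalar_prod g v * w $ i * (f $ k * v $ k))"
    using c ij by (intro sum.cong refl) (subst transvec_transvec, auto simp: algebra_simps)
  also have "\<dots> = v $ i"
    using ij orth by (simp add: sum.distrib sum_distrib_left[symmetric] scalar_prod_lessThan[OF c(1), symmetric])
  finally have s: "(\<Sum>k<n. ?yx $$ (i, k) * v $ k) = v $ i" .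
  show "(transvec n a v f * transvec n b w g) $$ (i, j) = (?yx * transvec n (a * b * scalar_prod f w) v g) $$ (i, j)"
    unfolding mult_transvec[OF yx c(1) ij] s transvec_transvec[OF c(3,2) ij] transvec_transvec[OF c(4,1) ij]
    using orth by (simp add: algebra_simps)
qed auto

definition ring_aut :: "'a :: field set \<Rightarrow> ('a \<Rightarrow> 'a) \<Rightarrow> bool" where
  "ring_aut R \<rho> \<longleftrightarrow> bij_betw \<rho> R R \<and> \<rho> 1 = 1 \<and>
    (\<forall>x \<in> R. \<forall>y \<in> R. \<rho> (x + y) = \<rho> x + \<rho> y \<and> \<rho> (x * y) = \<rho> x * \<rho> y)"

text \<open>Parallel unimodular vectors differ by a factor in \<open>R\<close> in both directions,
  so a root subgroup depends only on its two projective points.\<close>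

lemma (in euclidean_subring) transvec_parallel_image:
  assumes pr: "unimodular v" "unimodular v'" "unimodular f" "unimodular f'" and parallel: "parallel v v'" "parallel f f'"
  shows "(\<lambda>c. transvec n c v f) ` R = (\<lambda>c. transvec n c v' f') ` R"
proof -
  have *: "(\<lambda>c. transvec n c v f) ` R \<subseteq> (\<lambda>c. transvec n c v' f') ` R"
    if pr: "unimodular v" "unimodular v'" "unimodular f" "unimodular f'" and parallel: "parallel v v'" "parallel f f'" for v v' f f'
  proof -
    obtain a where a: "v = a \<cdot>\<^sub>v v'" using parallel by (auto simp: parallel_def)
    obtain b where b: "f = b \<cdot>\<^sub>v f'" using parallel by (auto simp: parallel_def)
    have ab: "a \<in> R" "b \<in> R"
      using unimodular_scale[OF pr(2)] unimodular_scale[OF pr(4)] unimodular_RV[OF pr(1)] unimodular_RV[OF pr(3)] a b by auto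
    have "transvec n c v f = transvec n (c * a * b) v' f'" for c
      unfolding a b using unimodular_carrier[OF pr(2)] unimodular_carrier[OF pr(4)]
      by (intro eq_matI) (auto simp: transvec_index)
    then show ?thesis using ab by auto
  qed
  show ?thesis using *[OF pr parallel] *[OF pr(2,1,4,3)] parallel_sym parallel by blast
qed

context matrix_aut
begin

definition roots :: "(nat \<Rightarrow> nat \<Rightarrow> 'a vec) \<Rightarrow> (nat \<Rightarrow> nat \<Rightarrow> 'a vec) \<Rightarrow> bool" where
  "roots v f \<longleftrightarrow> (\<forall>i<n. \<forall>j<n. i \<noteq> j \<longrightarrow> unimodular (v i j) \<and> unimodular (f i j) \<and> scalar_prod (f i j) (v i j) = 0 \<and>
     (\<lambda>r. \<phi> (elem_mat n i j r)) ` R = (\<lambda>c. transvec n c (v i j) (f i j)) ` R)"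

text \<open>In the pattern of the elementary matrices themselves the centre depends on the row index
  only and the axis on the column index only. \<open>skew\<close> is this pattern with the two
  indices interchanged.\<close>

definition straight :: "(nat \<Rightarrow> nat \<Rightarrow> 'a vec) \<Rightarrow> (nat \<Rightarrow> nat \<Rightarrow> 'a vec) \<Rightarrow> bool" where
  "straight v f \<longleftrightarrow> (\<forall>i<n. \<forall>j<n. \<forall>k<n. i \<noteq> j \<longrightarrow> j \<noteq> k \<longrightarrow> i \<noteq> k \<longrightarrow>
     scalar_prod (f i j) (v j k) \<noteq> 0 \<and> scalar_prod (f j k) (v i j) = 0 \<and>
     parallel (v i k) (v i j) \<and> parallel (f i k) (f j k))"

definition skew :: "(nat \<Rightarrow> nat \<Rightarrow> 'a vec) \<Rightarrow> (nat \<Rightarrow> nat \<Rightarrow> 'a vec) \<Rightarrow> bool" where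
  "skew v f \<longleftrightarrow> (\<forall>i<n. \<forall>j<n. \<forall>k<n. i \<noteq> j \<longrightarrow> j \<noteq> k \<longrightarrow> i \<noteq> k \<longrightarrow>
     scalar_prod (f i j) (v j k) = 0 \<and> scalar_prod (f j k) (v i j) \<noteq> 0 \<and>
     parallel (v i k) (v j k) \<and> parallel (f i k) (f i j))"

lemma ex_roots: "\<exists>v f. roots v f"
proof -
  have "\<exists>vf. i < n \<longrightarrow> j < n \<longrightarrow> i \<noteq> j \<longrightarrow>
    unimodular (fst vf) \<and> unimodular (snd vf) \<and> scalar_prod (snd vf) (fst vf) = 0 \<and>
     (\<lambda>r. \<phi> (elem_mat n i j r)) ` R = (\<lambda>c. transvec n c (fst vf) (snd vf)) ` R" for i j
    using root_image[of i j] by auto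
  then obtain vf where "\<And>i j. i < n \<longrightarrow> j < n \<longrightarrow> i \<noteq> j \<longrightarrow>
    unimodular (fst (vf i j)) \<and> unimodular (snd (vf i j)) \<and> scalar_prod (snd (vf i j)) (fst (vf i j)) = 0 \<and>
     (\<lambda>r. \<phi> (elem_mat n i j r)) ` R = (\<lambda>c. transvec n c (fst (vf i j)) (snd (vf i j))) ` R" by metis
  then show ?thesis
    unfolding roots_def by (intro exI[of _ "\<lambda>i j. fst (vf i j)"] exI[of _ "\<lambda>i j. snd (vf i j)"]) auto
qed

lemma rootsD:
  assumes "roots v f" "i < n" "j < n" "i \<noteq> j"
  shows "unimodular (v i j)" "unimodular (f i j)" "scalar_prod (f i j) (v i j) = 0"
    "(\<lambda>r. \<phi> (elem_mat n i j r)) ` R = (\<lambda>c. transvec n c (v i j) (f i j)) ` R"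
    "v i j \<in> carrier_vec n" "f i j \<in> carrier_vec n" "v i j \<noteq> 0\<^sub>v n" "f i j \<noteq> 0\<^sub>v n"
  using assms unimodular_carrier unimodular_nonzero unfolding roots_def by blast+

lemma roots_alternative:
  assumes r: "roots v f" and ijk: "i < n" "j < n" "k < n" "i \<noteq> j" "j \<noteq> k" "i \<noteq> k"
  shows "(scalar_prod (f i j) (v j k) \<noteq> 0 \<and> scalar_prod (f j k) (v i j) = 0 \<and>
     parallel (v i k) (v i j) \<and> parallel (f i k) (f j k)) \<or>
    (scalar_prod (f i j) (v j k) = 0 \<and> scalar_prod (f j k) (v i j) \<noteq> 0 \<and>
     parallel (v i k) (v j k) \<and> parallel (f i k) (f i j))"
proof -
  note ij = rootsD[OF r ijk(1,2,4)] and jk = rootsD[OF r ijk(2,3,5)] and ik = rootsD[OF r ijk(1,3,6)]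
  have ne: "\<phi> (elem_mat n a b 1) \<noteq> 1\<^sub>m n" if ab: "a < n" "b < n" "a \<noteq> b" for a b
  proof
    assume "\<phi> (elem_mat n a b 1) = 1\<^sub>m n"
    then have "elem_mat n a b (1 :: 'a) = 1\<^sub>m n"
      by (rule phi_inj[OF elem_mat_G[OF ab(3) R_one] one_G, unfolded phi_one])
    then show False using elem_mat_neq_one[OF ab, of "1 :: 'a"] by simp
  qed
  have ex: "\<exists>a. a \<noteq> 0 \<and> \<phi> (elem_mat n i j 1) = transvec n a (v i j) (f i j)" if ij: "i < n" "j < n" "i \<noteq> j" for i j
  proof -
    have "\<phi> (elem_mat n i j 1) \<in> (\<lambda>r. \<phi> (elem_mat n i j r)) ` R" by (rule image_eqI[OF refl R_one])
    then obtain a where "\<phi> (elem_mat n i j 1) = transvec n a (v i j) (f i j)"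
      unfolding rootsD(4)[OF r ij] by blast
    moreover from this have "a \<noteq> 0" using ne[OF ij] transvec_zero[of n "v i j" "f i j"] by auto
    ultimately show ?thesis by blast
  qed
  obtain a where a: "a \<noteq> 0" "\<phi> (elem_mat n i j 1) = transvec n a (v i j) (f i j)" using ex ijk by blast
  obtain b where b: "b \<noteq> 0" "\<phi> (elem_mat n j k 1) = transvec n b (v j k) (f j k)" using ex ijk by blast
  obtain d where d: "d \<noteq> 0" "\<phi> (elem_mat n i k 1) = transvec n d (v i k) (f i k)" using ex ijk by blast
  have E: "elem_mat n i j 1 \<in> G" "elem_mat n j k 1 \<in> G" "elem_mat n i k 1 \<in> G" using elem_mat_G ijk by auto
  have "elem_mat n i j 1 * elem_mat n j k 1 = elem_mat n j k 1 * elem_mat n i j 1 * elem_mat n i k (1 :: 'a)"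
    using elem_mat_commutator[of i n j k "1 :: 'a" 1] ijk by simp
  from arg_cong[OF this, of \<phi>]
  have rel: "transvec n a (v i j) (f i j) * transvec n b (v j k) (f j k) =
    transvec n b (v j k) (f j k) * transvec n a (v i j) (f i j) * transvec n d (v i k) (f i k)"
    unfolding phi_mult[OF E(1,2)] phi_mult[OF G_mult[OF E(2,1)] E(3)] phi_mult[OF E(2,1)] a b d .
  have "transvec n a (v i j) (f i j) \<in> G" "transvec n b (v j k) (f j k) \<in> G"
    using phi_G[OF E(1)] phi_G[OF E(2)] unfolding a b .
  from unipotent_commutator[OF a(1) b(1) d(1) ij(5,7) ij(6,8) jk(5,7) jk(6,8) ik(5,7) ik(6,8) ij(3) jk(3) this rel]
  show ?thesis .
qed

text \<open>\<open>uniform_type\<close> speaks of equal centres and axes, so it is applied to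
  classes of parallel vectors, with orthogonality of representatives as incidence.\<close>

lemma straight_or_skew:
  assumes r: "roots v f"
  shows "straight v f \<or> skew v f"
proof -
  define cl where "cl u = {w. parallel w u}" for u :: "'a vec"
  have cl: "cl u = cl w \<longleftrightarrow> parallel u w" for u w
    unfolding cl_def using parallel_refl parallel_sym parallel_trans by blast
  define I where "I h l \<longleftrightarrow> (\<exists>f \<in> h. \<exists>v \<in> l. scalar_prod f v = 0)" for h l :: "'a vec set"
  have I: "I (cl f) (cl v) \<longleftrightarrow> scalar_prod f v = 0" if "f \<in> carrier_vec n" "v \<in> carrier_vec n" for f v
    using parallel_scalar_prod_zero[OF _ _ that] parallel_refl unfolding I_def cl_def by blast
  note D = rootsD[OF r]
  note I' = I[OF D(6) D(5)]
  have "(\<forall>i<n. \<forall>j<n. \<forall>k<n. i \<noteq> j \<longrightarrow> j \<noteq> k \<longrightarrow> i \<noteq> k \<longrightarrow>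
      \<not> I (cl (f i j)) (cl (v j k)) \<and> I (cl (f j k)) (cl (v i j)) \<and>
      cl (v i k) = cl (v i j) \<and> cl (f i k) = cl (f j k)) \<or>
    (\<forall>i<n. \<forall>j<n. \<forall>k<n. i \<noteq> j \<longrightarrow> j \<noteq> k \<longrightarrow> i \<noteq> k \<longrightarrow>
      I (cl (f i j)) (cl (v j k)) \<and> \<not> I (cl (f j k)) (cl (v i j)) \<and>
      cl (v i k) = cl (v j k) \<and> cl (f i k) = cl (f i j))"
  proof (rule uniform_type[OF n])
    fix i j k assume ijk: "i < n" "j < n" "k < n" "i \<noteq> j" "j \<noteq> k" "i \<noteq> k"
    show "(\<not> I (cl (f i j)) (cl (v j k)) \<and> I (cl (f j k)) (cl (v i j)) \<and>
        cl (v i k) = cl (v i j) \<and> cl (f i k) = cl (f j k)) \<or>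
      (I (cl (f i j)) (cl (v j k)) \<and> \<not> I (cl (f j k)) (cl (v i j)) \<and>
        cl (v i k) = cl (v j k) \<and> cl (f i k) = cl (f i j))"
      unfolding cl I'[OF ijk(1,2,4) ijk(2,3,5)] I'[OF ijk(2,3,5) ijk(1,2,4)]
      using roots_alternative[OF r ijk] by blast
  next
    fix i j assume "i < n" "j < n" "i \<noteq> j"
    then show "I (cl (f i j)) (cl (v i j))" using I' D(3) by blast
  qed
  then show ?thesis
  proof (rule disj_forward)
    assume *: "\<forall>i<n. \<forall>j<n. \<forall>k<n. i \<noteq> j \<longrightarrow> j \<noteq> k \<longrightarrow> i \<noteq> k \<longrightarrow>
      \<not> I (cl (f i j)) (cl (v j k)) \<and> I (cl (f j k)) (cl (v i j)) \<and>
      cl (v i k) = cl (v i j) \<and> cl (f i k) = cl (f j k)"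
    show "straight v f" unfolding straight_def
    proof (intro allI impI)
      fix i j k assume ijk: "i < n" "j < n" "k < n" "i \<noteq> j" "j \<noteq> k" "i \<noteq> k"
      from *[rule_format, OF ijk]
      show "scalar_prod (f i j) (v j k) \<noteq> 0 \<and> scalar_prod (f j k) (v i j) = 0 \<and>
        parallel (v i k) (v i j) \<and> parallel (f i k) (f j k)"
        unfolding cl I'[OF ijk(1,2,4) ijk(2,3,5)] I'[OF ijk(2,3,5) ijk(1,2,4)] .
    qed
  next
    assume *: "\<forall>i<n. \<forall>j<n. \<forall>k<n. i \<noteq> j \<longrightarrow> j \<noteq> k \<longrightarrow> i \<noteq> k \<longrightarrow>
      I (cl (f i j)) (cl (v j k)) \<and> \<not> I (cl (f j k)) (cl (v i j)) \<and>
      cl (v i k) = cl (v j k) \<and> cl (f i k) = cl (f i j)"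
    show "skew v f" unfolding skew_def
    proof (intro allI impI)
      fix i j k assume ijk: "i < n" "j < n" "k < n" "i \<noteq> j" "j \<noteq> k" "i \<noteq> k"
      from *[rule_format, OF ijk]
      show "scalar_prod (f i j) (v j k) = 0 \<and> scalar_prod (f j k) (v i j) \<noteq> 0 \<and>
        parallel (v i k) (v j k) \<and> parallel (f i k) (f i j)"
        unfolding cl I'[OF ijk(1,2,4) ijk(2,3,5)] I'[OF ijk(2,3,5) ijk(1,2,4)] .
    qed
  qed
qed

text \<open>Each row contributes its centre and each column its axis. Whether \<open>F i\<close> and
  \<open>V j\<close> are orthogonal is read off from two consecutive roots, chosen with auxiliary
  indices.\<close>

lemma straight_frame:
  assumes r: "roots v f" and s: "straight v f"
  shows "\<exists>V F. (\<forall>i<n. unimodular (V i) \<and> unimodular (F i)) \<and>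
    (\<forall>i<n. \<forall>j<n. scalar_prod (F i) (V j) = 0 \<longleftrightarrow> i \<noteq> j) \<and>
    (\<forall>i<n. \<forall>j<n. i \<noteq> j \<longrightarrow> (\<lambda>r. \<phi> (elem_mat n i j r)) ` R = (\<lambda>c. transvec n c (V i) (F j)) ` R)"
proof -
  \<comment> \<open>\<open>c i\<close> is merely some index other than \<open>i\<close>, used to
    choose representatives.\<close>
  define c where "c i = (if i = 0 then 1 else 0 :: nat)" for i :: nat
  have c: "c i < n" "c i \<noteq> i" for i using n by (auto simp: c_def)
  define V where "V i = v i (c i)" for i
  define F where "F j = f (c j) j" for j
  note D = rootsD[OF r]
  have sD: "scalar_prod (f i j) (v j k) \<noteq> 0" "scalar_prod (f j k) (v i j) = 0"
     "parallel (v i k) (v i j)" "parallel (f i k) (f j k)"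
    if "i < n" "j < n" "k < n" "i \<noteq> j" "j \<noteq> k" "i \<noteq> k" for i j k
    using s that unfolding straight_def by blast+
  have prV: "unimodular (V i)" and prF: "unimodular (F i)" if "i < n" for i
    using D(1)[of i "c i"] D(2)[of "c i" i] c[of i] that by (auto simp: V_def F_def)
  have pV: "parallel (v i j) (V i)" and pF: "parallel (f i j) (F j)" if "i < n" "j < n" "i \<noteq> j" for i j
  proof -
    show "parallel (v i j) (V i)"
      unfolding V_def using sD(3)[of i "c i" j] c[of i] that parallel_refl by (cases "j = c i") auto
    show "parallel (f i j) (F j)"
      unfolding F_def using sD(4)[of i "c j" j] c[of j] that parallel_refl by (cases "i = c j") auto
  qed
  have orth: "scalar_prod (F i) (V j) = 0 \<longleftrightarrow> i \<noteq> j" if ij: "i < n" "j < n" for i j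
  proof (cases "i = j")
    case True
    obtain k where k: "k < n" "k \<noteq> i" using third_index[of i i] by blast
    obtain l where l: "l < n" "l \<noteq> i" "l \<noteq> k" using third_index[of i k] by blast
    have "scalar_prod (f k i) (v i l) = 0 \<longleftrightarrow> scalar_prod (F i) (V i) = 0"
      using pF[of k i] pV[of i l] prV[of i] prF[of i] k l ij unimodular_carrier
      by (intro parallel_scalar_prod_zero) auto
    then show ?thesis using sD(1)[of k i l] True k l ij by auto
  next
    case False
    obtain k where k: "k < n" "k \<noteq> i" "k \<noteq> j" using third_index[of i j] by blast
    have "scalar_prod (f k i) (v j k) = 0 \<longleftrightarrow> scalar_prod (F i) (V j) = 0"
      using pF[of k i] pV[of j k] prV[of j] prF[of i] k ij False unimodular_carrier
      by (intro parallel_scalar_prod_zero) auto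
    then show ?thesis using sD(2)[of j k i] False k ij by auto
  qed
  have img: "(\<lambda>r. \<phi> (elem_mat n i j r)) ` R = (\<lambda>c. transvec n c (V i) (F j)) ` R" if ij: "i < n" "j < n" "i \<noteq> j" for i j
    unfolding D(4)[OF ij] by (rule transvec_parallel_image[OF D(1)[OF ij] prV[OF ij(1)] D(2)[OF ij] prF[OF ij(2)] pV[OF ij] pF[OF ij]])
  show ?thesis
    by (intro exI[of _ V] exI[of _ F] conjI allI impI prV prF orth img)
qed

text \<open>On the root \<open>(i, j)\<close> the automorphism acts on parameters by a map
  \<open>s i j\<close>, and the commutator relation gives
  \<open>s i k (x * y) = d j * s i j x * s j k y\<close>. The units occurring here can be removed by
  rescaling the frame, which leaves one ring automorphism for all roots.\<close>

lemma frame_coordinates: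
  assumes pr: "\<And>i. i < n \<Longrightarrow> unimodular (V i)" "\<And>i. i < n \<Longrightarrow> unimodular (F i)"
    and orth: "\<And>i j. i < n \<Longrightarrow> j < n \<Longrightarrow> scalar_prod (F i) (V j) = 0 \<longleftrightarrow> i \<noteq> j"
    and img: "\<And>i j. i < n \<Longrightarrow> j < n \<Longrightarrow> i \<noteq> j \<Longrightarrow>
      (\<lambda>r. \<phi> (elem_mat n i j r)) ` R = (\<lambda>c. transvec n c (V i) (F j)) ` R"
  shows "\<exists>\<rho> V F. ring_aut R \<rho> \<and> (\<forall>i<n. V i \<in> RV \<and> F i \<in> RV) \<and>
    (\<forall>i<n. \<forall>j<n. scalar_prod (F i) (V j) = (if i = j then 1 else 0)) \<and>
    (\<forall>i<n. \<forall>j<n. i \<noteq> j \<longrightarrow> (\<forall>r \<in> R. \<phi> (elem_mat n i j r) = transvec n (\<rho> r) (V i) (F j)))"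
proof -
  note carV = unimodular_carrier[OF pr(1)] and carF = unimodular_carrier[OF pr(2)]
  have "\<exists>c. i < n \<longrightarrow> j < n \<longrightarrow> i \<noteq> j \<longrightarrow> r \<in> R \<longrightarrow>
    c \<in> R \<and> \<phi> (elem_mat n i j r) = transvec n c (V i) (F j)" for i j r
    using img[of i j] by (metis (no_types, lifting) image_iff)
  then obtain s where "\<And>i j r. i < n \<longrightarrow> j < n \<longrightarrow> i \<noteq> j \<longrightarrow> r \<in> R \<longrightarrow>
    s i j r \<in> R \<and> \<phi> (elem_mat n i j r) = transvec n (s i j r) (V i) (F j)" by metis
  then have sR: "s i j r \<in> R" and s: "\<phi> (elem_mat n i j r) = transvec n (s i j r) (V i) (F j)"
    if "i < n" "j < n" "i \<noteq> j" "r \<in> R" for i j r using that by blast+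
  have uniq: "x = y" if "i < n" "j < n" "transvec n x (V i) (F j) = transvec n y (V i) (F j)" for x y i j
    using transvec_nonzero[OF pr(1) pr(2) that(3)] that by blast
  have s_surj: "\<exists>r \<in> R. s i j r = c" if ij: "i < n" "j < n" "i \<noteq> j" and c: "c \<in> R" for i j c
  proof -
    have "transvec n c (V i) (F j) \<in> (\<lambda>r. \<phi> (elem_mat n i j r)) ` R" unfolding img[OF ij] using c by blast
    then obtain r where "r \<in> R" "transvec n c (V i) (F j) = transvec n (s i j r) (V i) (F j)" using s[OF ij] by auto
    then show ?thesis using uniq[OF ij(1,2)] by metis
  qed
  have s_inj: "r = r'" if ij: "i < n" "j < n" "i \<noteq> j" and r: "r \<in> R" "r' \<in> R" "s i j r = s i j r'" for i j r r'
  proof -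
    have "\<phi> (elem_mat n i j r) = \<phi> (elem_mat n i j r')" using s[OF ij] r by simp
    then have "elem_mat n i j r = elem_mat n i j r'"
      using phi_inj[OF elem_mat_G[OF ij(3) r(1)] elem_mat_G[OF ij(3) r(2)]] by simp
    then have "elem_mat n i j r $$ (i, j) = elem_mat n i j r' $$ (i, j)" by simp
    then show ?thesis using ij by (simp add: elem_mat_index)
  qed
  have s_add: "s i j (x + y) = s i j x + s i j y" if ij: "i < n" "j < n" "i \<noteq> j" and xy: "x \<in> R" "y \<in> R" for i j x y
  proof -
    have "\<phi> (elem_mat n i j (x + y)) = \<phi> (elem_mat n i j x) * \<phi> (elem_mat n i j y)"
      using phi_mult[OF elem_mat_G[OF ij(3) xy(1)] elem_mat_G[OF ij(3) xy(2)]] ij by (simp add: elem_mat_add)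
    then have "transvec n (s i j (x + y)) (V i) (F j) = transvec n (s i j x + s i j y) (V i) (F j)"
      using s[OF ij] xy transvec_add[OF carF[OF ij(2)] carV[OF ij(1)]] orth[OF ij(2,1)] ij(3) by simp
    then show ?thesis using uniq[OF ij(1,2)] by blast
  qed
  define d where "d j = scalar_prod (F j) (V j)" for j
  have s_mult: "s i k (x * y) = d j * s i j x * s j k y"
    if ijk: "i < n" "j < n" "k < n" "i \<noteq> j" "j \<noteq> k" "i \<noteq> k" and xy: "x \<in> R" "y \<in> R" for i j k x y
  proof -
    have E: "elem_mat n i j x \<in> G" "elem_mat n j k y \<in> G" "elem_mat n i k (x * y) \<in> G" using elem_mat_G ijk xy by auto
    let ?x = "transvec n (s i j x) (V i) (F j)" and ?y = "transvec n (s j k y) (V j) (F k)"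
      and ?c = "transvec n (s i k (x * y)) (V i) (F k)" and ?c' = "transvec n (s i j x * s j k y * d j) (V i) (F k)"
    have xG: "?x \<in> G" "?y \<in> G" using phi_G[OF E(1)] phi_G[OF E(2)] s ijk xy by auto
    have "\<phi> (elem_mat n i j x * elem_mat n j k y) = \<phi> (elem_mat n j k y * elem_mat n i j x * elem_mat n i k (x * y))"
      by (rule arg_cong[OF elem_mat_commutator[OF ijk]])
    then have "?x * ?y = ?y * ?x * ?c"
      unfolding phi_mult[OF E(1,2)] phi_mult[OF G_mult[OF E(2,1)] E(3)] phi_mult[OF E(2,1)]
      using s ijk xy by simp
    moreover have "?x * ?y = ?y * ?x * ?c'"
      unfolding d_def using orth ijk by (intro transvec_commutator carV carF) auto
    ultimately have eq: "?y * ?x * ?c = ?y * ?x * ?c'" by simp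
    have yx: "?y * ?x \<in> G" using G_mult xG by blast
    obtain W where W: "W \<in> G" "W * (?y * ?x) = 1\<^sub>m n" using G_inv[OF yx] by blast
    have "W * (?y * ?x * T) = T" if "T \<in> carrier_mat n n" for T
      using assoc_mult_mat[OF G_carrier[OF W(1)] G_carrier[OF yx] that] W(2) that by simp
    from this[OF transvec_carrier, of "s i k (x * y)" "V i" "F k", unfolded eq]
      this[OF transvec_carrier, of "s i j x * s j k y * d j" "V i" "F k"]
    have "?c = ?c'" by (rule trans[OF sym])
    then show ?thesis using uniq[OF ijk(1,3)] by (simp add: mult.commute mult.left_commute)
  qed
  have dR: "d j \<in> R" if "j < n" for j
    unfolding d_def using scalar_prod_RV unimodular_RV pr that by blast
  have d0: "d j \<noteq> 0" if "j < n" for j using orth[OF that that] by (simp add: d_def)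
  \<comment> \<open>Surjectivity puts 1 into the range of \<open>s i k\<close>; factoring it through
    the index \<open>j\<close> exhibits an inverse of \<open>d j\<close> in
    \<open>R\<close>.\<close>
  have dinv: "1 / d j \<in> R" if j: "j < n" for j
  proof -
    obtain i where i: "i < n" "i \<noteq> j" using third_index[of j j] by blast
    obtain k where k: "k < n" "k \<noteq> i" "k \<noteq> j" using third_index[of i j] by blast
    obtain x where x: "x \<in> R" "s i k x = 1" using s_surj[of i k 1] i k by auto
    have "1 = d j * s i j x * s j k 1" using s_mult[of i j k x 1] x i j k by simp
    then have "1 / d j = s i j x * s j k 1" using d0[OF j] by (simp add: field_simps)
    then show ?thesis using sR i j k x by simp
  qed
  \<comment> \<open>The factor \<open>d j\<close> removes the structure constant from the product
    rule.\<close>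
  define \<sigma> where "\<sigma> i j x = s i j x * d j" for i j x
  have \<sigma>_mult: "\<sigma> i k (x * y) = \<sigma> i j x * \<sigma> j k y"
    if "i < n" "j < n" "k < n" "i \<noteq> j" "j \<noteq> k" "i \<noteq> k" "x \<in> R" "y \<in> R" for i j k x y
    using s_mult[OF that] by (simp add: \<sigma>_def)
  define e where "e i j = \<sigma> i j 1" for i j
  have eR: "e i j \<in> R" if "i < n" "j < n" "i \<noteq> j" for i j
    using sR[OF that] dR that by (simp add: e_def \<sigma>_def)
  have e_mult: "e i k = e i j * e j k" if "i < n" "j < n" "k < n" "i \<noteq> j" "j \<noteq> k" "i \<noteq> k" for i j k
    using \<sigma>_mult[OF that, of 1 1] by (simp add: e_def)
  have e0: "e i j \<noteq> 0" if ij: "i < n" "j < n" "i \<noteq> j" for i j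
  proof
    assume "e i j = 0"
    then have "s i j 1 = 0" using d0[OF ij(2)] by (simp add: e_def \<sigma>_def)
    moreover have "s i j 0 = s i j 0 + s i j 0" using s_add[OF ij R_zero R_zero] by (simp only: add_0_left)
    then have "s i j 0 = 0" by (simp only: add_cancel_right_right)
    ultimately show False using s_inj[OF ij, of 1 0] by simp
  qed
  have e_inv: "e i j * e j i = 1" if ij: "i < n" "j < n" "i \<noteq> j" for i j
  proof -
    obtain k where k: "k < n" "k \<noteq> i" "k \<noteq> j" using third_index[of i j] by blast
    have "e k j = e k j * (e j i * e i j)"
      using e_mult[of k i j] e_mult[of k j i] ij k by (simp add: mult.assoc)
    then show ?thesis using e0[of k j] ij k by (simp add: mult.commute)
  qed
  \<comment> \<open>The cocycle \<open>e\<close> is a coboundary, \<open>e i j = c i / c j\<close>,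
    with 0 as base point; the case \<open>i = 0\<close> is separate because \<open>(0, 0)\<close> is
    not a root.\<close>
  define c where "c i = (if i = 0 then 1 else e i 0)" for i
  have n0: "0 < n" "1 < n" using n by auto
  have cR: "c i \<in> R" and c0: "c i \<noteq> 0" and cinv: "1 / c i \<in> R" if "i < n" for i
  proof -
    show "c i \<in> R" "c i \<noteq> 0" using eR[of i 0] e0[of i 0] n0 that by (auto simp: c_def)
    show "1 / c i \<in> R"
    proof (cases "i = 0")
      case False
      then have "1 / c i = e 0 i" using e_inv[of 0 i] e0[of i 0] n0 that by (simp add: c_def field_simps)
      then show ?thesis using eR[of 0 i] n0 that False by simp
    qed (simp add: c_def)
  qed
  have ec: "c i = e i j * c j" if ij: "i < n" "j < n" "i \<noteq> j" for i j
    using e_mult[of i j 0] e_inv[of i j] ij n0 by (auto simp: c_def)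
  define \<rho> where "\<rho> i j x = \<sigma> i j x / e i j" for i j x
  have \<rho>1: "\<rho> i j 1 = 1" if "i < n" "j < n" "i \<noteq> j" for i j
    using e0[OF that] by (simp add: \<rho>_def e_def)
  have \<rho>_mult: "\<rho> i k (x * y) = \<rho> i j x * \<rho> j k y"
    if "i < n" "j < n" "k < n" "i \<noteq> j" "j \<noteq> k" "i \<noteq> k" "x \<in> R" "y \<in> R" for i j k x y
    using \<sigma>_mult[OF that] e_mult[of i j k] that by (simp add: \<rho>_def)
  \<comment> \<open>Since \<open>\<rho> i j 1 = 1\<close>, setting one factor equal to 1 in the
    product rule changes either index freely.\<close>
  have row: "\<rho> i k x = \<rho> i j x" and col: "\<rho> i k x = \<rho> j k x"
    if "i < n" "j < n" "k < n" "i \<noteq> j" "j \<noteq> k" "i \<noteq> k" "x \<in> R" for i j k x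
    using \<rho>_mult[OF that(1-6), of x 1] \<rho>_mult[OF that(1-6), of 1 x] \<rho>1 that by auto
  have \<rho>: "\<rho> i j x = \<rho> 0 1 x" if ij: "i < n" "j < n" "i \<noteq> j" and x: "x \<in> R" for i j x
  proof -
    have a: "\<rho> i j x = \<rho> 0 1 x" if ij: "i < n" "j < n" "i \<noteq> j" "j \<noteq> 0" for i j
    proof -
      have "\<rho> i j x = \<rho> 0 j x" using col[of i 0 j x] ij n0 x by (cases "i = 0") auto
      also have "\<dots> = \<rho> 0 1 x" using row[of 0 1 j x] ij n0 x by (cases "j = 1") auto
      finally show ?thesis .
    qed
    show ?thesis
    proof (cases "j = 0")
      case True
      obtain k where k: "k < n" "k \<noteq> i" "k \<noteq> 0" using third_index[of i 0] by blast
      then show ?thesis using row[of i k j x] a[of i k] ij True x n0 by auto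
    next
      case False
      then show ?thesis by (rule a[OF ij])
    qed
  qed
  have e01: "e 0 1 \<noteq> 0" "1 / e 0 1 = e 1 0" using e0[of 0 1] e_inv[of 0 1] n0 by (auto simp: field_simps)
  \<comment> \<open>\<open>\<rho> 0 1\<close> is \<open>s 0 1\<close> times this unit, so it
    inherits additivity and bijectivity on \<open>R\<close>.\<close>
  let ?u = "d 1 / e 0 1"
  have u: "?u \<in> R" "1 / ?u \<in> R" "?u \<noteq> 0"
  proof -
    have "?u = d 1 * e 1 0" "1 / ?u = (1 / d 1) * e 0 1" using e01 by (simp_all add: field_simps)
    moreover have "d 1 * e 1 0 \<in> R" "(1 / d 1) * e 0 1 \<in> R"
      using n0 by (auto intro!: R_mult dR dinv eR simp del: times_divide_eq_left)
    ultimately show "?u \<in> R" "1 / ?u \<in> R" by simp_all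
    show "?u \<noteq> 0" using d0 e01 n0 by simp
  qed
  have \<rho>01: "\<rho> 0 1 x = s 0 1 x * ?u" for x by (simp add: \<rho>_def \<sigma>_def)
  have aut: "ring_aut R (\<rho> 0 1)"
    unfolding ring_aut_def
  proof (intro conjI ballI)
    show "bij_betw (\<rho> 0 1) R R"
    proof (rule bij_betw_imageI)
      show "inj_on (\<rho> 0 1) R"
      proof (rule inj_onI)
        fix x y assume xy: "x \<in> R" "y \<in> R" "\<rho> 0 1 x = \<rho> 0 1 y"
        from xy(3) have "s 0 1 x = s 0 1 y"
          unfolding \<rho>01 using u(3) mult_right_cancel[of ?u] by blast
        then show "x = y" using s_inj[of 0 1 x y] n0 xy by simp
      qed
      show "\<rho> 0 1 ` R = R"
      proof
        show "\<rho> 0 1 ` R \<subseteq> R" unfolding \<rho>01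
          by (intro image_subsetI R_mult[OF sR u(1)]) (use n0 in simp_all)
        show "R \<subseteq> \<rho> 0 1 ` R"
        proof
          fix y assume "y \<in> R"
          then have "y * (1 / ?u) \<in> R" using u by (intro R_mult)
          then obtain x where "x \<in> R" "s 0 1 x = y * (1 / ?u)" using s_surj[of 0 1] n0 by fastforce
          moreover from this have "y = \<rho> 0 1 x"
            unfolding \<rho>01 using u(3) by (simp only: mult.assoc nonzero_divide_eq_eq) simp
          ultimately have "x \<in> R" "y = \<rho> 0 1 x" by blast+
          then show "y \<in> \<rho> 0 1 ` R" by blast
        qed
      qed
    qed
    show "\<rho> 0 1 1 = 1" using \<rho>1 n0 by simp
    fix x y assume xy: "x \<in> R" "y \<in> R"
    show "\<rho> 0 1 (x + y) = \<rho> 0 1 x + \<rho> 0 1 y"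
      unfolding \<rho>01 using s_add[of 0 1 x y] n0 xy by (simp add: add_divide_distrib distrib_right)
    \<comment> \<open>The product on the root \<open>(0, 1)\<close> is computed through a third
      index, which is where \<open>n \<ge> 3\<close> enters.\<close>
    have n2: "2 < n" using n by simp
    show "\<rho> 0 1 (x * y) = \<rho> 0 1 x * \<rho> 0 1 y"
      using \<rho>_mult[of 0 2 1 x y] \<rho>[of 0 2 x] \<rho>[of 2 1 y] n0 n2 xy by simp
  qed
  \<comment> \<open>The factors come from \<open>s i j r = \<rho> 0 1 r * c i / (c j * d j)\<close>;
    dividing by \<open>d j\<close> also makes the two families dual.\<close>
  define V' where "V' i = c i \<cdot>\<^sub>v V i" for i
  define F' where "F' j = (1 / c j * (1 / d j)) \<cdot>\<^sub>v F j" for j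
  have RV': "V' i \<in> RV" "F' i \<in> RV" if i: "i < n" for i
    using unimodular_RV[OF pr(1)[OF i]] unimodular_RV[OF pr(2)[OF i]] cR[OF i] R_mult[OF cinv[OF i] dinv[OF i]]
    unfolding V'_def F'_def by (auto simp: RV_def simp del: times_divide_eq_left times_divide_eq_right)
  have orth': "scalar_prod (F' i) (V' j) = (if i = j then 1 else 0)" if ij: "i < n" "j < n" for i j
  proof -
    have "scalar_prod (F' i) (V' j) = 1 / c i * (1 / d i) * (c j * scalar_prod (F i) (V j))"
      unfolding V'_def F'_def using carV[OF ij(2)] carF[OF ij(1)]
        smult_scalar_prod_distrib[of "F i" n "c j \<cdot>\<^sub>v V j" "1 / c i * (1 / d i)"]
        scalar_prod_smult_distrib[of "F i" n "V j" "c j"]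
      by (simp only: smult_carrier_vec)
    then show ?thesis using orth[OF ij] c0[OF ij(1)] d0[OF ij(1)] by (auto simp: d_def)
  qed
  have phi': "\<phi> (elem_mat n i j r) = transvec n (\<rho> 0 1 r) (V' i) (F' j)" if ij: "i < n" "j < n" "i \<noteq> j" and r: "r \<in> R" for i j r
  proof -
    have "s i j r = \<rho> i j r * c i * (1 / c j * (1 / d j))"
      using ec[OF ij] c0[OF ij(2)] d0[OF ij(2)] e0[OF ij] by (simp add: \<rho>_def \<sigma>_def)
    then have "s i j r = \<rho> 0 1 r * c i * (1 / c j * (1 / d j))" using \<rho>[OF ij r] by simp
    then have "transvec n (s i j r) (V i) (F j) = transvec n (\<rho> 0 1 r) (V' i) (F' j)"
      using carV[OF ij(1)] carF[OF ij(2)]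
      by (intro eq_matI) (auto simp: transvec_index V'_def F'_def)
    then show ?thesis using s[OF ij r] by simp
  qed
  show ?thesis
    by (intro exI[of _ "\<rho> 0 1"] exI[of _ V'] exI[of _ F'] conjI allI impI ballI aut RV' orth' phi')
qed

end

section \<open>Row reduction over a Euclidean subring\<close>

lemma elem_mat_mult_left:
  assumes "A \<in> carrier_mat n n" "i < n" "j < n" "a < n" "b < n"
  shows "(elem_mat n i j r * A) $$ (a, b) = A $$ (a, b) + (if a = i then r * A $$ (j, b) else 0)"
  unfolding elem_mat_def transvec_mult[OF assms(1) unit_vec_carrier assms(4,5)] sum_unit_vec(2)[OF assms(3)]
  using assms by (simp add: unit_vec_index)

lemma elem_mat_mult_right:
  assumes "A \<in> carrier_mat n n" "i < n" "j < n" "a < n" "b < n"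
  shows "(A * elem_mat n i j r) $$ (a, b) = A $$ (a, b) + (if b = j then r * A $$ (a, i) else 0)"
  unfolding elem_mat_def mult_transvec[OF assms(1) unit_vec_carrier assms(4,5)] sum_unit_vec(1)[OF assms(2)]
  using assms by (simp add: unit_vec_index)

context euclidean_subring
begin

lemma R_prod: "(\<And>i. i \<in> I \<Longrightarrow> f i \<in> R) \<Longrightarrow> prod f I \<in> R"
  by (induction I rule: infinite_finite_induct) auto

definition R_unit :: "'a \<Rightarrow> bool" where
  "R_unit x \<longleftrightarrow> x \<in> R \<and> x \<noteq> 0 \<and> 1 / x \<in> R"

lemma R_unitI: "x \<in> R \<Longrightarrow> y \<in> R \<Longrightarrow> x * y = 1 \<Longrightarrow> R_unit x"
  unfolding R_unit_def by (metis mult_zero_left nonzero_mult_div_cancel_left zero_neq_one)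

lemma R_unit_mult: "R_unit x \<Longrightarrow> R_unit y \<Longrightarrow> R_unit (x * y)"
  unfolding R_unit_def by (metis R_mult mult_1 no_zero_divisors times_divide_times_eq)

text \<open>Only additions of a multiple of one row to another are allowed: they preserve the
  determinant and are undone by the same operation with \<open>- r\<close>.\<close>

definition row_reduces :: "'a mat \<Rightarrow> 'a mat \<Rightarrow> bool" where
  "row_reduces = (\<lambda>A B. \<exists>i j r. i < n \<and> j < n \<and> i \<noteq> j \<and> r \<in> R \<and> B = elem_mat n i j r * A)\<^sup>*\<^sup>*"

lemma row_reduces_refl: "row_reduces A A" by (simp add: row_reduces_def)

lemma row_reduces_trans: "row_reduces A B \<Longrightarrow> row_reduces B C \<Longrightarrow> row_reduces A C"
  unfolding row_reduces_def by (rule rtranclp_trans)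

lemma row_reduces_elem_mat: "i < n \<Longrightarrow> j < n \<Longrightarrow> i \<noteq> j \<Longrightarrow> r \<in> R \<Longrightarrow> row_reduces A (elem_mat n i j r * A)"
  unfolding row_reduces_def by (intro r_into_rtranclp) blast

lemma row_reduces_invariant:
  assumes "row_reduces A B" "A \<in> RM"
  shows "B \<in> RM" "det B = det A"
proof -
  have "B \<in> RM \<and> det B = det A"
    using assms unfolding row_reduces_def
  proof (induction rule: rtranclp_induct)
    case (step B C)
    then obtain i j r where *: "i < n" "j < n" "i \<noteq> j" "r \<in> R" "C = elem_mat n i j r * B" by blast
    then have "det C = det B"
      using step RM_carrier by (simp add: det_mult[of _ n] det_elem_mat)
    then show ?case using step * mult_RM elem_mat_RM by auto
  qed simp
  then show "B \<in> RM" "det B = det A" by auto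
qed

definition upper_tri_upto :: "nat \<Rightarrow> 'a mat \<Rightarrow> bool" where
  "upper_tri_upto k B \<longleftrightarrow> (\<forall>c<k. \<forall>i<n. c < i \<longrightarrow> B $$ (i, c) = 0)"

lemma upper_tri_upto_elem_mat:
  assumes "B \<in> carrier_mat n n" "upper_tri_upto k B" "k \<le> i" "k \<le> j" "i < n" "j < n"
  shows "upper_tri_upto k (elem_mat n i j r * B)"
  unfolding upper_tri_upto_def using assms by (auto simp: elem_mat_mult_left upper_tri_upto_def simp del: index_mult_mat(1))

text \<open>Euclid's algorithm as a minimality argument: among the reduced matrices with a nonzero
  pivot in column \<open>k\<close>, take one with least \<open>dl\<close> of the pivot and then with
  fewest nonzero entries. A second nonzero entry could be reduced modulo the pivot, against
  minimality.\<close>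

lemma clear_column:
  assumes A: "A \<in> RM" and k: "k < n" and up: "upper_tri_upto k A"
  shows "\<exists>B. row_reduces A B \<and> upper_tri_upto (Suc k) B"
proof -
  define nz where "nz B = {i. k \<le> i \<and> i < n \<and> B $$ (i, k) \<noteq> 0}" for B :: "'a mat"
  have fin: "finite (nz B)" for B by (rule finite_subset[of _ "{..<n}"]) (auto simp: nz_def)
  define M where "M = (\<lambda>(B, i). row_reduces A B \<and> upper_tri_upto k B \<and> i \<in> nz B)"
  show ?thesis
  proof (cases "\<exists>Bi. M Bi")
    case False
    then have "nz A = {}" using up row_reduces_refl by (auto simp: M_def)
    then have "upper_tri_upto (Suc k) A" using up by (auto simp: upper_tri_upto_def nz_def less_Suc_eq)
    then show ?thesis using row_reduces_refl by blast
  next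
    case True
    define m where "m = (\<lambda>(B, i). (dl (B $$ (i, k)), card (nz B)))"
    have wfm: "wf (inv_image (less_than <*lex*> less_than) m)" by auto
    obtain z0 where z0: "z0 \<in> Collect M" using True by auto
    have "\<exists>z \<in> Collect M. \<forall>y. (y, z) \<in> inv_image (less_than <*lex*> less_than) m \<longrightarrow> y \<notin> Collect M"
      by (rule wfm[unfolded wf_eq_minimal, rule_format, OF z0])
    then obtain z where z: "z \<in> Collect M"
      and zmin: "\<forall>y. (y, z) \<in> inv_image (less_than <*lex*> less_than) m \<longrightarrow> y \<notin> Collect M"
      by (elim bexE)
    obtain B i where Bi: "z = (B, i)" by (cases z)
    have B: "M (B, i)" using z Bi by simp
    have min: "\<not> (dl (B' $$ (i', k)) < dl (B $$ (i, k)) \<or>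
        dl (B' $$ (i', k)) = dl (B $$ (i, k)) \<and> card (nz B') < card (nz B))" if "M (B', i')" for B' i'
      using zmin[THEN spec, of "(B', i')"] that unfolding Bi by (auto simp: m_def)
    have lB: "row_reduces A B" and uB: "upper_tri_upto k B" and i: "k \<le> i" "i < n" "B $$ (i, k) \<noteq> 0"
      using B by (auto simp: M_def nz_def)
    have BRM: "B \<in> RM" by (rule row_reduces_invariant(1)[OF lB A])
    note Bc = RM_carrier[OF BRM]
    have inR: "B $$ (a, k) \<in> R" if "a < n" for a using BRM that k by (auto simp: RM_def)
    have only: "i' = i" if i': "i' \<in> nz B" for i'
    proof (rule ccontr)
      assume ne: "i' \<noteq> i"
      have i'': "k \<le> i'" "i' < n" "B $$ (i', k) \<noteq> 0" using i' by (auto simp: nz_def)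
      obtain q where q: "q \<in> R" "B $$ (i', k) - q * B $$ (i, k) = 0 \<or>
        dl (B $$ (i', k) - q * B $$ (i, k)) < dl (B $$ (i, k))"
        using R_div[OF inR[OF i''(2)] inR[OF i(2)] i(3)] by blast
      let ?B = "elem_mat n i' i (- q) * B"
      have ent: "?B $$ (a, k) = (if a = i' then B $$ (i', k) - q * B $$ (i, k) else B $$ (a, k))" if "a < n" for a
        using elem_mat_mult_left[OF Bc i''(2) i(2) that k] by simp
      have l: "row_reduces A ?B" using row_reduces_trans[OF lB row_reduces_elem_mat[OF i''(2) i(2) ne]] q by simp
      have u: "upper_tri_upto k ?B" using upper_tri_upto_elem_mat[OF Bc uB] i i'' by simp
      show False
      proof (cases "B $$ (i', k) - q * B $$ (i, k) = 0")
        case True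
        have "nz C = nz B - {i'}"
          if "C $$ (i', k) = 0" "\<And>x. x \<noteq> i' \<Longrightarrow> x < n \<Longrightarrow> C $$ (x, k) = B $$ (x, k)" for C
          using that unfolding nz_def by force
        from this[of ?B] have "nz ?B = nz B - {i'}" using True ent i'' by simp
        then have "card (nz ?B) < card (nz B)" using i' fin by (metis card_Diff1_less)
        moreover have "M (?B, i)" using l u i ne ent[OF i(2)] by (simp add: M_def nz_def)
        moreover have "?B $$ (i, k) = B $$ (i, k)" using ent[OF i(2)] ne by simp
        ultimately show False using min[of ?B i] by simp
      next
        case False
        have "M (?B, i')" using l u i'' False ent[OF i''(2)] by (simp add: M_def nz_def)
        moreover have "dl (?B $$ (i', k)) < dl (B $$ (i, k))" using q False ent[OF i''(2)] by simp
        ultimately show False using min[of ?B i'] by simp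
      qed
    qed
    show ?thesis
    proof (cases "i = k")
      case True
      have "B $$ (a, k) = 0" if "k < a" "a < n" for a
      proof (rule ccontr)
        assume "B $$ (a, k) \<noteq> 0"
        then have "a \<in> nz B" using that by (simp add: nz_def)
        then show False using only[of a] True that by simp
      qed
      then have "upper_tri_upto (Suc k) B"
        using uB by (auto simp: upper_tri_upto_def less_Suc_eq)
      then show ?thesis using lB by blast
    next
      case False
      \<comment> \<open>Row swaps are not among the allowed operations, so the pivot is brought to
        row \<open>k\<close> by two additions.\<close>
      let ?B = "elem_mat n k i 1 * B" and ?C = "elem_mat n i k (-1) * (elem_mat n k i 1 * B)"
      have B1: "?B \<in> RM" using mult_RM elem_mat_RM BRM by simp
      have u: "upper_tri_upto k ?C"
        by (rule upper_tri_upto_elem_mat[OF RM_carrier[OF B1] upper_tri_upto_elem_mat[OF Bc uB]]) (use i k in auto)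
      have z: "B $$ (a, k) = 0" if "k \<le> a" "a < n" "a \<noteq> i" for a
        using only that by (auto simp: nz_def)
      have e: "?B $$ (a, k) = (if a = k \<or> a = i then B $$ (i, k) else B $$ (a, k))" if "a < n" for a
        using elem_mat_mult_left[OF Bc k i(2) that k, of 1] z[of k] k False by auto
      have "?C $$ (a, k) = 0" if "k < a" "a < n" for a
        using elem_mat_mult_left[OF RM_carrier[OF B1] i(2) k that(2) k, of "-1"] e[OF that(2)] e[OF k] z[of a] that
        by auto
      then have "upper_tri_upto (Suc k) ?C" using u by (auto simp: upper_tri_upto_def less_Suc_eq simp del: index_mult_mat(1))
      moreover have "row_reduces A ?C"
        by (intro row_reduces_trans[OF row_reduces_trans[OF lB row_reduces_elem_mat] row_reduces_elem_mat]) (use i k False in auto)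
      ultimately show ?thesis by blast
    qed
  qed
qed

lemma triangularize:
  assumes A: "A \<in> RM" and k: "k \<le> n"
  shows "\<exists>B. row_reduces A B \<and> upper_tri_upto k B"
  using k
proof (induction k)
  case 0 then show ?case using row_reduces_refl by (auto simp: upper_tri_upto_def)
next
  case (Suc k)
  then obtain B where "row_reduces A B" "upper_tri_upto k B" by auto
  then show ?case
    using clear_column[OF row_reduces_invariant(1)[OF _ A], of B k] row_reduces_trans Suc.prems by (meson Suc_le_lessD)
qed

text \<open>Row \<open>k\<close> vanishes to the left of its unit pivot, so clearing column
  \<open>k\<close> above the diagonal disturbs neither the earlier columns nor the diagonal.\<close>

lemma clear_above:
  assumes A: "A \<in> RM" and up: "upper_tri_upto n A" and un: "\<And>i. i < n \<Longrightarrow> R_unit (A $$ (i, i))" and k: "k \<le> n"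
  shows "\<exists>B. row_reduces A B \<and> upper_tri_upto n B \<and> (\<forall>i<n. B $$ (i, i) = A $$ (i, i)) \<and>
    (\<forall>c<k. \<forall>i<c. B $$ (i, c) = 0)"
  using k
proof (induction k)
  case 0 then show ?case using row_reduces_refl up by auto
next
  case (Suc k)
  then have k: "k < n" by simp
  define P where "P B \<longleftrightarrow> row_reduces A B \<and> upper_tri_upto n B \<and> (\<forall>i<n. B $$ (i, i) = A $$ (i, i)) \<and>
    (\<forall>c<k. \<forall>i<c. B $$ (i, c) = 0)" for B
  define nz where "nz B = {i. i < k \<and> B $$ (i, k) \<noteq> 0}" for B :: "'a mat"
  have fin: "finite (nz B)" for B by (rule finite_subset[of _ "{..<n}"]) (use k in \<open>auto simp: nz_def\<close>)
  have "\<exists>B. P B" using Suc unfolding P_def by auto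
  then obtain B where B: "P B" and min: "\<And>B'. P B' \<Longrightarrow> card (nz B) \<le> card (nz B')"
    using ex_has_least_nat[of P _ "\<lambda>B. card (nz B)"] by blast
  have BRM: "B \<in> RM" using B row_reduces_invariant(1)[OF _ A] by (auto simp: P_def)
  note Bc = RM_carrier[OF BRM]
  have "nz B = {}"
  proof (rule ccontr)
    assume "nz B \<noteq> {}"
    then obtain i where i: "i < k" "B $$ (i, k) \<noteq> 0" "i \<in> nz B" by (auto simp: nz_def)
    have lt: "i < n" using i k by simp
    let ?r = "- (B $$ (i, k) * (1 / A $$ (k, k)))"
    have rR: "?r \<in> R"
    proof -
      have "B $$ (i, k) \<in> R" using BRM lt k by (auto simp: RM_def)
      then show ?thesis using un[OF k] by (intro R_uminus R_mult) (auto simp: R_unit_def)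
    qed
    let ?B = "elem_mat n i k ?r * B"
    have e: "?B $$ (a, b) = B $$ (a, b) + (if a = i then ?r * B $$ (k, b) else 0)" if "a < n" "b < n" for a b
      by (rule elem_mat_mult_left[OF Bc lt k that])
    have low: "B $$ (k, b) = 0" if "b < k" for b using B k that by (auto simp: P_def upper_tri_upto_def)
    have Bkk: "B $$ (k, k) = A $$ (k, k)" using B k by (auto simp: P_def)
    have ik: "?B $$ (i, k) = 0" using e[OF lt k] Bkk un[OF k] by (simp add: R_unit_def)
    have "P ?B" unfolding P_def
    proof (intro conjI allI impI)
      show "row_reduces A ?B" using B row_reduces_trans[OF _ row_reduces_elem_mat[OF lt k _ rR]] i by (auto simp: P_def)
      show "upper_tri_upto n ?B" unfolding upper_tri_upto_def
      proof (intro allI impI)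
        fix c a assume ca: "c < n" "a < n" "c < a"
        have "a = i \<Longrightarrow> B $$ (k, c) = 0" using low ca i by simp
        moreover have "B $$ (a, c) = 0" using B ca by (auto simp: P_def upper_tri_upto_def)
        ultimately show "?B $$ (a, c) = 0" using e[OF ca(2,1)] by simp
      qed
      fix a assume a: "a < n"
      have "a = i \<Longrightarrow> B $$ (k, a) = 0" using low i by simp
      then show "?B $$ (a, a) = A $$ (a, a)" using e[OF a a] B a by (auto simp: P_def)
    next
      fix c a assume ca: "c < k" "a < c"
      then have "B $$ (a, c) = 0" "B $$ (k, c) = 0" using B low by (auto simp: P_def)
      then show "?B $$ (a, c) = 0" using e[of a c] ca k by simp
    qed
    then have "card (nz B) \<le> card (nz ?B)" by (rule min)
    moreover have "nz C = nz B - {i}"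
      if "C $$ (i, k) = 0" "\<And>x. x \<noteq> i \<Longrightarrow> x < n \<Longrightarrow> C $$ (x, k) = B $$ (x, k)" for C
      using that k unfolding nz_def by force
    from this[OF ik] have "nz ?B = nz B - {i}" using e k by simp
    then have "card (nz ?B) < card (nz B)" using i(3) fin by (metis card_Diff1_less)
    ultimately show False by simp
  qed
  then have "\<forall>c<Suc k. \<forall>i<c. B $$ (i, c) = 0" using B by (auto simp: P_def nz_def less_Suc_eq)
  then show ?case using B unfolding P_def by blast
qed

lemma diagonalize:
  assumes A: "A \<in> RM" and det: "R_unit (det A)"
  shows "\<exists>D. row_reduces A D \<and> D \<in> RM \<and> (\<forall>i<n. \<forall>j<n. i \<noteq> j \<longrightarrow> D $$ (i, j) = 0) \<and>
    (\<forall>i<n. R_unit (D $$ (i, i)))"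
proof -
  obtain B where B: "row_reduces A B" "upper_tri_upto n B" using triangularize[OF A] by blast
  have BRM: "B \<in> RM" "det B = det A" using row_reduces_invariant[OF B(1) A] by auto
  note Bc = RM_carrier[OF BRM(1)]
  have "upper_triangular B" using B(2) Bc unfolding upper_tri_upto_def upper_triangular_def by auto
  then have "det A = prod_list (diag_mat B)" using det_upper_triangular[OF _ Bc] BRM by simp
  also have "\<dots> = (\<Prod>i<n. B $$ (i, i))" using Bc by (simp add: prod_list_diag_prod lessThan_atLeast0)
  finally have d: "det A = (\<Prod>i<n. B $$ (i, i))" .
  \<comment> \<open>The determinant is the product of the diagonal; the other factors divided by it
    are the inverse of a given entry.\<close>
  have un: "R_unit (B $$ (i, i))" if i: "i < n" for i
  proof -
    have "B $$ (j, j) \<in> R" if "j < n" for j using BRM that by (auto simp: RM_def)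
    then have R: "B $$ (i, i) \<in> R" "(\<Prod>j\<in>{..<n} - {i}. B $$ (j, j)) \<in> R"
      using i by (auto intro!: R_prod)
    have "B $$ (i, i) * ((\<Prod>j\<in>{..<n} - {i}. B $$ (j, j)) * (1 / det A)) = det A * (1 / det A)"
      unfolding d using i by (subst (2) prod.remove[of _ i]) auto
    also have "\<dots> = 1" using det by (simp add: R_unit_def)
    finally have "B $$ (i, i) * ((\<Prod>j\<in>{..<n} - {i}. B $$ (j, j)) * (1 / det A)) = 1" .
    moreover have "1 / det A \<in> R" using det by (simp add: R_unit_def)
    ultimately show ?thesis using R_unitI[OF R(1) R_mult[OF R(2)]] by blast
  qed
  obtain D where D: "row_reduces B D" "upper_tri_upto n D" "\<forall>i<n. D $$ (i, i) = B $$ (i, i)" "\<forall>c<n. \<forall>i<c. D $$ (i, c) = 0"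
    using clear_above[OF BRM(1) B(2) un order_refl] by blast
  have "D $$ (i, j) = 0" if "i < n" "j < n" "i \<noteq> j" for i j
    using D(2,4) that by (cases "i < j") (auto simp: upper_tri_upto_def)
  then show ?thesis
    using row_reduces_trans[OF B(1) D(1)] row_reduces_invariant(1)[OF D(1) BRM(1)] D(3) un by auto
qed

text \<open>Row reduction ends in a diagonal matrix of units, and each of its steps can be undone by
  an elementary matrix; walking the reduction backwards carries \<open>P\<close> from there to
  \<open>A\<close>.\<close>

lemma elementary_induct:
  assumes A: "A \<in> RM" and det: "R_unit (det A)"
    and diag: "\<And>D. D \<in> RM \<Longrightarrow> (\<And>i j. i < n \<Longrightarrow> j < n \<Longrightarrow> i \<noteq> j \<Longrightarrow> D $$ (i, j) = 0) \<Longrightarrow>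
      (\<And>i. i < n \<Longrightarrow> R_unit (D $$ (i, i))) \<Longrightarrow> P D"
    and step: "\<And>B i j r. B \<in> RM \<Longrightarrow> P B \<Longrightarrow> i < n \<Longrightarrow> j < n \<Longrightarrow> i \<noteq> j \<Longrightarrow> r \<in> R \<Longrightarrow> P (elem_mat n i j r * B)"
  shows "P A"
proof -
  obtain D where D: "row_reduces A D" "D \<in> RM" "\<forall>i<n. \<forall>j<n. i \<noteq> j \<longrightarrow> D $$ (i, j) = 0"
    "\<forall>i<n. R_unit (D $$ (i, i))" using diagonalize[OF A det] by blast
  have PD: "P D" by (rule diag) (use D in auto)
  have "B \<in> RM \<longrightarrow> P B" if "row_reduces B D" for B
    using that unfolding row_reduces_def
  proof (induction rule: converse_rtranclp_induct)
    case base then show ?case using PD by simp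
  next
    case (step B C)
    then obtain i j r where *: "i < n" "j < n" "i \<noteq> j" "r \<in> R" "C = elem_mat n i j r * B" by blast
    show ?case
    proof
      assume B: "B \<in> RM"
      then have C: "C \<in> RM" using mult_RM elem_mat_RM * by simp
      have "elem_mat n i j (- r) * C = (elem_mat n i j (- r) * elem_mat n i j r) * B"
        unfolding *(5) using RM_carrier[OF B] by (intro assoc_mult_mat[symmetric, of _ n n _ n _ n]) auto
      also have "\<dots> = B" using * RM_carrier[OF B] by (simp add: elem_mat_add elem_mat_zero)
      finally show "P B" using assms(4)[OF C _ *(1,2,3), of "- r"] step C * by simp
    qed
  qed
  then show ?thesis using D A by blast
qed

section \<open>Ring automorphisms acting on matrices entry by entry\<close>

lemma autD:
  assumes "ring_aut R \<rho>"
  shows "x \<in> R \<Longrightarrow> \<rho> x \<in> R" "\<rho> 1 = 1" "\<rho> 0 = 0" "x \<in> R \<Longrightarrow> y \<in> R \<Longrightarrow> \<rho> (x + y) = \<rho> x + \<rho> y"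
    "x \<in> R \<Longrightarrow> y \<in> R \<Longrightarrow> \<rho> (x * y) = \<rho> x * \<rho> y" "x \<in> R \<Longrightarrow> \<rho> (- x) = - \<rho> x"
    "(\<And>i. i \<in> I \<Longrightarrow> f i \<in> R) \<Longrightarrow> \<rho> (sum f I) = (\<Sum>i\<in>I. \<rho> (f i))"
    "x \<in> R \<Longrightarrow> \<rho> x = 0 \<Longrightarrow> x = 0" "y \<in> R \<Longrightarrow> \<exists>x \<in> R. \<rho> x = y"
proof -
  have h: "bij_betw \<rho> R R" "\<rho> 1 = 1" "\<And>x y. x \<in> R \<Longrightarrow> y \<in> R \<Longrightarrow> \<rho> (x + y) = \<rho> x + \<rho> y"
    "\<And>x y. x \<in> R \<Longrightarrow> y \<in> R \<Longrightarrow> \<rho> (x * y) = \<rho> x * \<rho> y"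
    using assms unfolding ring_aut_def by blast+
  show "x \<in> R \<Longrightarrow> \<rho> x \<in> R" using h(1) by (rule bij_betw_apply)
  show "\<rho> 1 = 1" by fact
  have "\<rho> 0 = \<rho> 0 + \<rho> 0" using h(3)[of 0 0] by simp
  then show z: "\<rho> 0 = 0" by (simp only: add_cancel_right_right)
  show "x \<in> R \<Longrightarrow> y \<in> R \<Longrightarrow> \<rho> (x + y) = \<rho> x + \<rho> y" "x \<in> R \<Longrightarrow> y \<in> R \<Longrightarrow> \<rho> (x * y) = \<rho> x * \<rho> y"
    using h by blast+
  show "x \<in> R \<Longrightarrow> \<rho> (- x) = - \<rho> x"
    using h(3)[of x "- x"] z by (simp add: eq_neg_iff_add_eq_0 add.commute)
  show "(\<And>i. i \<in> I \<Longrightarrow> f i \<in> R) \<Longrightarrow> \<rho> (sum f I) = (\<Sum>i\<in>I. \<rho> (f i))"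
    by (induction I rule: infinite_finite_induct) (auto simp: z h(3) R_sum)
  show "x \<in> R \<Longrightarrow> \<rho> x = 0 \<Longrightarrow> x = 0"
    using h(1) z by (metis R_zero bij_betw_imp_inj_on inj_onD)
  show "y \<in> R \<Longrightarrow> \<exists>x \<in> R. \<rho> x = y"
    using h(1) unfolding bij_betw_def by (metis imageE)
qed

lemma aut_R_unit:
  assumes r: "ring_aut R \<rho>" and x: "R_unit x"
  shows "R_unit (\<rho> x)" "\<rho> (1 / x) = 1 / \<rho> x"
proof -
  have "\<rho> x * \<rho> (1 / x) = 1"
    using autD(5)[OF r, of x "1 / x"] autD(2)[OF r] x by (simp add: R_unit_def)
  moreover from this have "\<rho> x \<noteq> 0" by auto
  ultimately show "\<rho> (1 / x) = 1 / \<rho> x" by (simp add: field_simps)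
  show "R_unit (\<rho> x)"
    by (rule R_unitI[OF _ _ \<open>\<rho> x * \<rho> (1 / x) = 1\<close>]) (use x autD(1)[OF r] in \<open>auto simp: R_unit_def\<close>)
qed

lemma map_RM: "ring_aut R \<rho> \<Longrightarrow> A \<in> RM \<Longrightarrow> map_mat \<rho> A \<in> RM"
  using autD(1) by (auto simp: RM_def)

lemma map_mult:
  assumes r: "ring_aut R \<rho>" and A: "A \<in> RM" and B: "B \<in> RM"
  shows "map_mat \<rho> (A * B) = map_mat \<rho> A * map_mat \<rho> B"
proof (rule eq_matI)
  fix i j assume "i < dim_row (map_mat \<rho> A * map_mat \<rho> B)" "j < dim_col (map_mat \<rho> A * map_mat \<rho> B)"
  then have ij: "i < n" "j < n" using RM_carrier[OF A] RM_carrier[OF B] by auto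
  have R: "A $$ (a, b) \<in> R" "B $$ (a, b) \<in> R" if "a < n" "b < n" for a b
    using A B that by (auto simp: RM_def)
  have "\<rho> (\<Sum>k = 0..<n. A $$ (i, k) * B $$ (k, j)) = (\<Sum>k = 0..<n. \<rho> (A $$ (i, k) * B $$ (k, j)))"
    by (rule autD(7)[OF r]) (use R ij in auto)
  also have "\<dots> = (\<Sum>k = 0..<n. \<rho> (A $$ (i, k)) * \<rho> (B $$ (k, j)))"
    by (intro sum.cong refl autD(5)[OF r]) (use R ij in auto)
  finally show "map_mat \<rho> (A * B) $$ (i, j) = (map_mat \<rho> A * map_mat \<rho> B) $$ (i, j)"
    using RM_carrier[OF A] RM_carrier[OF B] ij by (simp add: scalar_prod_def)
qed (use RM_carrier[OF A] RM_carrier[OF B] in auto)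

lemma map_one: "ring_aut R \<rho> \<Longrightarrow> map_mat \<rho> (1\<^sub>m n) = 1\<^sub>m n"
  by (intro eq_matI) (auto simp: autD)

lemma map_elem_mat:
  assumes "ring_aut R \<rho>" "r \<in> R"
  shows "map_mat \<rho> (elem_mat n i j r) = elem_mat n i j (\<rho> r)"
  using assms autD(4)[OF assms(1), of 1 r] by (intro eq_matI) (auto simp: elem_mat_index autD)

end

section \<open>Automorphisms are semilinear up to the contragredient\<close>

lemma (in euclidean_subring) det_RM:
  assumes "A \<in> RM"
  shows "det A \<in> R"
proof -
  have sR: "signof q \<in> R" for q :: "nat \<Rightarrow> nat"
    by (cases q rule: sign_cases) auto
  then show ?thesis
    using assms unfolding det_def RM_def
    by (auto intro!: R_sum R_mult R_prod dest: permutes_in_image)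
qed

context matrix_aut
begin

text \<open>The vectors \<open>V j\<close> are the columns of \<open>g\<close> and the
  \<open>F i\<close> the rows of \<open>h\<close>. Duality of the two families is
  \<open>h * g = 1\<close>, and it turns each image transvection into a conjugate of an elementary
  matrix.\<close>

lemma frame_matrix:
  assumes aut: "ring_aut R \<rho>" and RV: "\<And>i. i < n \<Longrightarrow> V i \<in> RV" "\<And>i. i < n \<Longrightarrow> F i \<in> RV"
    and orth: "\<And>i j. i < n \<Longrightarrow> j < n \<Longrightarrow> scalar_prod (F i) (V j) = (if i = j then 1 else 0)"
    and phi: "\<And>i j r. i < n \<Longrightarrow> j < n \<Longrightarrow> i \<noteq> j \<Longrightarrow> r \<in> R \<Longrightarrow> \<phi> (elem_mat n i j r) = transvec n (\<rho> r) (V i) (F j)"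
  shows "\<exists>g h. g \<in> RM \<and> h \<in> RM \<and> g * h = 1\<^sub>m n \<and> h * g = 1\<^sub>m n \<and>
    (\<forall>i<n. \<forall>j<n. i \<noteq> j \<longrightarrow> (\<forall>r \<in> R. \<phi> (elem_mat n i j r) * g = g * elem_mat n i j (\<rho> r)))"
proof -
  define g where "g = mat n n (\<lambda>(a, b). V b $ a)"
  define h where "h = mat n n (\<lambda>(a, b). F a $ b)"
  have g: "g \<in> RM" and h: "h \<in> RM" using RV by (auto simp: RM_def RV_def g_def h_def)
  note gc = RM_carrier[OF g] and hc = RM_carrier[OF h]
  have hg: "h * g = 1\<^sub>m n"
  proof (rule eq_matI)
    fix i j assume "i < dim_row (1\<^sub>m n :: 'a mat)" "j < dim_col (1\<^sub>m n :: 'a mat)"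
    then have ij: "i < n" "j < n" by auto
    have "(h * g) $$ (i, j) = scalar_prod (F i) (V j)"
      using ij RV_carrier[OF RV(1)[OF ij(2)]] by (simp add: scalar_prod_def g_def h_def)
    then show "(h * g) $$ (i, j) = 1\<^sub>m n $$ (i, j)" using orth[OF ij] ij by simp
  qed (use gc hc in auto)
  then have gh: "g * h = 1\<^sub>m n" using mat_mult_left_right_inverse[OF hc gc] by simp
  have "\<phi> (elem_mat n i j r) * g = g * elem_mat n i j (\<rho> r)" if ij: "i < n" "j < n" "i \<noteq> j" and r: "r \<in> R" for i j r
  proof (rule eq_matI)
    fix a b assume "a < dim_row (g * elem_mat n i j (\<rho> r))" "b < dim_col (g * elem_mat n i j (\<rho> r))"
    then have ab: "a < n" "b < n" using gc by auto
    have "(\<Sum>k<n. F j $ k * g $$ (k, b)) = scalar_prod (F j) (V b)"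
      using ab RV_carrier[OF RV(1)[OF ab(2)]] by (simp add: scalar_prod_lessThan[of "V b" n] g_def)
    then have "(\<phi> (elem_mat n i j r) * g) $$ (a, b) = g $$ (a, b) + \<rho> r * V i $ a * (if j = b then 1 else 0)"
      unfolding phi[OF ij r] using transvec_mult[OF gc RV_carrier[OF RV(2)[OF ij(2)]] ab] orth[OF ij(2) ab(2)] by simp
    moreover have "g $$ (a, i) = V i $ a" using ab ij by (simp add: g_def)
    ultimately show "(\<phi> (elem_mat n i j r) * g) $$ (a, b) = (g * elem_mat n i j (\<rho> r)) $$ (a, b)"
      using elem_mat_mult_right[OF gc ij(1,2) ab, of "\<rho> r"] by auto
  qed (use phi_G[OF elem_mat_G[OF ij(3) r]] G_carrier gc in auto)
  then show ?thesis using g h gh hg by blast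
qed

lemma det_R_unit:
  assumes A: "A \<in> G"
  shows "R_unit (det A)"
proof -
  obtain B where B: "B \<in> G" "A * B = 1\<^sub>m n" using G_inv[OF A] by blast
  have "det A * det B = 1"
    using det_mult[OF G_carrier[OF A] G_carrier[OF B(1)]] B by simp
  then show ?thesis using R_unitI det_RM G_RM A B by blast
qed

lemma matrix_inverse_cancel:
  fixes A :: "'a mat"
  assumes "h * g = 1\<^sub>m n" "h \<in> carrier_mat n n" "g \<in> carrier_mat n n" "A \<in> carrier_mat n n"
  shows "h * (g * A) = A" "A * h * g = A"
proof -
  show "h * (g * A) = A"
    unfolding assoc_mult_mat[OF assms(2-4), symmetric] assms(1) using assms(4) by simp
  show "A * h * g = A"
    unfolding assoc_mult_mat[OF assms(4,2,3)] assms(1) using assms(4) by simp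
qed

text \<open>By \<open>elementary_induct\<close> only diagonal matrices \<open>D\<close> remain.
  Conjugated by \<open>g\<close>, the image of \<open>D\<close> acts on root elements as the
  entrywise image of \<open>D\<close> under \<open>\<rho>\<close> does, which determines it up to a
  scalar. The scalar is allowed to depend on the matrix.\<close>

lemma extends_to_G:
  assumes aut: "ring_aut R \<rho>" and gh: "g \<in> RM" "h \<in> RM" "g * h = 1\<^sub>m n" "h * g = 1\<^sub>m n"
    and elem_mat: "\<And>i j r. i < n \<Longrightarrow> j < n \<Longrightarrow> i \<noteq> j \<Longrightarrow> r \<in> R \<Longrightarrow> \<phi> (elem_mat n i j r) * g = g * elem_mat n i j (\<rho> r)"
    and A: "A \<in> G"
  shows "\<exists>\<chi>. R_unit \<chi> \<and> \<phi> A * g = \<chi> \<cdot>\<^sub>m (g * map_mat \<rho> A)"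
proof -
  note gc = RM_carrier[OF gh(1)] and hc = RM_carrier[OF gh(2)]
  note assoc = assoc_mult_mat[of _ n n _ n _ n]
  \<comment> \<open>Membership in \<open>G\<close> is a premise of the induction predicate because
    the induction runs through \<open>RM\<close>; it passes to smaller cases since elementary
    matrices are invertible in \<open>G\<close>.\<close>
  have "A \<in> G \<longrightarrow> (\<exists>\<chi>. R_unit \<chi> \<and> \<phi> A * g = \<chi> \<cdot>\<^sub>m (g * map_mat \<rho> A))"
  proof (rule elementary_induct[OF G_RM[OF A] det_R_unit[OF A]])
    fix B i j r
    assume B: "B \<in> RM" and IH: "B \<in> G \<longrightarrow> (\<exists>\<chi>. R_unit \<chi> \<and> \<phi> B * g = \<chi> \<cdot>\<^sub>m (g * map_mat \<rho> B))"
      and ij: "i < n" "j < n" "i \<noteq> j" and r: "r \<in> R"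
    let ?E = "elem_mat n i j r"
    have E: "?E \<in> G" "elem_mat n i j (- r) \<in> G" using elem_mat_G ij r by auto
    show "?E * B \<in> G \<longrightarrow> (\<exists>\<chi>. R_unit \<chi> \<and> \<phi> (?E * B) * g = \<chi> \<cdot>\<^sub>m (g * map_mat \<rho> (?E * B)))"
    proof
      assume EB: "?E * B \<in> G"
      have "elem_mat n i j (- r) * (?E * B) = (elem_mat n i j (- r) * ?E) * B"
        using RM_carrier[OF B] by (intro assoc[symmetric]) auto
      also have "\<dots> = B" using ij RM_carrier[OF B] by (simp add: elem_mat_add elem_mat_zero)
      finally have BG: "B \<in> G" using G_mult[OF E(2) EB] by simp
      then obtain \<chi> where c: "R_unit \<chi>" "\<phi> B * g = \<chi> \<cdot>\<^sub>m (g * map_mat \<rho> B)" using IH by blast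
      have mB: "map_mat \<rho> B \<in> carrier_mat n n" using RM_carrier[OF B] by simp
      note pc = G_carrier[OF phi_G[OF E(1)]] G_carrier[OF phi_G[OF BG]]
      have "\<phi> (?E * B) * g = \<phi> ?E * (\<phi> B * g)"
        unfolding phi_mult[OF E(1) BG] using pc gc by (intro assoc)
      also have "\<dots> = \<chi> \<cdot>\<^sub>m (\<phi> ?E * (g * map_mat \<rho> B))"
        unfolding c(2) using pc gc mB by (simp add: mult_smult_distrib[of _ n n _ n])
      also have "\<phi> ?E * (g * map_mat \<rho> B) = (\<phi> ?E * g) * map_mat \<rho> B"
        using pc gc mB by (intro assoc[symmetric])
      also have "\<dots> = g * (elem_mat n i j (\<rho> r) * map_mat \<rho> B)"
        unfolding elem_mat[OF ij r] using gc mB by (intro assoc) auto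
      also have "elem_mat n i j (\<rho> r) * map_mat \<rho> B = map_mat \<rho> (?E * B)"
        unfolding map_mult[OF aut elem_mat_RM[OF r] B] map_elem_mat[OF aut r] ..
      finally show "\<exists>\<chi>. R_unit \<chi> \<and> \<phi> (?E * B) * g = \<chi> \<cdot>\<^sub>m (g * map_mat \<rho> (?E * B))"
        using c by blast
    qed
  next
    fix D assume D: "D \<in> RM" and off: "\<And>i j. i < n \<Longrightarrow> j < n \<Longrightarrow> i \<noteq> j \<Longrightarrow> D $$ (i, j) = 0"
      and un: "\<And>i. i < n \<Longrightarrow> R_unit (D $$ (i, i))"
    show "D \<in> G \<longrightarrow> (\<exists>\<chi>. R_unit \<chi> \<and> \<phi> D * g = \<chi> \<cdot>\<^sub>m (g * map_mat \<rho> D))"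
    proof
      assume DG: "D \<in> G"
      note Dc = RM_carrier[OF D] and pD = G_carrier[OF phi_G[OF DG]]
      define T where "T = h * (\<phi> D * g)"
      have T: "T \<in> RM" unfolding T_def by (intro mult_RM gh G_RM phi_G DG)
      note Tc = RM_carrier[OF T]
      have gT: "g * T = \<phi> D * g"
        unfolding T_def using matrix_inverse_cancel(1)[OF gh(3) gc hc, of "\<phi> D * g"] pD gc by simp
      \<comment> \<open>Conjugation by \<open>D\<close> scales the root \<open>(i, j)\<close> by
        \<open>q i j\<close>.\<close>
      define q where "q i j = D $$ (i, i) * (1 / D $$ (j, j))" for i j
      have qR: "q i j \<in> R" if "i < n" "j < n" for i j
        using un that unfolding q_def by (intro R_mult) (auto simp: R_unit_def)
      have TE: "T * elem_mat n i j 1 = elem_mat n i j (\<rho> (q i j)) * T" if ij: "i < n" "j < n" "i \<noteq> j" for i j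
      proof -
        let ?E = "elem_mat n i j 1" and ?E' = "elem_mat n i j (q i j)"
        have E: "?E \<in> G" "?E' \<in> G" using elem_mat_G[OF ij(3)] qR[OF ij(1,2)] by auto
        have "D * ?E = ?E' * D"
        proof (rule eq_matI)
          fix a b assume "a < dim_row (?E' * D)" "b < dim_col (?E' * D)"
          then have ab: "a < n" "b < n" using Dc by auto
          show "(D * ?E) $$ (a, b) = (?E' * D) $$ (a, b)"
            unfolding elem_mat_mult_left[OF Dc ij(1,2) ab] elem_mat_mult_right[OF Dc ij(1,2) ab]
            using off ab ij un[OF ij(2)] by (auto simp: q_def R_unit_def)
        qed (use Dc in auto)
        from arg_cong[OF this, of \<phi>]
        have "\<phi> D * \<phi> ?E = \<phi> ?E' * \<phi> D"
          unfolding phi_mult[OF DG E(1)] phi_mult[OF E(2) DG] .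
        then have "\<phi> D * \<phi> ?E * g = \<phi> ?E' * \<phi> D * g" by simp
        note pc = G_carrier[OF phi_G[OF E(1)]] G_carrier[OF phi_G[OF E(2)]]
        have "g * (T * ?E) = (g * T) * elem_mat n i j (\<rho> 1)"
          using gc Tc autD(2)[OF aut] by (simp add: assoc)
        also have "\<dots> = \<phi> D * (g * elem_mat n i j (\<rho> 1))"
          unfolding gT using pD gc by (intro assoc) auto
        also have "\<dots> = \<phi> D * \<phi> ?E * g"
          unfolding elem_mat[OF ij R_one, symmetric] using pD gc pc by (intro assoc[symmetric])
        also have "\<dots> = \<phi> ?E' * \<phi> D * g" by fact
        also have "\<dots> = \<phi> ?E' * (g * T)" unfolding gT using pD gc pc by (intro assoc)
        also have "\<dots> = (\<phi> ?E' * g) * T" using Tc gc pc by (intro assoc[symmetric])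
        also have "\<dots> = g * (elem_mat n i j (\<rho> (q i j)) * T)"
          unfolding elem_mat[OF ij qR[OF ij(1,2)]] using Tc gc by (intro assoc) auto
        finally have eq: "g * (T * ?E) = g * (elem_mat n i j (\<rho> (q i j)) * T)" .
        have c: "T * ?E \<in> carrier_mat n n" "elem_mat n i j (\<rho> (q i j)) * T \<in> carrier_mat n n"
          using Tc by (auto intro: mult_carrier_mat)
        show ?thesis
          using matrix_inverse_cancel(1)[OF gh(4) hc gc c(1)] matrix_inverse_cancel(1)[OF gh(4) hc gc c(2)]
          unfolding eq by (rule trans[OF sym])
      qed
      have ent: "(if b = j then T $$ (a, i) else 0) = (if a = i then \<rho> (q i j) * T $$ (j, b) else 0)"
        if ij: "i < n" "j < n" "i \<noteq> j" and ab: "a < n" "b < n" for i j a b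
      proof -
        have "(T * elem_mat n i j 1) $$ (a, b) = (elem_mat n i j (\<rho> (q i j)) * T) $$ (a, b)" using TE[OF ij] by simp
        then show ?thesis
          unfolding elem_mat_mult_left[OF Tc ij(1,2) ab] elem_mat_mult_right[OF Tc ij(1,2) ab]
          by (simp only: add_left_cancel mult_1_left)
      qed
      have Toff: "T $$ (a, i) = 0" if ai: "a < n" "i < n" "a \<noteq> i" for a i
      proof -
        obtain j where j: "j < n" "j \<noteq> i" using third_index[of i i] by blast
        show ?thesis using ent[OF ai(2) j(1) _ ai(1) j(1)] j ai by auto
      qed
      have n0: "0 < n" using n by simp
      \<comment> \<open>The scalar is read off at \<open>(0, 0)\<close>; the roots
        \<open>(i, 0)\<close> show that the same factor occurs along the whole diagonal.\<close>
      define \<chi> where "\<chi> = T $$ (0, 0) * (1 / \<rho> (D $$ (0, 0)))"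
      note r0 = aut_R_unit(1)[OF aut un[OF n0]]
      have Tdiag: "T $$ (i, i) = \<chi> * \<rho> (D $$ (i, i))" if i: "i < n" for i
      proof (cases "i = 0")
        case True
        then show ?thesis using r0 by (simp add: \<chi>_def R_unit_def)
      next
        case False
        have "T $$ (i, i) = \<rho> (q i 0) * T $$ (0, 0)"
          using ent[OF i n0 False i n0] by simp
        also have "\<rho> (q i 0) = \<rho> (D $$ (i, i)) * (1 / \<rho> (D $$ (0, 0)))"
          unfolding q_def aut_R_unit(2)[OF aut un[OF n0], symmetric]
          using un[OF i] un[OF n0] by (intro autD(5)[OF aut]) (auto simp: R_unit_def)
        finally show ?thesis by (simp add: \<chi>_def)
      qed
      have TX: "T = \<chi> \<cdot>\<^sub>m map_mat \<rho> D"
      proof (rule eq_matI)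
        fix a b assume "a < dim_row (\<chi> \<cdot>\<^sub>m map_mat \<rho> D)" "b < dim_col (\<chi> \<cdot>\<^sub>m map_mat \<rho> D)"
        then have ab: "a < n" "b < n" using Dc by auto
        show "T $$ (a, b) = (\<chi> \<cdot>\<^sub>m map_mat \<rho> D) $$ (a, b)"
          using Toff[OF ab] Tdiag[OF ab(1)] off[OF ab] ab Dc autD(3)[OF aut] by (cases "a = b") auto
      qed (use Tc Dc in auto)
      have "R_unit \<chi>"
      proof -
        \<comment> \<open>The inverse of \<open>D\<close> provides an integral inverse of the
          diagonal matrix \<open>T\<close>, so its corner entry is a unit.\<close>
        obtain D' where D': "D' \<in> G" "D * D' = 1\<^sub>m n" using G_inv[OF DG] by blast
        define T' where "T' = h * (\<phi> D' * g)"
        have T': "T' \<in> RM" unfolding T'_def by (intro mult_RM gh G_RM phi_G D')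
        note T'c = RM_carrier[OF T'] and pD' = G_carrier[OF phi_G[OF D'(1)]]
        have gT': "g * T' = \<phi> D' * g"
          unfolding T'_def using matrix_inverse_cancel(1)[OF gh(3) gc hc, of "\<phi> D' * g"] pD' gc by simp
        have "g * (T * T') = (g * T) * T'" using gc Tc T'c by (intro assoc[symmetric])
        also have "\<dots> = \<phi> D * (g * T')" unfolding gT using pD gc T'c by (intro assoc)
        also have "\<dots> = \<phi> D * \<phi> D' * g" unfolding gT' using pD pD' gc by (intro assoc[symmetric])
        also have "\<dots> = g"
          unfolding phi_mult[OF DG D'(1), symmetric] D'(2) phi_one using gc by simp
        finally have eq: "g * (T * T') = g" .
        have c: "T * T' \<in> carrier_mat n n" using Tc T'c by simp
        have TT: "T * T' = 1\<^sub>m n" using matrix_inverse_cancel(1)[OF gh(4) hc gc c] unfolding eq gh(4) by simp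
        have "(T * T') $$ (0, 0) = (\<Sum>k = 0..<n. T $$ (0, k) * T' $$ (k, 0))"
          using Tc T'c n0 by (simp add: scalar_prod_def)
        also have "\<dots> = (\<Sum>k = 0..<n. if k = 0 then T $$ (0, 0) * T' $$ (0, 0) else 0)"
          using Toff[OF n0] by (intro sum.cong) auto
        also have "\<dots> = T $$ (0, 0) * T' $$ (0, 0)" using n0 by simp
        finally have "T $$ (0, 0) * T' $$ (0, 0) = 1" using n0 unfolding TT by simp
        moreover have "T $$ (0, 0) \<in> R" "T' $$ (0, 0) \<in> R" using T T' n0 by (auto simp: RM_def)
        ultimately have "R_unit (T $$ (0, 0))" by (intro R_unitI)
        moreover have "R_unit (1 / \<rho> (D $$ (0, 0)))" using r0 by (auto simp: R_unit_def)
        ultimately show ?thesis unfolding \<chi>_def by (rule R_unit_mult)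
      qed
      moreover have "\<phi> D * g = \<chi> \<cdot>\<^sub>m (g * map_mat \<rho> D)"
        unfolding gT[symmetric] TX using gc Dc by (simp add: mult_smult_distrib[of _ n n _ n])
      ultimately show "\<exists>\<chi>. R_unit \<chi> \<and> \<phi> D * g = \<chi> \<cdot>\<^sub>m (g * map_mat \<rho> D)" by blast
    qed
  qed
  then show ?thesis using A by blast
qed

lemma straight_semilinear:
  assumes "roots v f" "straight v f"
  shows "\<exists>\<rho> g h. ring_aut R \<rho> \<and> g \<in> RM \<and> h \<in> RM \<and> g * h = 1\<^sub>m n \<and> h * g = 1\<^sub>m n \<and>
    (\<forall>A \<in> G. \<exists>\<chi>. R_unit \<chi> \<and> \<phi> A * g = \<chi> \<cdot>\<^sub>m (g * map_mat \<rho> A))"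
proof -
  obtain V F where VF: "\<forall>i<n. unimodular (V i) \<and> unimodular (F i)"
    "\<forall>i<n. \<forall>j<n. scalar_prod (F i) (V j) = 0 \<longleftrightarrow> i \<noteq> j"
    "\<forall>i<n. \<forall>j<n. i \<noteq> j \<longrightarrow> (\<lambda>r. \<phi> (elem_mat n i j r)) ` R = (\<lambda>c. transvec n c (V i) (F j)) ` R"
    using straight_frame[OF assms] by (elim exE conjE)
  have "\<exists>\<rho> V F. ring_aut R \<rho> \<and> (\<forall>i<n. V i \<in> RV \<and> F i \<in> RV) \<and>
    (\<forall>i<n. \<forall>j<n. scalar_prod (F i) (V j) = (if i = j then 1 else 0)) \<and>
    (\<forall>i<n. \<forall>j<n. i \<noteq> j \<longrightarrow> (\<forall>r \<in> R. \<phi> (elem_mat n i j r) = transvec n (\<rho> r) (V i) (F j)))"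
    by (rule frame_coordinates[of V F]) (simp_all add: VF)
  then obtain \<rho> V F where *: "ring_aut R \<rho>" "\<forall>i<n. V i \<in> RV \<and> F i \<in> RV"
    "\<forall>i<n. \<forall>j<n. scalar_prod (F i) (V j) = (if i = j then 1 else 0)"
    "\<forall>i<n. \<forall>j<n. i \<noteq> j \<longrightarrow> (\<forall>r \<in> R. \<phi> (elem_mat n i j r) = transvec n (\<rho> r) (V i) (F j))"
    by (elim exE conjE)
  have "\<exists>g h. g \<in> RM \<and> h \<in> RM \<and> g * h = 1\<^sub>m n \<and> h * g = 1\<^sub>m n \<and>
    (\<forall>i<n. \<forall>j<n. i \<noteq> j \<longrightarrow> (\<forall>r \<in> R. \<phi> (elem_mat n i j r) * g = g * elem_mat n i j (\<rho> r)))"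
    by (rule frame_matrix[OF *(1), of V F]) (simp_all add: *)
  then obtain g h where gh: "g \<in> RM" "h \<in> RM" "g * h = 1\<^sub>m n" "h * g = 1\<^sub>m n"
    and elem_mat: "\<forall>i<n. \<forall>j<n. i \<noteq> j \<longrightarrow> (\<forall>r \<in> R. \<phi> (elem_mat n i j r) * g = g * elem_mat n i j (\<rho> r))"
    by (elim exE conjE)
  have "\<exists>\<chi>. R_unit \<chi> \<and> \<phi> A * g = \<chi> \<cdot>\<^sub>m (g * map_mat \<rho> A)" if "A \<in> G" for A
    by (rule extends_to_G[OF *(1) gh _ that]) (simp add: elem_mat)
  then show ?thesis using *(1) gh by blast
qed

end

text \<open>Closure under transposition makes the contragredient a map from \<open>G\<close> to
  itself.\<close>

locale matrix_aut_transpose = matrix_aut +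
  assumes G_trans: "A \<in> G \<Longrightarrow> transpose_mat A \<in> G"
begin

definition G_inverse :: "'a mat \<Rightarrow> 'a mat" where
  "G_inverse A = (SOME B. B \<in> G \<and> A * B = 1\<^sub>m n \<and> B * A = 1\<^sub>m n)"

lemma G_inverse:
  assumes "A \<in> G"
  shows "G_inverse A \<in> G" "A * G_inverse A = 1\<^sub>m n" "G_inverse A * A = 1\<^sub>m n"
  using someI_ex[OF G_inv[OF assms, unfolded Bex_def]] unfolding G_inverse_def by blast+

lemma G_inverse_unique:
  assumes A: "A \<in> G" and B: "B \<in> G" "A * B = 1\<^sub>m n"
  shows "G_inverse A = B"
proof -
  note c = G_carrier[OF G_inverse(1)[OF A]] G_carrier[OF A] G_carrier[OF B(1)]
  have "G_inverse A * (A * B) = G_inverse A * A * B" using c by (simp add: assoc_mult_mat[of _ n n _ n _ n])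
  then show ?thesis unfolding B(2) G_inverse(3)[OF A] using c by simp
qed

definition contragredient :: "'a mat \<Rightarrow> 'a mat" where
  "contragredient A = transpose_mat (G_inverse A)"

lemma contragredient_G: "A \<in> G \<Longrightarrow> contragredient A \<in> G"
  by (simp add: contragredient_def G_trans G_inverse)

lemma contragredient_transpose: "A \<in> G \<Longrightarrow> contragredient A * transpose_mat A = 1\<^sub>m n"
  using transpose_mult[OF G_carrier G_carrier, of A "G_inverse A"] G_inverse[of A] by (simp add: contragredient_def)

lemma G_inverse_mult: "A \<in> G \<Longrightarrow> B \<in> G \<Longrightarrow> G_inverse (A * B) = G_inverse B * G_inverse A"
proof (rule G_inverse_unique)
  assume AB: "A \<in> G" "B \<in> G"
  show "A * B \<in> G" "G_inverse B * G_inverse A \<in> G" using AB G_mult G_inverse by auto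
  note c = G_carrier[OF AB(1)] G_carrier[OF AB(2)] G_carrier[OF G_inverse(1)[OF AB(1)]] G_carrier[OF G_inverse(1)[OF AB(2)]]
  have "A * B * (G_inverse B * G_inverse A) = A * (B * G_inverse B * G_inverse A)"
    using c by (simp add: assoc_mult_mat[of _ n n _ n _ n])
  then show "A * B * (G_inverse B * G_inverse A) = 1\<^sub>m n" using G_inverse AB c by simp
qed

lemma contragredient_mult: "A \<in> G \<Longrightarrow> B \<in> G \<Longrightarrow> contragredient (A * B) = contragredient A * contragredient B"
  unfolding contragredient_def G_inverse_mult
  by (rule transpose_mult[of _ n n _ n]) (use G_carrier G_inverse in auto)

lemma contragredient_contragredient: "A \<in> G \<Longrightarrow> contragredient (contragredient A) = A"
proof -
  assume A: "A \<in> G"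
  have "G_inverse (contragredient A) = transpose_mat A"
    by (rule G_inverse_unique[OF contragredient_G[OF A] G_trans[OF A] contragredient_transpose[OF A]])
  then show ?thesis by (simp add: contragredient_def)
qed

lemma contragredient_elem_mat:
  assumes ij: "i < n" "j < n" "i \<noteq> j" and r: "r \<in> R"
  shows "contragredient (elem_mat n i j r) = elem_mat n j i (- r)"
proof -
  have "G_inverse (elem_mat n i j r) = elem_mat n i j (- r)"
    by (rule G_inverse_unique) (use ij r elem_mat_G in \<open>auto simp: elem_mat_add elem_mat_zero\<close>)
  then show ?thesis unfolding contragredient_def by (intro eq_matI) (auto simp: elem_mat_index)
qed

lemma contragredient_matrix_aut: "matrix_aut R dl n p G (\<phi> \<circ> contragredient)"
proof (unfold_locales, goal_cases)
  case (5)
  have "bij_betw contragredient G G"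
    by (rule bij_betw_byWitness[of _ contragredient]) (auto simp: contragredient_contragredient contragredient_G)
  then show ?case using phi_bij by (rule bij_betw_trans)
next
  case (6 A B) then show ?case by (simp add: contragredient_mult contragredient_G phi_mult)
qed (use G_RM SL_G G_mult G_inv in auto)

text \<open>The contragredient sends the root element at \<open>(i, j)\<close> with parameter
  \<open>r\<close> to the one at \<open>(j, i)\<close> with \<open>- r\<close>, so composing with it
  turns \<open>skew\<close> into \<open>straight\<close>. In the second alternative the transposed
  factor is multiplied over to the left, so that no inverse matrix appears.\<close>

theorem semilinear_or_contragredient:
  shows "\<exists>\<rho> g h. ring_aut R \<rho> \<and> g \<in> RM \<and> h \<in> RM \<and> g * h = 1\<^sub>m n \<and> h * g = 1\<^sub>m n \<and>
    ((\<forall>A \<in> G. \<exists>\<chi>. R_unit \<chi> \<and> \<phi> A * g = \<chi> \<cdot>\<^sub>m (g * map_mat \<rho> A)) \<or>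
     (\<forall>A \<in> G. \<exists>\<chi>. R_unit \<chi> \<and> \<phi> A * (g * transpose_mat (map_mat \<rho> A)) = \<chi> \<cdot>\<^sub>m g))"
proof -
  obtain v f where r: "roots v f" using ex_roots by blast
  show ?thesis
  proof (cases "straight v f")
    case True
    show ?thesis using straight_semilinear[OF r True] by blast
  next
    case False
    then have sk: "skew v f" using straight_or_skew[OF r] by blast
    interpret C: matrix_aut R dl n p G "\<phi> \<circ> contragredient" by (rule contragredient_matrix_aut)
    have r': "C.roots (\<lambda>i j. v j i) (\<lambda>i j. f j i)"
      unfolding C.roots_def
    proof (intro allI impI)
      fix i j assume ij: "i < n" "j < n" "i \<noteq> j"
      have ji: "j \<noteq> i" using ij by simp
      note D = rootsD[OF r ij(2,1) ji]
      have "(\<lambda>r. (\<phi> \<circ> contragredient) (elem_mat n i j r)) ` R = (\<lambda>r. \<phi> (elem_mat n j i (- r))) ` R"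
        using contragredient_elem_mat[OF ij] by (intro image_cong) auto
      also have "\<dots> = (\<lambda>r. \<phi> (elem_mat n j i r)) ` R"
      proof -
        have "R = uminus ` R"
        proof
          show "R \<subseteq> uminus ` R"
          proof
            fix x assume "x \<in> R"
            then have "- (- x) \<in> uminus ` R" by (intro imageI R_uminus)
            then show "x \<in> uminus ` R" by simp
          qed
        qed auto
        then have "(\<lambda>r. \<phi> (elem_mat n j i r)) ` R = (\<lambda>r. \<phi> (elem_mat n j i r)) ` uminus ` R" by simp
        then show ?thesis by (simp add: image_image)
      qed
      finally show "unimodular (v j i) \<and> unimodular (f j i) \<and> scalar_prod (f j i) (v j i) = 0 \<and>
        (\<lambda>r. (\<phi> \<circ> contragredient) (elem_mat n i j r)) ` R = (\<lambda>c. transvec n c (v j i) (f j i)) ` R"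
        using D(1-4) by simp
    qed
    have s': "C.straight (\<lambda>i j. v j i) (\<lambda>i j. f j i)"
      unfolding C.straight_def
    proof (intro allI impI)
      fix i j k assume ijk: "i < n" "j < n" "k < n" "i \<noteq> j" "j \<noteq> k" "i \<noteq> k"
      then show "scalar_prod (f j i) (v k j) \<noteq> 0 \<and> scalar_prod (f k j) (v j i) = 0 \<and>
        parallel (v k i) (v j i) \<and> parallel (f k i) (f k j)"
        using sk[unfolded skew_def, rule_format, of k j i] by simp
    qed
    obtain \<rho> g h where *: "ring_aut R \<rho>" "g \<in> RM" "h \<in> RM" "g * h = 1\<^sub>m n" "h * g = 1\<^sub>m n"
      and ex: "\<And>A. A \<in> G \<Longrightarrow> \<exists>\<chi>. R_unit \<chi> \<and> (\<phi> \<circ> contragredient) A * g = \<chi> \<cdot>\<^sub>m (g * map_mat \<rho> A)"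
      using C.straight_semilinear[OF r' s'] by blast
    note gc = RM_carrier[OF *(2)]
    have "\<exists>\<chi>. R_unit \<chi> \<and> \<phi> A * (g * transpose_mat (map_mat \<rho> A)) = \<chi> \<cdot>\<^sub>m g" if A: "A \<in> G" for A
    proof -
      obtain \<chi> where c: "R_unit \<chi>" "\<phi> A * g = \<chi> \<cdot>\<^sub>m (g * map_mat \<rho> (contragredient A))"
        using ex[OF contragredient_G[OF A]] contragredient_contragredient[OF A] by auto
      let ?P = "map_mat \<rho> (contragredient A)" and ?Q = "map_mat \<rho> (transpose_mat A)"
      note car = G_carrier[OF A] G_carrier[OF contragredient_G[OF A]] G_carrier[OF phi_G[OF A]] gc
      have PQ: "?P \<in> carrier_mat n n" "?Q \<in> carrier_mat n n" using car by auto
      have pq: "?P * ?Q = 1\<^sub>m n"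
        unfolding map_mult[OF *(1) G_RM[OF contragredient_G[OF A]] G_RM[OF G_trans[OF A]], symmetric]
          contragredient_transpose[OF A] by (rule map_one[OF *(1)])
      have "transpose_mat (map_mat \<rho> A) = ?Q" by (auto intro: eq_matI)
      moreover have "\<phi> A * (g * ?Q) = \<phi> A * g * ?Q"
        using car PQ by (simp add: assoc_mult_mat[of _ n n _ n _ n])
      moreover have "\<dots> = \<chi> \<cdot>\<^sub>m (g * ?P * ?Q)"
        unfolding c(2) using car PQ by (simp add: mult_smult_assoc_mat[of _ n n _ n])
      moreover have "g * ?P * ?Q = g"
        using car PQ pq by (simp add: assoc_mult_mat[of _ n n _ n _ n])
      ultimately show ?thesis using c(1) by auto
    qed
    then show ?thesis using * by blast
  qed
qed

end

section \<open>Degree and denominators of rational functions\<close>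

abbreviation pdeg :: "'k :: zero poly \<Rightarrow> nat" where "pdeg \<equiv> Polynomial.degree"
abbreviation pcoeff :: "'k :: zero poly \<Rightarrow> nat \<Rightarrow> 'k" where "pcoeff \<equiv> Polynomial.coeff"

text \<open>This is minus the valuation at infinity. The value at 0 is unspecified, hence the
  nonzero premises below and the separate case in \<open>deg_le\<close>.\<close>

definition fdeg :: "'k :: field poly fract \<Rightarrow> int" where
  "fdeg x = (THE d. \<exists>a b. a \<noteq> 0 \<and> b \<noteq> 0 \<and> x = to_fract a / to_fract b \<and> d = int (pdeg a) - int (pdeg b))"

lemma fract_cases:
  obtains a b :: "'k :: field poly" where "b \<noteq> 0" "x = to_fract a / to_fract b"
proof (cases x)
  case (Fract a b)
  then have "x = to_fract a / to_fract b" by (simp add: Fract_conv_to_fract)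
  then show ?thesis using Fract that by blast
qed

lemma fdeg_eq:
  fixes a b :: "'k :: field poly"
  assumes "a \<noteq> 0" "b \<noteq> 0"
  shows "fdeg (to_fract a / to_fract b) = int (pdeg a) - int (pdeg b)"
  unfolding fdeg_def
proof (rule the_equality)
  show "\<exists>a' b'. a' \<noteq> 0 \<and> b' \<noteq> 0 \<and> to_fract a / to_fract b = to_fract a' / to_fract b' \<and>
    int (pdeg a) - int (pdeg b) = int (pdeg a') - int (pdeg b')" using assms by blast
next
  fix d assume "\<exists>a' b'. a' \<noteq> 0 \<and> b' \<noteq> 0 \<and> to_fract a / to_fract b = to_fract a' / to_fract b' \<and>
    d = int (pdeg a') - int (pdeg b')"
  then obtain a' b' where *: "a' \<noteq> 0" "b' \<noteq> 0" "to_fract a / to_fract b = to_fract a' / to_fract b'"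
    "d = int (pdeg a') - int (pdeg b')" by blast
  then have "to_fract (a * b') = to_fract (a' * b)" using assms by (simp add: field_simps)
  then have "a * b' = a' * b" by (simp only: to_fract_eq_iff)
  then have "pdeg a + pdeg b' = pdeg a' + pdeg b"
    using assms * by (metis degree_mult_eq)
  then show "d = int (pdeg a) - int (pdeg b)" using * by simp
qed

lemma fdeg_to_fract: "(a :: 'k :: field poly) \<noteq> 0 \<Longrightarrow> fdeg (to_fract a) = int (pdeg a)"
  using fdeg_eq[of a 1] by simp

lemma fdeg_one: "fdeg 1 = 0"
  using fdeg_to_fract[of 1] by simp

lemma fdeg_mult:
  assumes "x \<noteq> 0" "y \<noteq> 0"
  shows "fdeg (x * y) = fdeg x + fdeg y"
proof -
  obtain a b where ab: "b \<noteq> 0" "x = to_fract a / to_fract b" by (rule fract_cases)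
  obtain c d where cd: "d \<noteq> 0" "y = to_fract c / to_fract d" by (rule fract_cases)
  have "a \<noteq> 0" "c \<noteq> 0" using ab cd assms by auto
  moreover have "x * y = to_fract (a * c) / to_fract (b * d)" using ab cd by simp
  ultimately show ?thesis
    using ab cd fdeg_eq[of "a * c" "b * d"] fdeg_eq[of a b] fdeg_eq[of c d] by (simp add: degree_mult_eq)
qed

lemma fdeg_power: "x \<noteq> 0 \<Longrightarrow> fdeg (x ^ k) = int k * fdeg x"
  by (induction k) (auto simp: fdeg_one fdeg_mult algebra_simps)

lemma fdeg_uminus: "x \<noteq> 0 \<Longrightarrow> fdeg (- x) = fdeg x"
proof -
  assume x: "x \<noteq> 0"
  obtain a b where ab: "b \<noteq> 0" "x = to_fract a / to_fract b" by (rule fract_cases)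
  then have "a \<noteq> 0" using x by auto
  moreover have "- x = to_fract (- a) / to_fract b" using ab by simp
  ultimately show ?thesis using ab fdeg_eq[of a b] fdeg_eq[of "- a" b] by simp
qed

definition deg_le :: "'k :: field poly fract \<Rightarrow> int \<Rightarrow> bool" where
  "deg_le x d \<longleftrightarrow> x = 0 \<or> fdeg x \<le> d"

lemma deg_le_zero [simp]: "deg_le 0 d" by (simp add: deg_le_def)

lemma deg_le_mono: "deg_le x d \<Longrightarrow> d \<le> e \<Longrightarrow> deg_le x e" by (auto simp: deg_le_def)

lemma deg_le_mult: "deg_le x d \<Longrightarrow> deg_le y e \<Longrightarrow> deg_le (x * y) (d + e)"
  by (cases "x = 0 \<or> y = 0") (auto simp: deg_le_def fdeg_mult)

lemma deg_le_uminus: "deg_le x d \<Longrightarrow> deg_le (- x) d"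
  by (cases "x = 0") (auto simp: deg_le_def fdeg_uminus)

lemma deg_le_add:
  assumes "deg_le x d" "deg_le y d"
  shows "deg_le (x + y) d"
proof (cases "x = 0 \<or> y = 0 \<or> x + y = 0")
  case True then show ?thesis using assms by auto
next
  case False
  obtain a b where ab: "b \<noteq> 0" "x = to_fract a / to_fract b" by (rule fract_cases)
  obtain c e where ce: "e \<noteq> 0" "y = to_fract c / to_fract e" by (rule fract_cases)
  have nz: "a \<noteq> 0" "c \<noteq> 0" using ab ce False by auto
  have xy: "x + y = to_fract (a * e + c * b) / to_fract (b * e)"
    using ab ce by (simp add: field_simps)
  then have nz': "a * e + c * b \<noteq> 0" using False by (metis divide_eq_0_iff to_fract_0)
  have "int (pdeg a) - int (pdeg b) \<le> d" "int (pdeg c) - int (pdeg e) \<le> d"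
    using assms False ab ce nz fdeg_eq[of a b] fdeg_eq[of c e] by (auto simp: deg_le_def)
  then have "int (pdeg (a * e)) \<le> d + pdeg b + pdeg e" "int (pdeg (c * b)) \<le> d + pdeg b + pdeg e"
    using nz ab ce by (simp_all add: degree_mult_eq)
  moreover have "pdeg (a * e + c * b) \<le> max (pdeg (a * e)) (pdeg (c * b))" by (rule degree_add_le_max)
  ultimately have "int (pdeg (a * e + c * b)) \<le> d + pdeg b + pdeg e" by simp
  then show ?thesis
    unfolding deg_le_def xy using fdeg_eq[OF nz', of "b * e"] ab ce by (simp add: degree_mult_eq)
qed

lemma deg_le_sum: "(\<And>i. i \<in> I \<Longrightarrow> deg_le (f i) d) \<Longrightarrow> deg_le (sum f I) d"
  by (induction I rule: infinite_finite_induct) (auto intro: deg_le_add)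

text \<open>The equality case of the ultrametric inequality: a bound below \<open>d\<close> for
  \<open>x + y\<close> would carry over to \<open>x = (x + y) - y\<close>.\<close>

lemma fdeg_add_dominant:
  assumes x: "x \<noteq> 0" "fdeg x = d" and y: "deg_le y (d - 1)"
  shows "x + y \<noteq> 0" "fdeg (x + y) = d"
proof -
  have *: "\<not> deg_le x (d - 1)" using x by (simp add: deg_le_def)
  have "deg_le (x + y) d" by (intro deg_le_add) (use x y in \<open>auto simp: deg_le_def\<close>)
  moreover have "\<not> deg_le (x + y) (d - 1)"
  proof
    assume "deg_le (x + y) (d - 1)"
    from deg_le_add[OF this deg_le_uminus[OF y]] show False using * by simp
  qed
  ultimately show "x + y \<noteq> 0" "fdeg (x + y) = d" by (auto simp: deg_le_def)
qed

text \<open>A form of the rational root theorem. At the lowest index \<open>i0\<close> with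
  \<open>c i0 \<noteq> 0\<close> all other terms are divisible by \<open>A ^ (i0 + 1)\<close>, so
  \<open>A\<close> divides \<open>c i0\<close> times a power of \<open>B\<close>, and the Bezout
  identity removes that power. Applied to linear coefficients it bounds the degree of
  \<open>A\<close>.\<close>

lemma dvd_lowest_coeff:
  fixes A B :: "'r :: idom"
  assumes A: "A \<noteq> 0" and bez: "u * A + v * B = 1" and rel: "(\<Sum>i\<le>N. c i * A ^ i * B ^ (N - i)) = 0"
    and ex: "i \<le> N" "c i \<noteq> 0"
  shows "\<exists>i\<le>N. c i \<noteq> 0 \<and> A dvd c i"
proof -
  define i0 where "i0 = (LEAST i. c i \<noteq> 0)"
  have i0: "c i0 \<noteq> 0" "\<And>i. i < i0 \<Longrightarrow> c i = 0"
    unfolding i0_def using LeastI[of "\<lambda>i. c i \<noteq> 0", OF ex(2)]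
    by (auto dest: not_less_Least)
  have le: "i0 \<le> N" using i0(2)[of i] ex by (meson leI le_trans)
  let ?f = "\<lambda>i. c i * A ^ i * B ^ (N - i)"
  have "0 = ?f i0 + sum ?f ({..N} - {i0})" using rel le by (simp add: sum.remove[of _ i0])
  moreover have "A ^ i0 * A dvd sum ?f ({..N} - {i0})"
  proof (rule dvd_sum)
    fix i assume "i \<in> {..N} - {i0}"
    then consider "i < i0" | "i > i0" by fastforce
    then show "A ^ i0 * A dvd ?f i"
    proof cases
      case 1 then show ?thesis using i0 by simp
    next
      case 2
      then have "A ^ Suc i0 dvd A ^ i" by (intro le_imp_power_dvd) simp
      then show ?thesis by (simp add: mult.commute dvd_mult dvd_mult2)
    qed
  qed
  ultimately have "A ^ i0 * A dvd ?f i0"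
    by (metis add.commute add_eq_0_iff dvd_minus_iff)
  then have "A ^ i0 * A dvd A ^ i0 * (c i0 * B ^ (N - i0))" by (simp add: ac_simps)
  then have d: "A dvd c i0 * B ^ (N - i0)" using A by (simp only: dvd_mult_cancel_left) simp
  have "A dvd c i0 * B ^ k \<Longrightarrow> A dvd c i0" for k
  proof (induction k)
    case (Suc k)
    have "c i0 * B ^ k = (c i0 * B ^ k * u) * A + v * (c i0 * B ^ Suc k)"
      using arg_cong[OF bez, of "\<lambda>z. c i0 * B ^ k * z"] by (simp add: algebra_simps)
    then show ?case using Suc by (metis dvd_add dvd_mult dvd_triv_right)
  qed simp
  then show ?thesis using d i0 le by blast
qed

text \<open>\<open>F_root\<close> is the form in which algebraicity of \<open>F\<close> over the
  prime field is used. Polynomials over \<open>F\<close> are kept as a subset of those over the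
  large field.\<close>

locale rational_subring =
  fixes F :: "'k :: field set" and R :: "'k poly fract set" and p :: nat
  assumes F0: "0 \<in> F" and F1: "1 \<in> F" and F_add: "x \<in> F \<Longrightarrow> y \<in> F \<Longrightarrow> x + y \<in> F"
    and F_uminus: "x \<in> F \<Longrightarrow> - x \<in> F" and F_mult: "x \<in> F \<Longrightarrow> y \<in> F \<Longrightarrow> x * y \<in> F"
    and F_inverse: "x \<in> F \<Longrightarrow> inverse x \<in> F"
    and F_root: "x \<in> F \<Longrightarrow> x \<noteq> 0 \<Longrightarrow> \<exists>m>0. x ^ m = 1"
    and p_prime: "prime p" and p_char: "of_nat p = (0 :: 'k)"
    and R0: "0 \<in> R" and R1: "1 \<in> R" and Ra: "r \<in> R \<Longrightarrow> s \<in> R \<Longrightarrow> r + s \<in> R"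
    and Ru: "r \<in> R \<Longrightarrow> - r \<in> R" and Rm: "r \<in> R \<Longrightarrow> s \<in> R \<Longrightarrow> r * s \<in> R"
    and poly_R: "polys_over F \<subseteq> R" and R_rat: "R \<subseteq> ratfuns_over F"
begin

definition F_polys :: "'k poly set" where "F_polys = {f. \<forall>i. pcoeff f i \<in> F}"

lemma F_sum: "(\<And>i. i \<in> I \<Longrightarrow> f i \<in> F) \<Longrightarrow> sum f I \<in> F"
  by (induction I rule: infinite_finite_induct) (auto simp: F0 F_add)

lemma F_diff: "x \<in> F \<Longrightarrow> y \<in> F \<Longrightarrow> x - y \<in> F"
  using F_add[OF _ F_uminus] by (simp add: diff_conv_add_uminus del: add_uminus_conv_diff)

lemma F_polys_add: "a \<in> F_polys \<Longrightarrow> b \<in> F_polys \<Longrightarrow> a + b \<in> F_polys"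
  and F_polys_diff: "a \<in> F_polys \<Longrightarrow> b \<in> F_polys \<Longrightarrow> a - b \<in> F_polys"
  and F_polys_mult: "a \<in> F_polys \<Longrightarrow> b \<in> F_polys \<Longrightarrow> a * b \<in> F_polys"
  and F_polys_zero: "0 \<in> F_polys" and FP_one: "1 \<in> F_polys"
  and F_polys_monom: "c \<in> F \<Longrightarrow> Polynomial.monom c k \<in> F_polys"
  and F_polys_const: "c \<in> F \<Longrightarrow> [:c:] \<in> F_polys"
  unfolding F_polys_def
  by (auto simp: F_add F_uminus F_diff F0 F1 coeff_mult coeff_pCons F_mult split: nat.splits intro!: F_sum)

lemma F_polys_power: "a \<in> F_polys \<Longrightarrow> a ^ k \<in> F_polys"
  by (induction k) (auto simp: FP_one F_polys_mult)

lemma F_polys_R: "a \<in> F_polys \<Longrightarrow> to_fract a \<in> R"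
  using poly_R unfolding polys_over_def F_polys_def by auto

text \<open>The quotient must have its coefficients in \<open>F\<close>. A quotient in
  \<open>F_polys\<close> with smallest remainder works, since otherwise the leading term of the
  remainder could be cancelled inside \<open>F_polys\<close>.\<close>

lemma F_polys_div:
  assumes a: "a \<in> F_polys" and b: "b \<in> F_polys" "b \<noteq> 0"
  shows "\<exists>q \<in> F_polys. a - q * b = 0 \<or> pdeg (a - q * b) < pdeg b"
proof -
  \<comment> \<open>The shift by \<open>Suc\<close> ranks the zero remainder below nonzero constant
    ones.\<close>
  define d where "d q = (if a - q * b = 0 then 0 else Suc (pdeg (a - q * b)))" for q
  obtain q where q: "q \<in> F_polys" and min: "\<And>q'. q' \<in> F_polys \<Longrightarrow> d q \<le> d q'"
    using ex_has_least_nat[of "\<lambda>q. q \<in> F_polys" 0 d] F_polys_zero by blast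
  let ?r = "a - q * b"
  show ?thesis
  proof (rule ccontr)
    assume "\<not> ?thesis"
    then have r: "?r \<noteq> 0" "pdeg b \<le> pdeg ?r" using q by force+
    have rF: "?r \<in> F_polys" using a b q F_polys_diff F_polys_mult by blast
    define m where "m = Polynomial.monom (pcoeff ?r (pdeg ?r) * inverse (pcoeff b (pdeg b))) (pdeg ?r - pdeg b)"
    have mF: "m \<in> F_polys" unfolding m_def using rF b by (intro F_polys_monom F_mult F_inverse) (auto simp: F_polys_def)
    let ?s = "a - (q + m) * b"
    have s: "?s = ?r - m * b" by (simp add: algebra_simps)
    have lc: "pcoeff b (pdeg b) \<noteq> 0" "pcoeff ?r (pdeg ?r) \<noteq> 0"
      using b(2) r(1) leading_coeff_0_iff by blast+
    have m0: "m \<noteq> 0" unfolding m_def using lc by (simp add: monom_eq_0_iff)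
    have dm: "pdeg m = pdeg ?r - pdeg b" unfolding m_def using lc by (intro degree_monom_eq) simp
    then have dmb: "pdeg (m * b) = pdeg ?r" using m0 b r by (simp add: degree_mult_eq)
    have "pcoeff (m * b) (pdeg ?r) = pcoeff ?r (pdeg ?r)"
      using coeff_degree_mult[of m b] lc dm unfolding dmb by (simp add: m_def)
    then have "pcoeff ?s (pdeg ?r) = 0" unfolding s by simp
    moreover have "pdeg ?s \<le> pdeg ?r" unfolding s by (rule degree_diff_le) (simp_all only: dmb order_refl)
    ultimately have "?s = 0 \<or> pdeg ?s < pdeg ?r"
      by (metis leading_coeff_0_iff le_neq_implies_less)
    then have "d (q + m) < d q" using r by (auto simp: d_def)
    then show False using min[OF F_polys_add[OF q mF]] by simp
  qed
qed

text \<open>For a reduced fraction \<open>x = a / b\<close> with \<open>u * a + v * b = 1\<close>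
  one has \<open>1 / b = u * x + v\<close>, which lies in \<open>R\<close>. So \<open>R\<close> is a
  localisation of the polynomial ring over \<open>F\<close>.\<close>

lemma coprime_fraction:
  assumes x: "x \<in> R"
  shows "\<exists>a b u v. a \<in> F_polys \<and> b \<in> F_polys \<and> u \<in> F_polys \<and> v \<in> F_polys \<and> b \<noteq> 0 \<and> u * a + v * b = 1 \<and>
    x = to_fract a / to_fract b \<and> 1 / to_fract b \<in> R"
proof -
  define P where "P b \<longleftrightarrow> b \<in> F_polys \<and> b \<noteq> 0 \<and> (\<exists>a \<in> F_polys. x = to_fract a / to_fract b)" for b
  obtain a0 b0 where "a0 \<in> F_polys" "b0 \<in> F_polys" "to_fract b0 \<noteq> 0" "x = to_fract a0 / to_fract b0"
    using x R_rat unfolding ratfuns_over_def polys_over_def F_polys_def by blast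
  then have "P b0" by (auto simp: P_def)
  then obtain b where b: "P b" and bmin: "\<And>b'. P b' \<Longrightarrow> pdeg b \<le> pdeg b'"
    using ex_has_least_nat[of P b0 pdeg] by blast
  then obtain a where a: "a \<in> F_polys" "x = to_fract a / to_fract b" by (auto simp: P_def)
  have bF: "b \<in> F_polys" "b \<noteq> 0" using b by (auto simp: P_def)
  \<comment> \<open>A nonzero element of least degree in this ideal is a common divisor of
    \<open>a\<close> and \<open>b\<close>; the minimal degree of \<open>b\<close> forces it to be
    constant.\<close>
  define J where "J = {u * a + v * b | u v. u \<in> F_polys \<and> v \<in> F_polys}"
  have JF: "d \<in> F_polys" if "d \<in> J" for d using that a bF F_polys_add F_polys_mult by (auto simp: J_def)
  have Jb: "b \<in> J" unfolding J_def using F_polys_zero FP_one by (intro CollectI exI[of _ 0] exI[of _ 1]) auto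
  have Ja: "a \<in> J" unfolding J_def using F_polys_zero FP_one by (intro CollectI exI[of _ 1] exI[of _ 0]) auto
  have Jd: "y - q * d \<in> J" if yd: "y \<in> J" "d \<in> J" and q: "q \<in> F_polys" for y d q
  proof -
    obtain u v u' v' where *: "y = u * a + v * b" "d = u' * a + v' * b" "u \<in> F_polys" "v \<in> F_polys" "u' \<in> F_polys" "v' \<in> F_polys"
      using yd by (auto simp: J_def)
    have "y - q * d = (u - q * u') * a + (v - q * v') * b" unfolding * by (simp add: algebra_simps)
    then show ?thesis unfolding J_def using * q F_polys_diff F_polys_mult by blast
  qed
  obtain d where d: "d \<in> J" "d \<noteq> 0" and dmin: "\<And>y. y \<in> J \<Longrightarrow> y \<noteq> 0 \<Longrightarrow> pdeg d \<le> pdeg y"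
    using ex_has_least_nat[of "\<lambda>d. d \<in> J \<and> d \<noteq> 0" b pdeg] Jb bF by blast
  have dvd: "\<exists>q \<in> F_polys. y = q * d" if y: "y \<in> J" for y
  proof -
    obtain q where q: "q \<in> F_polys" "y - q * d = 0 \<or> pdeg (y - q * d) < pdeg d"
      using F_polys_div[OF JF[OF y] JF[OF d(1)] d(2)] by blast
    then have "y - q * d = 0" using dmin[OF Jd[OF y d(1) q(1)]] by (meson not_le)
    then show ?thesis using q by (intro bexI[of _ q]) auto
  qed
  obtain q1 where q1: "q1 \<in> F_polys" "a = q1 * d" using dvd[OF Ja] by blast
  obtain q2 where q2: "q2 \<in> F_polys" "b = q2 * d" using dvd[OF Jb] by blast
  have q20: "q2 \<noteq> 0" using q2 bF by auto
  have "x = to_fract q1 / to_fract q2" using a q1 q2 d by simp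
  then have "P q2" using q1 q2 q20 by (auto simp: P_def)
  then have "pdeg b \<le> pdeg q2" by (rule bmin)
  then have "pdeg d = 0" using q2(2) q20 d(2) by (simp add: degree_mult_eq)
  then obtain c where c: "d = [:c:]" by (rule degree_eq_zeroE)
  have c0: "c \<noteq> 0" using d c by simp
  have cF: "c \<in> F" using JF[OF d(1)] unfolding c F_polys_def by (auto dest: spec[of _ 0])
  obtain u v where uv: "u \<in> F_polys" "v \<in> F_polys" "d = u * a + v * b" using d by (auto simp: J_def)
  define e where "e = [:inverse c:]"
  have e: "e \<in> F_polys" "e * d = 1" using cF c0 F_inverse F_polys_const by (auto simp: e_def c one_pCons)
  have bez: "(e * u) * a + (e * v) * b = 1" using e uv by (simp add: algebra_simps)
  have uvF: "e * u \<in> F_polys" "e * v \<in> F_polys" using e uv F_polys_mult by auto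
  let ?w = "to_fract (e * u) * x + to_fract (e * v)"
  have "?w * to_fract b = to_fract (e * u) * (x * to_fract b) + to_fract (e * v) * to_fract b"
    by (simp only: distrib_right mult.assoc)
  also have "x * to_fract b = to_fract a" using a bF by simp
  also have "to_fract (e * u) * to_fract a + to_fract (e * v) * to_fract b =
    to_fract ((e * u) * a + (e * v) * b)" by (simp only: to_fract_add to_fract_mult)
  also have "\<dots> = 1" unfolding bez by simp
  finally have "1 / to_fract b = ?w" using bF by (simp add: divide_eq_eq)
  moreover have "?w \<in> R" by (intro Ra Rm F_polys_R uvF x)
  ultimately have "1 / to_fract b \<in> R" by (simp only:)
  then show ?thesis using a bF bez uvF by blast
qed

text \<open>The degree of a numerator after units of \<open>R\<close> have been split off as far as
  possible. A plain degree of numerators would not do, since some polynomials become units in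
  \<open>R\<close>.\<close>

definition euclid_deg :: "'k poly fract \<Rightarrow> nat" where
  "euclid_deg x = (LEAST d. \<exists>a \<in> F_polys. \<exists>e \<in> R. a \<noteq> 0 \<and> e \<noteq> 0 \<and> 1 / e \<in> R \<and> x = to_fract a * e \<and> pdeg a = d)"

lemma euclid_deg_attained:
  assumes x: "x \<in> R" "x \<noteq> 0"
  shows "\<exists>a \<in> F_polys. \<exists>e \<in> R. a \<noteq> 0 \<and> e \<noteq> 0 \<and> 1 / e \<in> R \<and> x = to_fract a * e \<and> pdeg a = euclid_deg x"
proof -
  obtain a b where ab: "a \<in> F_polys" "b \<in> F_polys" "b \<noteq> 0" "x = to_fract a / to_fract b" "1 / to_fract b \<in> R"
    using coprime_fraction[OF x(1)] by blast
  have "\<exists>d. \<exists>a \<in> F_polys. \<exists>e \<in> R. a \<noteq> 0 \<and> e \<noteq> 0 \<and> 1 / e \<in> R \<and> x = to_fract a * e \<and> pdeg a = d"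
    using ab x F_polys_R[OF ab(2)]
    by (intro exI[of _ "pdeg a"] bexI[of _ a] bexI[of _ "1 / to_fract b"]) auto
  then show ?thesis unfolding euclid_deg_def by (rule LeastI_ex)
qed

lemma euclid_deg_le:
  assumes "a \<in> F_polys" "e \<in> R" "a \<noteq> 0" "e \<noteq> 0" "1 / e \<in> R"
  shows "euclid_deg (to_fract a * e) \<le> pdeg a"
  unfolding euclid_deg_def using assms by (intro Least_le) blast

text \<open>With \<open>x = a e\<close> and \<open>y = b h\<close> for units \<open>e, h\<close>,
  division of \<open>a\<close> by \<open>b\<close> gives
  \<open>x - (q e / h) y = (a - q b) e\<close>.\<close>

lemma R_euclid:
  assumes x: "x \<in> R" and y: "y \<in> R" "y \<noteq> 0"
  shows "\<exists>q \<in> R. x - q * y = 0 \<or> euclid_deg (x - q * y) < euclid_deg y"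
proof (cases "x = 0")
  case True
  then show ?thesis using R0 by (intro bexI[of _ 0]) auto
next
  case False
  obtain a e where a: "a \<in> F_polys" "e \<in> R" "a \<noteq> 0" "e \<noteq> 0" "1 / e \<in> R" "x = to_fract a * e"
    using euclid_deg_attained[OF x False] by blast
  obtain b h where b: "b \<in> F_polys" "h \<in> R" "b \<noteq> 0" "h \<noteq> 0" "1 / h \<in> R" "y = to_fract b * h" "pdeg b = euclid_deg y"
    using euclid_deg_attained[OF y] by blast
  obtain q where q: "q \<in> F_polys" "a - q * b = 0 \<or> pdeg (a - q * b) < pdeg b"
    using F_polys_div[OF a(1) b(1,3)] by blast
  let ?Q = "to_fract q * (e * (1 / h))"
  have QR: "?Q \<in> R" using q a b F_polys_R by (intro Rm) auto
  have eq: "x - ?Q * y = to_fract (a - q * b) * e" using a b by (simp add: field_simps)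
  show ?thesis
  proof (cases "a - q * b = 0")
    case True
    then have "x - ?Q * y = 0" unfolding eq by (simp only: to_fract_0 mult_zero_left)
    then show ?thesis using QR by blast
  next
    case False
    have "euclid_deg (x - ?Q * y) \<le> pdeg (a - q * b)"
      unfolding eq using False a q b F_polys_diff F_polys_mult by (intro euclid_deg_le) auto
    then show ?thesis using q False b QR by (intro bexI[of _ ?Q] disjI2) auto
  qed
qed

section \<open>Constants and roots of unity\<close>

definition const :: "'k \<Rightarrow> 'k poly fract" where "const c = to_fract [:c:]"

lemma const_hom: "const (a + b) = const a + const b" "const (a * b) = const a * const b"
  "const (- a) = - const a" "const 0 = 0" "const 1 = 1" "const (a ^ k) = const a ^ k"
proof -
  show "const (a + b) = const a + const b" "const (- a) = - const a" "const 0 = 0"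
    unfolding const_def by (simp_all flip: to_fract_add to_fract_uminus)
  show o: "const 1 = 1" unfolding const_def by (simp flip: one_pCons)
  show m: "const (a * b) = const a * const b" for a b
    unfolding const_def by (simp flip: to_fract_mult)
  show "const (a ^ k) = const a ^ k" by (induction k) (simp_all add: o m)
qed

lemma const_eq: "const a = const b \<longleftrightarrow> a = b"
  unfolding const_def by (simp only: to_fract_eq_iff pCons_eq_iff simp_thms)

lemma const_R: "c \<in> F \<Longrightarrow> const c \<in> R"
  unfolding const_def by (intro F_polys_R F_polys_const)

text \<open>A root of unity \<open>y\<close> is integral over \<open>F[t]\<close>; Dedekind's minimal common denominator \<open>c\<close> of
  all powers of \<open>y\<close> shows that \<open>y\<close> is a polynomial.\<close>

lemma root_of_unity_const:
  assumes y: "y \<in> R" and m: "m > 0" "y ^ m = 1"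
  shows "\<exists>c \<in> F. y = const c"
proof -
  define P where "P c \<longleftrightarrow> c \<in> F_polys \<and> c \<noteq> 0 \<and> (\<forall>j. \<exists>f \<in> F_polys. to_fract c * y ^ j = to_fract f)" for c
  obtain a b where ab: "a \<in> F_polys" "b \<in> F_polys" "b \<noteq> 0" "y = to_fract a / to_fract b"
    using coprime_fraction[OF y] by blast
  have tp: "to_fract (f ^ k) = to_fract f ^ k" for f :: "'k poly" and k by (induction k) auto
  \<comment> \<open>\<open>b ^ m\<close> clears all denominators because \<open>y ^ j\<close>
    depends only on \<open>j mod m\<close>.\<close>
  have "P (b ^ m)" unfolding P_def
  proof (intro conjI allI)
    fix j
    have "y ^ j = y ^ (j mod m)"
    proof -
      have "y ^ j = (y ^ m) ^ (j div m) * y ^ (j mod m)"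
        by (simp flip: power_mult power_add)
      then show ?thesis using m by simp
    qed
    also have "to_fract (b ^ m) * \<dots> = to_fract (a ^ (j mod m) * b ^ (m - j mod m))"
    proof -
      have "m = (m - j mod m) + j mod m" using m by simp
      then have "to_fract b ^ m = to_fract b ^ (m - j mod m) * to_fract b ^ (j mod m)"
        by (metis power_add)
      then show ?thesis using ab by (simp add: tp power_divide)
    qed
    finally show "\<exists>f \<in> F_polys. to_fract (b ^ m) * y ^ j = to_fract f"
      using ab F_polys_mult F_polys_power by blast
  qed (use ab F_polys_power in auto)
  then obtain c where c: "P c" and min: "\<And>c'. P c' \<Longrightarrow> pdeg c \<le> pdeg c'"
    using ex_has_least_nat[of P "b ^ m" pdeg] by blast
  have cF: "c \<in> F_polys" "c \<noteq> 0" and cy: "\<And>j. \<exists>f \<in> F_polys. to_fract c * y ^ j = to_fract f"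
    using c by (auto simp: P_def)
  obtain f where f: "f \<in> F_polys" "to_fract c * y = to_fract f" using cy[of 1] by auto
  obtain q where q: "q \<in> F_polys" "f - q * c = 0 \<or> pdeg (f - q * c) < pdeg c" using F_polys_div[OF f(1) cF] by blast
  let ?r = "f - q * c"
  have "?r = 0"
  proof (rule ccontr)
    \<comment> \<open>The remainder is again a common denominator, as
      \<open>r y ^ j = c y ^ (j + 1) - q (c y ^ j)\<close>, but has smaller degree.\<close>
    assume r: "?r \<noteq> 0"
    have "P ?r" unfolding P_def
    proof (intro conjI allI r)
      show "?r \<in> F_polys" using f q cF F_polys_diff F_polys_mult by blast
      fix j
      obtain g where g: "g \<in> F_polys" "to_fract c * y ^ Suc j = to_fract g" using cy by blast
      obtain h where h: "h \<in> F_polys" "to_fract c * y ^ j = to_fract h" using cy by blast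
      have "to_fract ?r * y ^ j = to_fract c * y ^ Suc j - to_fract q * (to_fract c * y ^ j)"
        using f(2) by (simp add: algebra_simps flip: f(2))
      also have "\<dots> = to_fract (g - q * h)" unfolding g h by simp
      finally show "\<exists>f \<in> F_polys. to_fract ?r * y ^ j = to_fract f" using g h q F_polys_diff F_polys_mult by blast
    qed
    then show False using min q r by fastforce
  qed
  then have "to_fract c * y = to_fract c * to_fract q" using f(2) by (simp add: mult.commute)
  then have yq: "y = to_fract q" using cF by simp
  then have "to_fract (q ^ m) = to_fract 1" using m tp by simp
  then have qm: "q ^ m = 1" by (simp only: to_fract_eq_iff)
  have "m * pdeg q = 0"
  proof -
    have "q \<noteq> 0" using qm m by (auto simp: power_0_left)
    then have "pdeg (q ^ m) = m * pdeg q" by (rule degree_power_eq)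
    then show ?thesis unfolding qm by simp
  qed
  then have "pdeg q = 0" using m by simp
  then obtain d where d: "q = [:d:]" by (rule degree_eq_zeroE)
  then have "d \<in> F" using q(1) by (auto simp: F_polys_def dest: spec[of _ 0])
  then show ?thesis using yq d by (auto simp: const_def)
qed

end

section \<open>Ring automorphisms are locally finite\<close>

locale rational_subring_matrices = rational_subring F R p for F :: "'k :: field set" and R p +
  fixes n :: nat
  assumes n3: "n \<ge> 3"
begin

lemma char_fract: "of_nat p = (0 :: 'k poly fract)"
proof -
  have "const (of_nat k) = of_nat k" for k by (induction k) (simp_all add: const_hom)
  then show ?thesis using p_char const_hom(4) by metis
qed

sublocale euclidean_subring R euclid_deg n p
  by unfold_locales (rule R0 R1 Ru Ra Rm R_euclid p_prime char_fract n3; assumption)+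

lemma aut_power:
  assumes "ring_aut R \<rho>" "x \<in> R"
  shows "\<rho> (x ^ k) = \<rho> x ^ k"
  using assms by (induction k) (auto simp: autD)

lemma aut_diff: "ring_aut R \<rho> \<Longrightarrow> x \<in> R \<Longrightarrow> y \<in> R \<Longrightarrow> \<rho> (x - y) = \<rho> x - \<rho> y"
  using autD(4)[of \<rho> x "- y"] autD(6)[of \<rho> y] by simp

lemma aut_inj: "ring_aut R \<rho> \<Longrightarrow> x \<in> R \<Longrightarrow> y \<in> R \<Longrightarrow> \<rho> x = \<rho> y \<Longrightarrow> x = y"
  unfolding ring_aut_def bij_betw_def inj_on_def by blast

lemma funpow_aut_R: "ring_aut R \<rho> \<Longrightarrow> x \<in> R \<Longrightarrow> (\<rho> ^^ k) x \<in> R"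
  by (induction k) (auto simp: autD)

lemma ring_aut_funpow:
  assumes r: "ring_aut R \<rho>"
  shows "ring_aut R (\<rho> ^^ k)"
proof -
  have "bij_betw (\<rho> ^^ k) R R"
    using r bij_betw_funpow unfolding ring_aut_def by blast
  moreover have "(\<rho> ^^ k) 1 = 1" using autD(2)[OF r] by (induction k) auto
  moreover have "(\<rho> ^^ k) (x + y) = (\<rho> ^^ k) x + (\<rho> ^^ k) y \<and> (\<rho> ^^ k) (x * y) = (\<rho> ^^ k) x * (\<rho> ^^ k) y"
    if "x \<in> R" "y \<in> R" for x y
    using autD(4,5)[OF r] funpow_aut_R[OF r] that by (induction k) auto
  ultimately show ?thesis unfolding ring_aut_def by blast
qed

text \<open>Finiteness is stated element by element, because \<open>\<rho>\<close> itself may have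
  infinite order, for instance when it acts as Frobenius on an infinite \<open>F\<close>.\<close>

definition periodic :: "('k poly fract \<Rightarrow> 'k poly fract) \<Rightarrow> 'k poly fract \<Rightarrow> bool" where
  "periodic \<rho> x \<longleftrightarrow> x \<in> R \<and> (\<exists>m>0. (\<rho> ^^ m) x = x)"

lemma funpow_fixed: "f x = x \<Longrightarrow> (f ^^ k) x = x"
  by (induction k) auto

lemma fixed_multiple: "(f ^^ m) x = x \<Longrightarrow> (f ^^ (m * l)) x = x" "(f ^^ m) x = x \<Longrightarrow> (f ^^ (l * m)) x = x"
  using funpow_fixed[of "f ^^ m" x l] by (simp_all add: funpow_mult mult.commute)

text \<open>Two iterates coincide by the pigeonhole principle, and injectivity of
  \<open>\<rho>\<close> cancels the common initial part.\<close>

lemma periodic_finite_orbit: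
  assumes r: "ring_aut R \<rho>" and x: "x \<in> R" and T: "finite T" "\<And>k. (\<rho> ^^ k) x \<in> T"
  shows "periodic \<rho> x"
proof -
  have "\<not> inj (\<lambda>k. (\<rho> ^^ k) x)"
  proof
    assume "inj (\<lambda>k. (\<rho> ^^ k) x)"
    moreover have "range (\<lambda>k. (\<rho> ^^ k) x) \<subseteq> T" using T(2) by blast
    then have "finite (range (\<lambda>k. (\<rho> ^^ k) x))" using T(1) by (rule finite_subset)
    ultimately have "finite (UNIV :: nat set)" using finite_imageD by blast
    then show False by simp
  qed
  then obtain i j where "i \<noteq> j" "(\<rho> ^^ i) x = (\<rho> ^^ j) x" by (auto simp: inj_def)
  then obtain i j where ij: "i < j" "(\<rho> ^^ i) x = (\<rho> ^^ j) x" by (metis linorder_neqE_nat)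
  then have "(\<rho> ^^ i) ((\<rho> ^^ (j - i)) x) = (\<rho> ^^ i) x"
    by (simp flip: funpow_add comp_apply[of "\<rho> ^^ i"])
  then have "(\<rho> ^^ (j - i)) x = x"
    using aut_inj[OF ring_aut_funpow[OF r] funpow_aut_R[OF r x] x] by blast
  then show ?thesis using ij x unfolding periodic_def by (intro conjI exI[of _ "j - i"]) auto
qed

lemma periodic_common:
  assumes "periodic \<rho> x" "periodic \<rho> y"
  shows "\<exists>m>0. (\<rho> ^^ m) x = x \<and> (\<rho> ^^ m) y = y"
proof -
  obtain k l where "k > 0" "l > 0" "(\<rho> ^^ k) x = x" "(\<rho> ^^ l) y = y" using assms by (auto simp: periodic_def)
  then show ?thesis using fixed_multiple by (intro exI[of _ "k * l"]) auto
qed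

lemma periodic_add: "ring_aut R \<rho> \<Longrightarrow> periodic \<rho> x \<Longrightarrow> periodic \<rho> y \<Longrightarrow> periodic \<rho> (x + y)"
  and periodic_mult: "ring_aut R \<rho> \<Longrightarrow> periodic \<rho> x \<Longrightarrow> periodic \<rho> y \<Longrightarrow> periodic \<rho> (x * y)"
proof -
  assume r: "ring_aut R \<rho>" and xy: "periodic \<rho> x" "periodic \<rho> y"
  obtain m where m: "m > 0" "(\<rho> ^^ m) x = x" "(\<rho> ^^ m) y = y" using periodic_common[OF xy] by blast
  have R: "x \<in> R" "y \<in> R" using xy by (auto simp: periodic_def)
  show "periodic \<rho> (x + y)" "periodic \<rho> (x * y)"
    using autD(4,5)[OF ring_aut_funpow[OF r] R, of m] m R unfolding periodic_def by auto
qed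

lemma periodic_one: "ring_aut R \<rho> \<Longrightarrow> periodic \<rho> 1" and periodic_zero: "ring_aut R \<rho> \<Longrightarrow> periodic \<rho> 0"
  using autD(2,3) unfolding periodic_def by (auto intro!: exI[of _ 1])

lemma periodic_power: "ring_aut R \<rho> \<Longrightarrow> periodic \<rho> x \<Longrightarrow> periodic \<rho> (x ^ k)"
  by (induction k) (auto simp: periodic_one periodic_mult)

lemma periodic_sum: "ring_aut R \<rho> \<Longrightarrow> (\<And>i. i \<in> I \<Longrightarrow> periodic \<rho> (f i)) \<Longrightarrow> periodic \<rho> (sum f I)"
  by (induction I rule: infinite_finite_induct) (auto simp: periodic_zero periodic_add)

lemma periodic_quotient:
  assumes r: "ring_aut R \<rho>" and x: "x \<in> R" and b: "periodic \<rho> b" "b \<noteq> 0" and xb: "periodic \<rho> (x * b)"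
  shows "periodic \<rho> x"
proof -
  obtain m where m: "m > 0" "(\<rho> ^^ m) b = b" "(\<rho> ^^ m) (x * b) = x * b" using periodic_common[OF b(1) xb] by blast
  have "b \<in> R" using b by (auto simp: periodic_def)
  then have "(\<rho> ^^ m) (x * b) = (\<rho> ^^ m) x * b"
    using autD(5)[OF ring_aut_funpow[OF r] x, of b m] m(2) by simp
  then have "(\<rho> ^^ m) x * b = x * b" unfolding m(3) by (rule sym)
  then have "(\<rho> ^^ m) x = x" using b(2) by (metis mult_right_cancel)
  then show ?thesis using m x unfolding periodic_def by auto
qed

text \<open>The intersection of \<open>F\<close> with the field of \<open>p ^ e\<close> elements.
  Being cut out by an equation, it is preserved by every automorphism.\<close>

definition frob_fixed :: "nat \<Rightarrow> 'k set" where "frob_fixed e = {c \<in> F. c ^ (p ^ e) = c}"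

lemma char_eq: "CHAR('k) = p"
proof -
  have "CHAR('k) dvd p" using p_char by (simp only: of_nat_eq_0_iff_char_dvd)
  moreover have "CHAR('k) \<noteq> 1" using of_nat_CHAR[where ?'a = 'k] by (metis of_nat_1 one_neq_zero)
  ultimately show ?thesis using p_prime by (metis prime_nat_iff)
qed

lemma p_gt1: "p > 1" using p_prime by (rule prime_gt_1_nat)

lemma finite_frob_fixed: "e > 0 \<Longrightarrow> finite (frob_fixed e)"
proof -
  assume e: "e > 0"
  let ?P = "Polynomial.monom 1 (p ^ e) - Polynomial.monom 1 1 :: 'k poly"
  have "1 < p ^ e" using e p_gt1 by (metis one_less_power)
  then have "pcoeff ?P 1 \<noteq> 0" using e p_gt1 by simp
  then have "?P \<noteq> 0" by (metis coeff_0)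
  then have "finite {x. poly ?P x = 0}" by (rule poly_roots_finite)
  moreover have "frob_fixed e \<subseteq> {x. poly ?P x = 0}" by (auto simp: frob_fixed_def poly_monom)
  ultimately show ?thesis by (rule rev_finite_subset)
qed

lemma frob_fixed_add: "x \<in> frob_fixed e \<Longrightarrow> y \<in> frob_fixed e \<Longrightarrow> x + y \<in> frob_fixed e"
  using freshmans_dream'[where ?'a = 'k, of "p ^ e" e x y] p_prime
  by (auto simp: frob_fixed_def F_add char_eq)

lemma frob_fixed_mult: "x \<in> frob_fixed e \<Longrightarrow> y \<in> frob_fixed e \<Longrightarrow> x * y \<in> frob_fixed e"
  by (auto simp: frob_fixed_def F_mult power_mult_distrib)

lemma frob_fixed_zero: "0 \<in> frob_fixed e" and frob_fixed_one: "1 \<in> frob_fixed e"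
  using p_gt1 F0 F1 by (auto simp: frob_fixed_def power_0_left)

lemma frob_fixed_mono: "frob_fixed e \<subseteq> frob_fixed (e * l)"
proof -
  have "x ^ (p ^ (e * l)) = x" if "x ^ (p ^ e) = x" for x :: 'k
    using that by (induction l) (auto simp: power_add power_mult)
  then show ?thesis by (auto simp: frob_fixed_def)
qed

text \<open>The powers \<open>c ^ (p ^ i)\<close> are roots of unity of one order, so two of them
  agree; injectivity of Frobenius gives \<open>c ^ (p ^ (j - i)) = c\<close>.\<close>

lemma ex_frob_fixed:
  assumes c: "c \<in> F"
  shows "\<exists>e>0. c \<in> frob_fixed e"
proof (cases "c = 0")
  case True then show ?thesis using frob_fixed_zero by (intro exI[of _ 1]) auto
next
  case False
  obtain m where m: "m > 0" "c ^ m = 1" using F_root[OF c False] by blast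
  let ?P = "Polynomial.monom 1 m - 1 :: 'k poly"
  have "pcoeff ?P m \<noteq> 0" using m by (cases m) (auto simp: one_pCons)
  then have "?P \<noteq> 0" by (metis coeff_0)
  then have "finite {x. poly ?P x = 0}" by (rule poly_roots_finite)
  moreover have "range (\<lambda>i. c ^ (p ^ i)) \<subseteq> {x. poly ?P x = 0}"
    using m by (auto simp: poly_monom simp flip: power_mult) (metis mult.commute power_mult power_one)
  ultimately have "finite (range (\<lambda>i. c ^ (p ^ i)))" by (rule rev_finite_subset)
  then have "\<not> inj (\<lambda>i. c ^ (p ^ i))" using finite_imageD by fastforce
  then obtain i j where "i \<noteq> j" "c ^ (p ^ i) = c ^ (p ^ j)" by (auto simp: inj_def)
  then obtain i j where ij: "i < j" "c ^ (p ^ i) = c ^ (p ^ j)" by (metis linorder_neqE_nat)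
  let ?d = "c ^ (p ^ (j - i))"
  have "?d ^ (p ^ i) = c ^ (p ^ i)" using ij by (simp flip: power_mult power_add)
  moreover have "(?d - c) ^ (p ^ i) + c ^ (p ^ i) = (?d - c + c) ^ (p ^ i)"
    using freshmans_dream'[where ?'a = 'k, of "p ^ i" i "?d - c" c] p_prime by (simp add: char_eq)
  ultimately have "(?d - c) ^ (p ^ i) = 0" by simp
  then have "?d = c" by simp
  then show ?thesis using ij c by (intro exI[of _ "j - i"]) (auto simp: frob_fixed_def)
qed

text \<open>The nonzero constants are roots of unity, a property that \<open>\<rho>\<close>
  preserves, and \<open>root_of_unity_const\<close> recognises them.\<close>

lemma aut_const:
  assumes r: "ring_aut R \<rho>" and c: "c \<in> F"
  shows "\<exists>d \<in> F. \<rho> (const c) = const d"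
proof (cases "c = 0")
  case True then show ?thesis using autD(3)[OF r] F0 by (intro bexI[of _ 0]) (auto simp: const_hom)
next
  case False
  obtain m where m: "m > 0" "c ^ m = 1" using F_root[OF c False] by blast
  have "\<rho> (const c) ^ m = \<rho> (const (c ^ m))"
    using aut_power[OF r const_R[OF c]] by (simp add: const_hom)
  then have "\<rho> (const c) ^ m = 1" using m autD(2)[OF r] by (simp add: const_hom)
  then show ?thesis using root_of_unity_const[OF autD(1)[OF r const_R[OF c]] m(1)] by blast
qed

lemma aut_const_frob_fixed:
  assumes r: "ring_aut R \<rho>" and c: "c \<in> frob_fixed e"
  shows "\<exists>d \<in> frob_fixed e. \<rho> (const c) = const d"
proof -
  have cF: "c \<in> F" "c ^ (p ^ e) = c" using c by (auto simp: frob_fixed_def)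
  obtain d where d: "d \<in> F" "\<rho> (const c) = const d" using aut_const[OF r cF(1)] by blast
  have "const (d ^ (p ^ e)) = \<rho> (const c ^ (p ^ e))"
    using aut_power[OF r const_R[OF cF(1)]] d by (simp add: const_hom)
  also have "\<dots> = const d" using cF(2) d(2) by (simp flip: const_hom(6))
  finally show ?thesis using d by (auto simp: frob_fixed_def const_eq)
qed

lemma periodic_const:
  assumes r: "ring_aut R \<rho>" and c: "c \<in> F"
  shows "periodic \<rho> (const c)"
proof -
  obtain e where e: "e > 0" "c \<in> frob_fixed e" using ex_frob_fixed[OF c] by blast
  have "(\<rho> ^^ k) (const c) \<in> const ` frob_fixed e" for k
    using e(2) aut_const_frob_fixed[OF r] by (induction k) (auto, metis imageI)
  then show ?thesis using periodic_finite_orbit[OF r const_R[OF c], of "const ` frob_fixed e"] finite_frob_fixed[OF e(1)] by blast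
qed

section \<open>The orbit of the indeterminate\<close>

definition indet :: "'k poly fract" where "indet = to_fract [:0, 1:]"

lemma indet_R: "indet \<in> R"
  unfolding indet_def by (rule F_polys_R) (auto simp: F_polys_def coeff_pCons F0 F1 split: nat.splits)

lemma fdeg_indet: "indet \<noteq> 0" "fdeg indet = 1"
  unfolding indet_def using fdeg_to_fract[of "[:0, 1:] :: 'k poly"] by auto

lemma to_fract_linear: "to_fract [:a, b:] = const a + const b * indet"
proof -
  have "[:a, b:] = [:a:] + [:b:] * [:0, 1:]" by simp
  then show ?thesis unfolding const_def indet_def by (simp only: to_fract_add to_fract_mult)
qed

lemma to_fract_sum_powers:
  assumes "pdeg f \<le> N"
  shows "to_fract f = (\<Sum>i\<le>N. const (pcoeff f i) * indet ^ i)"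
proof -
  have tp: "to_fract (g ^ k) = to_fract g ^ k" for g :: "'k poly" and k by (induction k) auto
  have "f = (\<Sum>i\<le>N. Polynomial.monom (pcoeff f i) i)" using poly_as_sum_of_monoms'[OF assms] by simp
  also have "\<dots> = (\<Sum>i\<le>N. [:pcoeff f i:] * [:0, 1:] ^ i)" by (simp add: monom_altdef)
  finally have "to_fract f = to_fract (\<Sum>i\<le>N. [:pcoeff f i:] * [:0, 1:] ^ i)" by simp
  then show ?thesis by (simp only: to_fract_sum to_fract_mult tp const_def indet_def)
qed

text \<open>Surjectivity expresses the indeterminate as a rational function of
  \<open>f = \<rho> indet\<close>, a fraction \<open>A / B\<close>. Clearing denominators gives a
  homogeneous relation in \<open>A, B\<close> with coefficients linear in the indeterminate, so
  \<open>dvd_lowest_coeff\<close> makes \<open>A\<close> and \<open>B\<close> divide nonzero linear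
  polynomials.\<close>

lemma aut_moebius:
  assumes r: "ring_aut R \<rho>"
  shows "\<exists>a b c d. a \<in> F \<and> b \<in> F \<and> c \<in> F \<and> d \<in> F \<and> const c + const d * indet \<noteq> 0 \<and>
    \<rho> indet * (const c + const d * indet) = const a + const b * indet"
proof -
  define f where "f = \<rho> indet"
  have fR: "f \<in> R" unfolding f_def using autD(1)[OF r indet_R] .
  have f0: "f \<noteq> 0" unfolding f_def using autD(8)[OF r indet_R] fdeg_indet by blast
  obtain A B u v where AB: "A \<in> F_polys" "B \<in> F_polys" "B \<noteq> 0" "u * A + v * B = 1" "f = to_fract A / to_fract B"
    using coprime_fraction[OF fR] by blast
  have A0: "A \<noteq> 0" using AB f0 by auto
  obtain f' where f': "f' \<in> R" "\<rho> f' = indet" using autD(9)[OF r indet_R] by blast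
  obtain P Q where PQ: "P \<in> F_polys" "Q \<in> F_polys" "Q \<noteq> 0" "f' = to_fract P / to_fract Q"
    using coprime_fraction[OF f'(1)] by blast
  define N where "N = max (pdeg P) (pdeg Q)"
  have "\<forall>c. \<exists>d. c \<in> F \<longrightarrow> d \<in> F \<and> \<rho> (const c) = const d" using aut_const[OF r] by blast
  then obtain h where h: "\<And>c. c \<in> F \<Longrightarrow> h c \<in> F \<and> \<rho> (const c) = const (h c)" by metis
  have ev: "\<rho> (to_fract G) = (\<Sum>i\<le>N. const (h (pcoeff G i)) * f ^ i)" if G: "G \<in> F_polys" "pdeg G \<le> N" for G
  proof -
    have cF: "pcoeff G i \<in> F" for i using G by (auto simp: F_polys_def)
    have "\<rho> (to_fract G) = (\<Sum>i\<le>N. \<rho> (const (pcoeff G i) * indet ^ i))"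
      unfolding to_fract_sum_powers[OF G(2)]
      by (rule autD(7)[OF r]) (intro R_mult R_power const_R cF indet_R)
    also have "\<dots> = (\<Sum>i\<le>N. const (h (pcoeff G i)) * f ^ i)"
      using cF h by (intro sum.cong refl) (simp add: autD(5)[OF r] const_R indet_R aut_power[OF r] f_def)
    finally show ?thesis .
  qed
  have "to_fract Q * f' = to_fract P" using PQ by simp
  then have "\<rho> (to_fract Q) * indet = \<rho> (to_fract P)"
    using autD(5)[OF r F_polys_R[OF PQ(2)] f'(1)] f'(2) by simp
  then have rel0: "(\<Sum>i\<le>N. const (h (pcoeff Q i)) * f ^ i) * indet - (\<Sum>i\<le>N. const (h (pcoeff P i)) * f ^ i) = 0"
    using ev[OF PQ(1)] ev[OF PQ(2)] by (simp add: N_def)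
  \<comment> \<open>The coefficient of \<open>f ^ i\<close> in the equation that results from
    applying \<open>\<rho>\<close> to \<open>Q * f' = P\<close>.\<close>
  define c where "c i = [:- h (pcoeff P i), h (pcoeff Q i):]" for i
  have tc: "to_fract (c i) = const (h (pcoeff Q i)) * indet - const (h (pcoeff P i))" for i
    unfolding c_def to_fract_linear by (simp add: const_hom)
  have "(\<Sum>i\<le>N. to_fract (c i) * f ^ i) = 0"
    using rel0 unfolding tc sum_distrib_right sum_subtractf[symmetric] by (simp add: algebra_simps)
  then have "(\<Sum>i\<le>N. to_fract (c i) * f ^ i) * to_fract B ^ N = 0" by simp
  then have "(\<Sum>i\<le>N. to_fract (c i) * f ^ i * to_fract B ^ N) = 0" by (simp add: sum_distrib_right)
  moreover have "to_fract (c i) * f ^ i * to_fract B ^ N = to_fract (c i * A ^ i * B ^ (N - i))" if "i \<le> N" for i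
  proof -
    have tp: "to_fract (g ^ k) = to_fract g ^ k" for g :: "'k poly" and k by (induction k) auto
    have "to_fract B ^ N = to_fract B ^ i * to_fract B ^ (N - i)" using that by (simp flip: power_add)
    then show ?thesis using AB by (simp add: tp power_divide)
  qed
  ultimately have "to_fract (\<Sum>i\<le>N. c i * A ^ i * B ^ (N - i)) = to_fract 0" by simp
  then have rel: "(\<Sum>i\<le>N. c i * A ^ i * B ^ (N - i)) = 0" by (simp only: to_fract_eq_iff)
  have "pcoeff Q (pdeg Q) \<noteq> 0" using PQ by simp
  moreover have QF: "pcoeff Q (pdeg Q) \<in> F" using PQ by (auto simp: F_polys_def)
  ultimately have "\<rho> (const (pcoeff Q (pdeg Q))) \<noteq> 0"
    using autD(8)[OF r const_R[OF QF]] const_eq[of "pcoeff Q (pdeg Q)" 0] const_hom(4) by metis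
  then have "h (pcoeff Q (pdeg Q)) \<noteq> 0" using h[OF QF] by (auto simp: const_hom)
  then have ex: "pdeg Q \<le> N" "c (pdeg Q) \<noteq> 0" by (auto simp: N_def c_def)
  have c1: "pdeg (c i) \<le> 1" for i unfolding c_def by simp
  obtain i where "c i \<noteq> 0" "A dvd c i" using dvd_lowest_coeff[OF A0 AB(4) rel ex] by blast
  then have dA: "pdeg A \<le> 1" using c1[of i] dvd_imp_degree_le le_trans by blast
  \<comment> \<open>Reversing the sum exchanges the roles of \<open>A\<close> and \<open>B\<close>,
    which bounds the denominator as well.\<close>
  have rel': "(\<Sum>i\<le>N. c (N - i) * B ^ i * A ^ (N - i)) = 0"
  proof -
    have "(\<Sum>i\<le>N. c (N - i) * B ^ i * A ^ (N - i)) = (\<Sum>i\<le>N. c i * A ^ i * B ^ (N - i))"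
      by (rule sum.reindex_bij_witness[of _ "\<lambda>i. N - i" "\<lambda>i. N - i"]) (auto simp: mult.assoc mult.commute[of "B ^ _"])
    then show ?thesis using rel by simp
  qed
  obtain i where "c (N - i) \<noteq> 0" "B dvd c (N - i)"
    using dvd_lowest_coeff[OF AB(3) _ rel', of v u "N - pdeg Q"] AB(4) ex by (auto simp: add.commute)
  then have dB: "pdeg B \<le> 1" using c1[of "N - i"] dvd_imp_degree_le le_trans by blast
  have lin: "G = [:pcoeff G 0, pcoeff G 1:]" if "pdeg G \<le> 1" for G :: "'k poly"
    using that by (intro poly_eqI) (auto simp: coeff_pCons coeff_eq_0 split: nat.splits)
  have tA: "to_fract A = const (pcoeff A 0) + const (pcoeff A 1) * indet"
    using to_fract_linear lin[OF dA] by metis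
  have tB: "to_fract B = const (pcoeff B 0) + const (pcoeff B 1) * indet"
    using to_fract_linear lin[OF dB] by metis
  have "\<rho> indet * to_fract B = to_fract A" using AB unfolding f_def by simp
  moreover have "to_fract B \<noteq> 0" using AB by simp
  ultimately show ?thesis
    unfolding tA tB using AB(1,2)
    by (intro exI[of _ "pcoeff A 0"] exI[of _ "pcoeff A 1"] exI[of _ "pcoeff B 0"] exI[of _ "pcoeff B 1"])
      (simp add: F_polys_def)
qed

text \<open>All iterates of the indeterminate are fractional linear with coefficients in one finite
  field that \<open>\<rho>\<close> preserves, so the orbit is finite.\<close>

lemma periodic_indet:
  assumes r: "ring_aut R \<rho>"
  shows "periodic \<rho> indet"
proof -
  obtain a b c d where F: "a \<in> F" "b \<in> F" "c \<in> F" "d \<in> F" and D0: "const c + const d * indet \<noteq> 0"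
    and eq: "\<rho> indet * (const c + const d * indet) = const a + const b * indet" using aut_moebius[OF r] by blast
  obtain ea eb ec ed where e: "ea > 0" "eb > 0" "ec > 0" "ed > 0" "a \<in> frob_fixed ea" "b \<in> frob_fixed eb" "c \<in> frob_fixed ec" "d \<in> frob_fixed ed"
    using ex_frob_fixed F by metis
  define e where "e = ea * eb * ec * ed"
  have e0: "e > 0" using e by (simp add: e_def)
  \<comment> \<open>The fields \<open>frob_fixed\<close> grow along divisibility of exponents, so
    the product of the four exponents serves all coefficients.\<close>
  have mem: "a \<in> frob_fixed e" "b \<in> frob_fixed e" "c \<in> frob_fixed e" "d \<in> frob_fixed e"
    using frob_fixed_mono[of ea "eb * ec * ed"] frob_fixed_mono[of eb "ea * ec * ed"] frob_fixed_mono[of ec "ea * eb * ed"]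
      frob_fixed_mono[of ed "ea * eb * ec"] e by (auto simp: e_def ac_simps)
  define T where "T = (\<lambda>(a, b, c, d). (const a + const b * indet) / (const c + const d * indet)) ` (frob_fixed e \<times> frob_fixed e \<times> frob_fixed e \<times> frob_fixed e)"
  have finT: "finite T" unfolding T_def using finite_frob_fixed[OF e0] by blast
  have orb: "\<exists>a' b' c' d'. a' \<in> frob_fixed e \<and> b' \<in> frob_fixed e \<and> c' \<in> frob_fixed e \<and> d' \<in> frob_fixed e \<and> const c' + const d' * indet \<noteq> 0 \<and>
    (\<rho> ^^ k) indet * (const c' + const d' * indet) = const a' + const b' * indet" for k
  proof (induction k)
    case 0
    then show ?case
      by (intro exI[of _ 0] exI[of _ 1] conjI frob_fixed_zero frob_fixed_one) (auto simp: const_hom intro!: exI[of _ 1] exI[of _ 0] frob_fixed_one frob_fixed_zero)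
  next
    case (Suc k)
    then obtain a1 b1 c1 d1 where S1: "a1 \<in> frob_fixed e" "b1 \<in> frob_fixed e" "c1 \<in> frob_fixed e" "d1 \<in> frob_fixed e"
      and nz: "const c1 + const d1 * indet \<noteq> 0"
      and rel: "(\<rho> ^^ k) indet * (const c1 + const d1 * indet) = const a1 + const b1 * indet" by blast
    obtain a2 b2 c2 d2 where S2: "a2 \<in> frob_fixed e" "b2 \<in> frob_fixed e" "c2 \<in> frob_fixed e" "d2 \<in> frob_fixed e"
      and h: "\<rho> (const a1) = const a2" "\<rho> (const b1) = const b2" "\<rho> (const c1) = const c2" "\<rho> (const d1) = const d2"
      using aut_const_frob_fixed[OF r] S1 by metis
    have F1: "a1 \<in> F" "b1 \<in> F" "c1 \<in> F" "d1 \<in> F" using S1 by (auto simp: frob_fixed_def)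
    have lin: "\<rho> (const x + const y * indet) = \<rho> (const x) + \<rho> (const y) * \<rho> indet" if "x \<in> F" "y \<in> F" for x y
      using that autD(4,5)[OF r] const_R indet_R by simp
    have xR: "(\<rho> ^^ k) indet \<in> R" "const c1 + const d1 * indet \<in> R" using funpow_aut_R[OF r indet_R] F1 const_R indet_R by auto
    let ?x = "(\<rho> ^^ Suc k) indet" and ?f = "\<rho> indet" and ?D = "const c + const d * indet"
    have relx: "?x * (const c2 + const d2 * ?f) = const a2 + const b2 * ?f"
      using arg_cong[OF rel, of \<rho>] autD(5)[OF r xR] lin F1 h by simp
    have nz2: "const c2 + const d2 * ?f \<noteq> 0"
      using autD(8)[OF r xR(2)] nz lin F1 h by auto
    \<comment> \<open>Substituting one fractional linear expression into another multiplies their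
      coefficient matrices, which stays inside \<open>frob_fixed e\<close>.\<close>
    have comb: "(const x + const y * ?f) * ?D = const (x * c + y * a) + const (x * d + y * b) * indet" for x y
    proof -
      have "(const x + const y * ?f) * ?D = const x * ?D + const y * (?f * ?D)" by (simp add: algebra_simps)
      then show ?thesis unfolding eq by (simp add: const_hom algebra_simps)
    qed
    have "?x * ((const c2 + const d2 * ?f) * ?D) = (const a2 + const b2 * ?f) * ?D"
      using relx by (simp add: mult.assoc[symmetric])
    moreover have "(const c2 + const d2 * ?f) * ?D \<noteq> 0" using nz2 D0 by simp
    ultimately have *: "?x * (const (c2 * c + d2 * a) + const (c2 * d + d2 * b) * indet) =
        const (a2 * c + b2 * a) + const (a2 * d + b2 * b) * indet"
      "const (c2 * c + d2 * a) + const (c2 * d + d2 * b) * indet \<noteq> 0"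
      unfolding comb by blast+
    show ?case
      by (rule exI[of _ "a2 * c + b2 * a"], rule exI[of _ "a2 * d + b2 * b"],
          rule exI[of _ "c2 * c + d2 * a"], rule exI[of _ "c2 * d + d2 * b"])
        (intro conjI * frob_fixed_add frob_fixed_mult S2 mem)
  qed
  have "(\<rho> ^^ k) indet \<in> T" for k
  proof -
    from orb[of k] obtain a' b' c' d' where *: "a' \<in> frob_fixed e" "b' \<in> frob_fixed e" "c' \<in> frob_fixed e" "d' \<in> frob_fixed e"
      "const c' + const d' * indet \<noteq> 0" "(\<rho> ^^ k) indet * (const c' + const d' * indet) = const a' + const b' * indet" by blast
    then have "(\<rho> ^^ k) indet = (const a' + const b' * indet) / (const c' + const d' * indet)"
      by (simp add: nonzero_eq_divide_eq)
    then show ?thesis unfolding T_def using * by (intro image_eqI[of _ _ "(a', b', c', d')"]) auto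
  qed
  then show ?thesis using periodic_finite_orbit[OF r indet_R finT] by blast
qed

theorem locally_finite:
  assumes r: "ring_aut R \<rho>" and x: "x \<in> R"
  shows "periodic \<rho> x"
proof -
  have pol: "periodic \<rho> (to_fract G)" if "G \<in> F_polys" for G
    unfolding to_fract_sum_powers[OF order_refl] using that
    by (intro periodic_sum[OF r] periodic_mult[OF r] periodic_power[OF r] periodic_indet[OF r] periodic_const[OF r]) (auto simp: F_polys_def)
  obtain a b where ab: "a \<in> F_polys" "b \<in> F_polys" "b \<noteq> 0" "x = to_fract a / to_fract b"
    using coprime_fraction[OF x] by blast
  show ?thesis
    by (rule periodic_quotient[OF r x pol[OF ab(2)]]) (use ab pol in auto)
qed

lemma coeff_prod_linear:
  fixes a :: "nat \<Rightarrow> 'k poly fract"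
  assumes r: "ring_aut R \<rho>" and a: "\<And>i. a i \<in> R"
  shows "pcoeff (\<Prod>i<l. [:- a i, 1:]) k \<in> R \<and>
    \<rho> (pcoeff (\<Prod>i<l. [:- a i, 1:]) k) = pcoeff (\<Prod>i<l. [:- \<rho> (a i), 1:]) k"
proof (induction l arbitrary: k)
  case 0
  then show ?case using autD(2,3)[OF r] by (cases k) (auto simp: coeff_1)
next
  case (Suc l)
  have c: "pcoeff (q * [:- x, 1:]) k = (if k = 0 then 0 else pcoeff q (k - 1)) - x * pcoeff q k"
    for q :: "'k poly fract poly" and x by (cases k) (auto simp: coeff_pCons)
  show ?case
    unfolding prod.lessThan_Suc c
    using Suc.IH[of k] Suc.IH[of "k - 1"] a[of l]
    by (cases "k = 0") (simp_all add: aut_diff[OF r] autD[OF r])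
qed

text \<open>The candidates are the coefficients of the polynomial \<open>P\<close> whose roots are
  the conjugates of the indeterminate.\<close>

theorem ex_fixed_nonconstant:
  assumes r: "ring_aut R \<rho>"
  shows "\<exists>s \<in> R. \<rho> s = s \<and> s \<noteq> 0 \<and> fdeg s > 0"
proof -
  obtain m where m: "m > 0" "(\<rho> ^^ m) indet = indet" using periodic_indet[OF r] by (auto simp: periodic_def)
  define a where "a i = (\<rho> ^^ i) indet" for i
  have aR: "a i \<in> R" for i unfolding a_def by (rule funpow_aut_R[OF r indet_R])
  define P where "P = (\<Prod>i<m. [:- a i, 1:])"
  \<comment> \<open>\<open>\<rho>\<close> shifts the roots cyclically, since
    \<open>a m = a 0\<close>.\<close>
  have "(\<Prod>i<m. [:- \<rho> (a i), 1:]) = P"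
  proof -
    have "[:- a 0, 1:] * (\<Prod>i<m. [:- a (Suc i), 1:]) = (\<Prod>i<Suc m. [:- a i, 1:])"
      by (rule prod.lessThan_Suc_shift[symmetric])
    also have "\<dots> = P * [:- a m, 1:]" by (simp add: P_def)
    also have "a m = a 0" using m by (simp add: a_def)
    finally have "[:- a 0, 1:] * (\<Prod>i<m. [:- a (Suc i), 1:]) = [:- a 0, 1:] * P" by (simp only: mult.commute)
    then have "(\<Prod>i<m. [:- a (Suc i), 1:]) = P" by (simp only: mult_cancel_left) simp
    then show ?thesis by (simp add: a_def)
  qed
  then have fixed: "pcoeff P k \<in> R" "\<rho> (pcoeff P k) = pcoeff P k" for k
    using coeff_prod_linear[where l = m and k = k, OF r aR] by (auto simp: P_def)
  have deg: "pdeg P = m" unfolding P_def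
    by (subst degree_prod_eq_sum_degree) auto
  have monic: "pcoeff P m = 1"
  proof -
    have "pcoeff P (pdeg P) = (\<Prod>i<m. pcoeff [:- a i, 1:] (pdeg [:- a i, 1:]))"
      unfolding P_def by (rule lead_coeff_prod)
    then show ?thesis unfolding deg by simp
  qed
  have "poly P (a 0) = 0" unfolding P_def using m by (auto simp: poly_prod intro!: prod_zero)
  then have "(\<Sum>k\<le>m. pcoeff P k * indet ^ k) = 0"
    unfolding poly_altdef deg by (simp add: a_def)
  then have sum0: "(\<Sum>k<m. pcoeff P k * indet ^ k) + indet ^ m = 0"
    using monic by (simp add: lessThan_Suc_atMost[symmetric])
  \<comment> \<open>The indeterminate is a root of the monic \<open>P\<close>; if all lower
    coefficients had degree at most 0, its \<open>m\<close>-th power would dominate and the sum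
    could not vanish.\<close>
  have "\<exists>k<m. \<not> deg_le (pcoeff P k) 0"
  proof (rule ccontr)
    assume "\<not> ?thesis"
    then have d: "deg_le (pcoeff P k) 0" if "k < m" for k using that by blast
    have "deg_le (\<Sum>k<m. pcoeff P k * indet ^ k) (int m - 1)"
    proof (rule deg_le_sum)
      fix k assume k: "k \<in> {..<m}"
      have "deg_le (indet ^ k) (int k)" using fdeg_indet by (simp add: deg_le_def fdeg_power)
      moreover have "deg_le (pcoeff P k) 0" using d k by simp
      ultimately have "deg_le (pcoeff P k * indet ^ k) (0 + int k)" by (intro deg_le_mult)
      then show "deg_le (pcoeff P k * indet ^ k) (int m - 1)"
        by (rule deg_le_mono) (use k in simp)
    qed
    from fdeg_add_dominant(1)[OF _ _ this, of "indet ^ m"] have "indet ^ m + (\<Sum>k<m. pcoeff P k * indet ^ k) \<noteq> 0"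
      using fdeg_indet by (simp add: fdeg_power)
    then show False using sum0 by (simp add: add.commute)
  qed
  then obtain k where "\<not> deg_le (pcoeff P k) 0" by blast
  then show ?thesis using fixed[of k] by (intro bexI[of _ "pcoeff P k"]) (auto simp: deg_le_def)
qed

end

section \<open>Traces of twisted norms\<close>

definition mtrace :: "nat \<Rightarrow> 'a :: comm_ring_1 mat \<Rightarrow> 'a" where
  "mtrace n A = (\<Sum>i<n. A $$ (i, i))"

lemma mtrace_mult_commute:
  assumes "A \<in> carrier_mat n n" "B \<in> carrier_mat n n"
  shows "mtrace n (A * B) = mtrace n (B * A)"
proof -
  have "mtrace n (A * B) = (\<Sum>i<n. \<Sum>j<n. A $$ (i, j) * B $$ (j, i))"
    using assms by (simp add: mtrace_def scalar_prod_def lessThan_atLeast0)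
  also have "\<dots> = (\<Sum>j<n. \<Sum>i<n. B $$ (j, i) * A $$ (i, j))"
    by (subst sum.swap) (simp add: mult.commute)
  also have "\<dots> = mtrace n (B * A)"
    using assms by (simp add: mtrace_def scalar_prod_def lessThan_atLeast0)
  finally show ?thesis .
qed

lemma mtrace_smult: "A \<in> carrier_mat n n \<Longrightarrow> mtrace n (c \<cdot>\<^sub>m A) = c * mtrace n A"
  by (simp add: mtrace_def sum_distrib_left)

text \<open>The entry \<open>\<nu>\<close> only adjusts the determinant. For
  \<open>n \<ge> 3\<close> its place is outside the 2 x 2 block, so block and entry multiply
  independently.\<close>

definition block_mat :: "nat \<Rightarrow> 'a :: comm_ring_1 \<Rightarrow> 'a \<Rightarrow> 'a \<Rightarrow> 'a \<Rightarrow> 'a \<Rightarrow> 'a mat" where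
  "block_mat n a b c d \<nu> = mat n n (\<lambda>(i, j).
     if i = 0 \<and> j = 0 then a else if i = 0 \<and> j = 1 then b
     else if i = 1 \<and> j = 0 then c else if i = 1 \<and> j = 1 then d
     else if i = j then (if i = n - 1 then \<nu> else 1) else 0)"

lemma block_mat_carrier [simp]: "block_mat n a b c d \<nu> \<in> carrier_mat n n"
  and block_mat_dim [simp]: "dim_row (block_mat n a b c d \<nu>) = n" "dim_col (block_mat n a b c d \<nu>) = n"
  by (auto simp: block_mat_def)

lemma block_mat_index: "i < n \<Longrightarrow> j < n \<Longrightarrow> block_mat n a b c d \<nu> $$ (i, j) =
    (if i = 0 \<and> j = 0 then a else if i = 0 \<and> j = 1 then b
     else if i = 1 \<and> j = 0 then c else if i = 1 \<and> j = 1 then d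
     else if i = j then (if i = n - 1 then \<nu> else 1) else 0)"
  by (simp add: block_mat_def)

lemma block_mat_mult_left:
  assumes n: "n \<ge> 3" and A: "A \<in> carrier_mat n n" and ij: "i < n" "j < n"
  shows "(block_mat n a b c d \<nu> * A) $$ (i, j) =
    (if i = 0 then a * A $$ (0, j) + b * A $$ (1, j)
     else if i = 1 then c * A $$ (0, j) + d * A $$ (1, j)
     else (if i = n - 1 then \<nu> else 1) * A $$ (i, j))"
proof -
  have s: "(block_mat n a b c d \<nu> * A) $$ (i, j) = (\<Sum>k<n. block_mat n a b c d \<nu> $$ (i, k) * A $$ (k, j))"
    using A ij by (simp add: scalar_prod_def lessThan_atLeast0)
  show ?thesis
  proof (cases "i = 0 \<or> i = 1")
    case True
    have "(\<Sum>k<n. block_mat n a b c d \<nu> $$ (i, k) * A $$ (k, j)) =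
      (\<Sum>k\<in>{0, 1}. block_mat n a b c d \<nu> $$ (i, k) * A $$ (k, j))"
      using n ij True by (intro sum.mono_neutral_right) (auto simp: block_mat_index)
    then show ?thesis unfolding s using n True by (auto simp: block_mat_index)
  next
    case False
    have "(\<Sum>k<n. block_mat n a b c d \<nu> $$ (i, k) * A $$ (k, j)) =
      (\<Sum>k\<in>{i}. block_mat n a b c d \<nu> $$ (i, k) * A $$ (k, j))"
      using n ij False by (intro sum.mono_neutral_right) (auto simp: block_mat_index)
    then show ?thesis unfolding s using n ij False by (auto simp: block_mat_index)
  qed
qed

lemma block_mat_mult:
  assumes n: "n \<ge> 3"
  shows "block_mat n a b c d \<nu> * block_mat n a' b' c' d' \<nu>' =
    block_mat n (a * a' + b * c') (a * b' + b * d') (c * a' + d * c') (c * b' + d * d') (\<nu> * \<nu>')"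
  using n by (intro eq_matI) (auto simp: block_mat_mult_left block_mat_index simp del: index_mult_mat(1))

lemma block_mat_one: "block_mat n 1 0 0 1 1 = 1\<^sub>m n"
  by (intro eq_matI) (auto simp: block_mat_index)

lemma map_block_mat: "f 0 = 0 \<Longrightarrow> f 1 = 1 \<Longrightarrow> map_mat f (block_mat n a b c d \<nu>) = block_mat n (f a) (f b) (f c) (f d) (f \<nu>)"
  by (intro eq_matI) (auto simp: block_mat_index)

lemma transpose_block_mat: "transpose_mat (block_mat n a b c d \<nu>) = block_mat n a c b d \<nu>"
  by (intro eq_matI) (auto simp: block_mat_index)

lemma det_block_mat:
  fixes x \<nu> :: "'a :: field"
  assumes n: "n \<ge> 3"
  shows "det (block_mat n 1 x 0 1 \<nu>) = \<nu>" "det (block_mat n (1 - x * x) x (- x) 1 \<nu>) = \<nu>"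
proof -
  have d: "det (block_mat n 1 y 0 1 \<nu>) = \<nu>" for y :: 'a
  proof -
    have "upper_triangular (block_mat n 1 y 0 1 \<nu>)" unfolding upper_triangular_def by (auto simp: block_mat_index)
    then have "det (block_mat n 1 y 0 1 \<nu>) = (\<Prod>i = 0..<n. block_mat n 1 y 0 1 \<nu> $$ (i, i))"
      using det_upper_triangular[OF _ block_mat_carrier] by (simp add: prod_list_diag_prod)
    also have "\<dots> = (\<Prod>i\<in>{n - 1}. block_mat n 1 y 0 1 \<nu> $$ (i, i))"
      using n by (intro prod.mono_neutral_right) (auto simp: block_mat_index)
    finally show ?thesis using n by (auto simp: block_mat_index)
  qed
  then show "det (block_mat n 1 x 0 1 \<nu>) = \<nu>" .
  have "block_mat n (1 - x * x) x (- x) 1 \<nu> = block_mat n 1 x 0 1 1 * (block_mat n 1 0 (- x) 1 1 * block_mat n 1 0 0 1 \<nu>)"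
    using n by (simp add: block_mat_mult)
  moreover have "block_mat n 1 x 0 1 1 = elem_mat n 0 1 x" "block_mat n 1 0 (- x) 1 1 = elem_mat n 1 0 (- x)"
    using n by (auto intro!: eq_matI simp: block_mat_index elem_mat_index)
  ultimately have "block_mat n (1 - x * x) x (- x) 1 \<nu> = elem_mat n 0 1 x * (elem_mat n 1 0 (- x) * block_mat n 1 0 0 1 \<nu>)" by simp
  then show "det (block_mat n (1 - x * x) x (- x) 1 \<nu>) = \<nu>"
    by (simp only: det_mult[OF elem_mat_carrier mult_carrier_mat[OF elem_mat_carrier block_mat_carrier]]
      det_mult[OF elem_mat_carrier block_mat_carrier]) (simp add: det_elem_mat d)
qed

section \<open>Twisted norms of the test matrices and the degrees of their traces\<close>

context rational_subring_matrices
begin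

lemma block_mat_RM: "a \<in> R \<Longrightarrow> b \<in> R \<Longrightarrow> c \<in> R \<Longrightarrow> d \<in> R \<Longrightarrow> \<nu> \<in> R \<Longrightarrow> block_mat n a b c d \<nu> \<in> RM"
  by (auto simp: RM_def block_mat_index)

text \<open>\<open>twist_block x \<nu>\<close> has the block \<open>[[1, x], [0, 1]] * [[1, 0], [- x, 1]]\<close>: this is also what the
  contragredient type produces from \<open>[[1, x], [0, 1]]\<close>.\<close>

abbreviation twist_block :: "'k poly fract \<Rightarrow> 'k poly fract \<Rightarrow> 'k poly fract mat" where
  "twist_block x \<nu> \<equiv> block_mat n (1 - x * x) x (- x) 1 \<nu>"

text \<open>It is meant for \<open>x\<close> fixed by \<open>\<sigma>\<close>: then applying
  \<open>\<sigma> ^^ k\<close> to the block changes only \<open>\<nu>\<close>, and this is the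
  product of the successive images.\<close>

primrec twisted_norm :: "('k poly fract \<Rightarrow> 'k poly fract) \<Rightarrow> 'k poly fract \<Rightarrow> 'k poly fract \<Rightarrow> nat \<Rightarrow> 'k poly fract mat" where
  "twisted_norm \<sigma> x \<nu> 0 = 1\<^sub>m n"
| "twisted_norm \<sigma> x \<nu> (Suc k) = twisted_norm \<sigma> x \<nu> k * twist_block x ((\<sigma> ^^ k) \<nu>)"

lemma twisted_norm_carrier [simp]: "twisted_norm \<sigma> x \<nu> k \<in> carrier_mat n n"
  by (induction k) (auto intro: mult_carrier_mat)

lemma det_twisted_norm: "det (twisted_norm \<sigma> x \<nu> k) = (\<Prod>j<k. (\<sigma> ^^ j) \<nu>)"
  by (induction k) (simp_all add: det_mult[OF twisted_norm_carrier block_mat_carrier] det_block_mat[OF n3])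

text \<open>Each further factor multiplies the upper left entry by \<open>1 - x * x\<close>, of
  degree \<open>2 * d\<close>. The other entries stay strictly below it in degree, so no
  cancellation can reach its leading term.\<close>

lemma twisted_norm_growth:
  assumes x: "x \<noteq> 0" "fdeg x = d" "d > 0"
  shows "\<exists>q r s t. twisted_norm \<sigma> x \<nu> (Suc k) = block_mat n q r s t (\<Prod>j<Suc k. (\<sigma> ^^ j) \<nu>) \<and>
    q \<noteq> 0 \<and> fdeg q = 2 * int (Suc k) * d \<and> deg_le r (2 * int (Suc k) * d - 1) \<and>
    deg_le s (2 * int (Suc k) * d - 1) \<and> deg_le t (2 * int (Suc k) * d - 1)"
proof (induction k)
  have one: "deg_le (1 :: 'k poly fract) 0" by (simp add: deg_le_def fdeg_one)
  have dx: "deg_le x d" using x by (simp add: deg_le_def)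
  have twist_block: "- (x * x) + 1 \<noteq> 0" "fdeg (- (x * x) + 1) = 2 * d"
    using fdeg_add_dominant[of "- (x * x)" "2 * d" 1] x deg_le_mono[OF one, of "2 * d - 1"]
    by (simp_all add: fdeg_uminus fdeg_mult)
  then have q1: "1 - x * x \<noteq> 0" "fdeg (1 - x * x) = 2 * d" by simp_all
  {
    case 0
    have "deg_le x (2 * d - 1)" "deg_le (1 :: 'k poly fract) (2 * d - 1)" using deg_le_mono[OF dx] deg_le_mono[OF one] x by auto
    then show ?case
      using q1 deg_le_uminus[of x "2 * d - 1"]
      by (intro exI[of _ "1 - x * x"] exI[of _ x] exI[of _ "- x"] exI[of _ 1]) simp
  next
    case (Suc k)
    define D where "D = 2 * int (Suc k) * d"
    obtain q r s t where *: "twisted_norm \<sigma> x \<nu> (Suc k) = block_mat n q r s t (\<Prod>j<Suc k. (\<sigma> ^^ j) \<nu>)"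
      "q \<noteq> 0" "fdeg q = D" "deg_le r (D - 1)" "deg_le s (D - 1)" "deg_le t (D - 1)"
      using Suc unfolding D_def by blast
    have D': "2 * int (Suc (Suc k)) * d = D + 2 * d" by (simp add: D_def algebra_simps)
    have dq: "deg_le q D" using * by (simp add: deg_le_def)
    have m: "deg_le (y * z) (D + 2 * d - 1)" if "deg_le y (D - 1)" "deg_le z (2 * d)" for y z
      using deg_le_mono[OF deg_le_mult[OF that]] by simp
    have dx2: "deg_le x (2 * d)" using deg_le_mono[OF dx] x by simp
    have d1: "deg_le (1 - x * x) (2 * d)" using q1 by (simp add: deg_le_def)
    have one2: "deg_le (1 :: 'k poly fract) (2 * d)" using deg_le_mono[OF one] x by simp
    have "deg_le (q * x) (D + 2 * d - 1)" using deg_le_mono[OF deg_le_mult[OF dq dx]] x by simp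
    moreover have "deg_le r (D + 2 * d - 1)" by (rule deg_le_mono[OF *(4)]) (use x in simp)
    ultimately have e2: "deg_le (q * x + r * 1) (D + 2 * d - 1)" by (simp add: deg_le_add)
    have e1: "q * (1 - x * x) + r * (- x) \<noteq> 0" "fdeg (q * (1 - x * x) + r * (- x)) = D + 2 * d"
      using fdeg_add_dominant[of "q * (1 - x * x)" "D + 2 * d" "r * (- x)"] m[OF *(4) deg_le_uminus[OF dx2]]
        q1 * by (simp_all add: fdeg_mult)
    have e3: "deg_le (s * (1 - x * x) + t * (- x)) (D + 2 * d - 1)"
      by (intro deg_le_add m * d1 deg_le_uminus dx2)
    have e4: "deg_le (s * x + t * 1) (D + 2 * d - 1)"
      by (intro deg_le_add m * dx2 one2)
    have "twisted_norm \<sigma> x \<nu> (Suc (Suc k)) = block_mat n (q * (1 - x * x) + r * (- x)) (q * x + r * 1)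
      (s * (1 - x * x) + t * (- x)) (s * x + t * 1) (\<Prod>j<Suc (Suc k). (\<sigma> ^^ j) \<nu>)"
      unfolding twisted_norm.simps(2)[of _ _ _ "Suc k"] *(1) block_mat_mult[OF n3] by simp
    then show ?case unfolding D' using e1 e2 e3 e4 by blast
  }
qed

text \<open>The upper left entry dominates the trace. The condition \<open>b < 2 * d\<close> keeps
  the product of the \<open>k\<close> conjugates of \<open>\<nu>\<close> below degree
  \<open>2 * k * d\<close>.\<close>

lemma mtrace_twisted_norm:
  assumes x: "x \<noteq> 0" "fdeg x = d" "d > 0" and k: "k > 0"
    and b: "\<And>j. deg_le ((\<sigma> ^^ j) \<nu>) b" "b < 2 * d"
  shows "mtrace n (twisted_norm \<sigma> x \<nu> k) \<noteq> 0" "fdeg (mtrace n (twisted_norm \<sigma> x \<nu> k)) = 2 * int k * d"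
proof -
  obtain k' where k': "k = Suc k'" using k by (cases k) auto
  define D where "D = 2 * int k * d"
  define N where "N = (\<Prod>j<k. (\<sigma> ^^ j) \<nu>)"
  obtain q r s t where *: "twisted_norm \<sigma> x \<nu> k = block_mat n q r s t N" "q \<noteq> 0" "fdeg q = D" "deg_le t (D - 1)"
    using twisted_norm_growth[OF x, of \<sigma> \<nu> k'] unfolding k' D_def N_def by blast
  have "deg_le N (int k * b)"
    unfolding N_def
  proof (induction k)
    case 0 then show ?case by (simp add: deg_le_def fdeg_one)
  next
    case (Suc k)
    then show ?case using deg_le_mult[OF Suc b(1)[of k]] by (simp add: algebra_simps)
  qed
  moreover have "int k * b \<le> D - 1"
  proof -
    have "int k * b \<le> int k * (2 * d - 1)" using b by (intro mult_left_mono) auto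
    also have "\<dots> = D - int k" by (simp add: D_def algebra_simps)
    finally show ?thesis using k by simp
  qed
  ultimately have N: "deg_le N (D - 1)" by (rule deg_le_mono)
  have "int k * d \<ge> 1 * 1" using k x by (intro mult_mono) auto
  then have "D \<ge> 2" unfolding D_def by linarith
  then have one: "deg_le (1 :: 'k poly fract) (D - 1)" by (simp add: deg_le_def fdeg_one)
  have "mtrace n (twisted_norm \<sigma> x \<nu> k) = q + (\<Sum>i\<in>{..<n} - {0}. block_mat n q r s t N $$ (i, i))"
    unfolding *(1) mtrace_def using n3 by (subst sum.remove[of _ 0]) (auto simp: block_mat_index)
  moreover have "deg_le (\<Sum>i\<in>{..<n} - {0}. block_mat n q r s t N $$ (i, i)) (D - 1)"
    by (rule deg_le_sum) (use * N one in \<open>auto simp: block_mat_index\<close>)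
  ultimately show "mtrace n (twisted_norm \<sigma> x \<nu> k) \<noteq> 0" "fdeg (mtrace n (twisted_norm \<sigma> x \<nu> k)) = 2 * int k * d"
    using fdeg_add_dominant[OF *(2,3)] by (simp_all add: D_def)
qed

lemma ex_common_period:
  assumes r: "ring_aut R \<sigma>" and z: "z \<in> RM"
  shows "\<exists>m>0. map_mat (\<sigma> ^^ m) z = z"
proof -
  have "\<exists>m>0. \<forall>ij \<in> I. (\<sigma> ^^ m) (z $$ ij) = z $$ ij" if "finite I" "I \<subseteq> {..<n} \<times> {..<n}" for I
    using that
  proof (induction I)
    case empty then show ?case by auto
  next
    case (insert ij I)
    then obtain m where m: "m > 0" "\<forall>ij \<in> I. (\<sigma> ^^ m) (z $$ ij) = z $$ ij" by auto
    have "z $$ ij \<in> R" using insert.prems z by (auto simp: RM_def)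
    then obtain l where l: "l > 0" "(\<sigma> ^^ l) (z $$ ij) = z $$ ij"
      using locally_finite[OF r] unfolding periodic_def by blast
    show ?case using m l by (intro exI[of _ "m * l"]) (auto intro: fixed_multiple)
  qed
  from this[of "{..<n} \<times> {..<n}"] obtain m where m: "m > 0" "\<forall>ij \<in> {..<n} \<times> {..<n}. (\<sigma> ^^ m) (z $$ ij) = z $$ ij"
    by auto
  have "map_mat (\<sigma> ^^ m) z = z" using m(2) RM_carrier[OF z] by (intro eq_matI) auto
  then show ?thesis using m(1) by blast
qed

lemma map_smult:
  assumes r: "ring_aut R \<sigma>" and c: "c \<in> R" and A: "A \<in> RM"
  shows "map_mat \<sigma> (c \<cdot>\<^sub>m A) = \<sigma> c \<cdot>\<^sub>m map_mat \<sigma> A"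
  using A c autD(5)[OF r c] by (intro eq_matI) (auto simp: RM_def)

text \<open>Telescoping: applying powers of \<open>\<sigma>\<close> to the relation and multiplying
  lets the intermediate images of \<open>z\<close> cancel. The unit \<open>e\<close> collects the
  conjugates of \<open>c\<close>.\<close>

lemma twisted_twisted_norm:
  assumes r: "ring_aut R \<sigma>" and fx: "x \<in> R" "\<sigma> x = x" and fy: "y \<in> R" "\<sigma> y = y" and nu: "\<nu> \<in> R"
    and c: "R_unit c" and z: "z \<in> RM"
    and rel: "c \<cdot>\<^sub>m (twist_block y \<nu> * map_mat \<sigma> z) = z * twist_block x \<nu>"
  shows "\<exists>e. R_unit e \<and> e \<cdot>\<^sub>m (twisted_norm \<sigma> y \<nu> k * map_mat (\<sigma> ^^ k) z) = z * twisted_norm \<sigma> x \<nu> k"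
proof (induction k)
  case 0
  have "map_mat (\<sigma> ^^ 0) z = z" using RM_carrier[OF z] by (intro eq_matI) auto
  then show ?case using RM_carrier[OF z] by (intro exI[of _ 1]) (auto simp: R_unit_def intro!: eq_matI)
next
  case (Suc k)
  then obtain e where e: "R_unit e" "e \<cdot>\<^sub>m (twisted_norm \<sigma> y \<nu> k * map_mat (\<sigma> ^^ k) z) = z * twisted_norm \<sigma> x \<nu> k" by blast
  note rk = ring_aut_funpow[OF r, of k]
  let ?s = "\<sigma> ^^ k"
  have fixed: "?s x = x" "?s y = y" using funpow_fixed[of \<sigma> x k, OF fx(2)] funpow_fixed[of \<sigma> y k, OF fy(2)] by auto
  have xxR: "twist_block x \<nu> \<in> RM" "twist_block y \<nu> \<in> RM" using fx fy nu by (auto intro!: block_mat_RM)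
  have sx: "map_mat ?s (twist_block w \<nu>) = twist_block w (?s \<nu>)" if "w \<in> R" "?s w = w" for w
    using map_block_mat[of ?s n] autD(2,3)[OF rk] autD(5,6)[OF rk] aut_diff[OF rk] that by simp
  have zR: "map_mat \<sigma> z \<in> RM" by (rule map_RM[OF r z])
  have zc: "z \<in> carrier_mat n n" "map_mat ?s z \<in> carrier_mat n n" "map_mat (\<sigma> ^^ Suc k) z \<in> carrier_mat n n"
    using RM_carrier[OF z] by auto
  have mm: "map_mat ?s (map_mat \<sigma> z) = map_mat (\<sigma> ^^ Suc k) z"
    using zc by (intro eq_matI) (auto simp flip: funpow_swap1)
  have cR: "c \<in> R" using c by (simp add: R_unit_def)
  have "map_mat ?s (c \<cdot>\<^sub>m (twist_block y \<nu> * map_mat \<sigma> z)) = map_mat ?s (z * twist_block x \<nu>)" unfolding rel ..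
  then have rel': "?s c \<cdot>\<^sub>m (twist_block y (?s \<nu>) * map_mat (\<sigma> ^^ Suc k) z) = map_mat ?s z * twist_block x (?s \<nu>)"
    unfolding map_smult[OF rk cR mult_RM[OF xxR(2) zR]] map_mult[OF rk xxR(2) zR] map_mult[OF rk z xxR(1)]
      sx[OF fx(1) fixed(1)] sx[OF fy(1) fixed(2)] mm .
  note assoc = assoc_mult_mat[of _ n n _ n _ n]
  note sm = mult_smult_distrib[of _ n n _ n] mult_smult_assoc_mat[of _ n n _ n]
  let ?Z = "map_mat (\<sigma> ^^ Suc k) z" and ?NY = "twisted_norm \<sigma> y \<nu> k" and ?NX = "twisted_norm \<sigma> x \<nu> k"
  have W: "twist_block y (?s \<nu>) * ?Z \<in> carrier_mat n n" by (rule mult_carrier_mat[OF block_mat_carrier zc(3)])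
  have "z * twisted_norm \<sigma> x \<nu> (Suc k) = z * ?NX * twist_block x (?s \<nu>)"
    unfolding twisted_norm.simps by (rule assoc[symmetric, OF zc(1) twisted_norm_carrier block_mat_carrier])
  also have "\<dots> = e \<cdot>\<^sub>m (?NY * map_mat ?s z) * twist_block x (?s \<nu>)" unfolding e(2) ..
  also have "\<dots> = e \<cdot>\<^sub>m (?NY * map_mat ?s z * twist_block x (?s \<nu>))"
    by (rule mult_smult_assoc_mat[OF mult_carrier_mat[OF twisted_norm_carrier zc(2)] block_mat_carrier])
  also have "?NY * map_mat ?s z * twist_block x (?s \<nu>) = ?NY * (map_mat ?s z * twist_block x (?s \<nu>))"
    by (rule assoc[OF twisted_norm_carrier zc(2) block_mat_carrier])
  also have "\<dots> = ?s c \<cdot>\<^sub>m (?NY * (twist_block y (?s \<nu>) * ?Z))"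
    unfolding rel'[symmetric] by (rule mult_smult_distrib[OF twisted_norm_carrier W])
  also have "?NY * (twist_block y (?s \<nu>) * ?Z) = twisted_norm \<sigma> y \<nu> (Suc k) * ?Z"
    unfolding twisted_norm.simps by (rule assoc[symmetric, OF twisted_norm_carrier block_mat_carrier zc(3)])
  also have "e \<cdot>\<^sub>m (?s c \<cdot>\<^sub>m (twisted_norm \<sigma> y \<nu> (Suc k) * ?Z)) = (e * ?s c) \<cdot>\<^sub>m (twisted_norm \<sigma> y \<nu> (Suc k) * ?Z)"
    by (intro eq_matI) auto
  finally have "(e * ?s c) \<cdot>\<^sub>m (twisted_norm \<sigma> y \<nu> (Suc k) * ?Z) = z * twisted_norm \<sigma> x \<nu> (Suc k)" ..
  moreover have "R_unit (e * ?s c)" by (intro R_unit_mult e aut_R_unit(1)[OF rk c])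
  ultimately show ?case by blast
qed

text \<open>At a period \<open>m\<close> of \<open>z\<close> the two norms are conjugate up to a
  unit \<open>e\<close>. Their determinants agree, as both depend on \<open>\<nu>\<close> alone, so
  \<open>e\<close> has degree 0 and the traces have equal degree, namely \<open>2 * m\<close> times
  those of \<open>x\<close> and \<open>y\<close>.\<close>

theorem fdeg_eq_if_twisted:
  assumes r: "ring_aut R \<sigma>" and fx: "x \<in> R" "\<sigma> x = x" and fy: "y \<in> R" "\<sigma> y = y" and nu: "R_unit \<nu>"
    and c: "R_unit c" and z: "z \<in> RM" "z' \<in> RM" "z * z' = 1\<^sub>m n"
    and rel: "c \<cdot>\<^sub>m (twist_block y \<nu> * map_mat \<sigma> z) = z * twist_block x \<nu>"
    and x: "x \<noteq> 0" "fdeg x > 0" "b < 2 * fdeg x" and y: "y \<noteq> 0" "fdeg y > 0" "b < 2 * fdeg y"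
    and b: "\<And>j. deg_le ((\<sigma> ^^ j) \<nu>) b"
  shows "fdeg x = fdeg y"
proof -
  obtain m where m: "m > 0" "map_mat (\<sigma> ^^ m) z = z" using ex_common_period[OF r z(1)] by blast
  have nuR: "\<nu> \<in> R" using nu by (simp add: R_unit_def)
  obtain e where e: "R_unit e" "e \<cdot>\<^sub>m (twisted_norm \<sigma> y \<nu> m * z) = z * twisted_norm \<sigma> x \<nu> m"
    using twisted_twisted_norm[OF r fx fy nuR c z(1) rel, of m] m(2) by auto
  let ?X = "twisted_norm \<sigma> x \<nu> m" and ?Y = "twisted_norm \<sigma> y \<nu> m"
  note zc = RM_carrier[OF z(1)] RM_carrier[OF z(2)]
  have e0: "e \<noteq> 0" using e by (simp add: R_unit_def)
  have dz: "det z \<noteq> 0" using det_mult[OF zc] z(3) by auto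
  have dn: "(\<Prod>j<m. (\<sigma> ^^ j) \<nu>) \<noteq> 0"
    using aut_R_unit(1)[OF ring_aut_funpow[OF r] nu] by (auto simp: R_unit_def)
  have d1: "det (e \<cdot>\<^sub>m (?Y * z)) = e ^ n * (det ?Y * det z)"
    using zc det_mult[OF twisted_norm_carrier zc(1)] by (simp add: det_smult)
  have "det (z * ?X) = det z * det ?X" by (rule det_mult[OF zc(1) twisted_norm_carrier])
  with d1 have "e ^ n * (det ?Y * det z) = det z * det ?X" unfolding e(2) by (rule trans[OF sym])
  then have "e ^ n = 1" using dz dn by (simp add: det_twisted_norm)
  then have "fdeg (e ^ n) = 0" by (simp add: fdeg_one)
  then have "int n * fdeg e = 0" using fdeg_power[OF e0, of n] by simp
  then have fe: "fdeg e = 0" using n3 by simp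
  have "e \<cdot>\<^sub>m (?Y * z) * z' = e \<cdot>\<^sub>m (?Y * z * z')"
    by (rule mult_smult_assoc_mat[OF mult_carrier_mat[OF twisted_norm_carrier zc(1)] zc(2)])
  also have "?Y * z * z' = ?Y"
    unfolding assoc_mult_mat[OF twisted_norm_carrier zc] z(3) by (rule right_mult_one_mat[OF twisted_norm_carrier])
  finally have "e \<cdot>\<^sub>m ?Y = z * ?X * z'" unfolding e(2) ..
  then have "mtrace n (e \<cdot>\<^sub>m ?Y) = mtrace n (z * ?X * z')" by simp
  also have "\<dots> = mtrace n (z' * (z * ?X))"
    using zc by (intro mtrace_mult_commute) (auto intro: mult_carrier_mat)
  also have "z' * (z * ?X) = ?X"
    unfolding assoc_mult_mat[OF zc(2,1) twisted_norm_carrier, symmetric] mat_mult_left_right_inverse[OF zc z(3)]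
    by (rule left_mult_one_mat[OF twisted_norm_carrier])
  finally have t: "e * mtrace n ?Y = mtrace n ?X" by (simp add: mtrace_smult)
  note tx = mtrace_twisted_norm[OF x(1) refl x(2) m(1) b x(3)] and ty = mtrace_twisted_norm[OF y(1) refl y(2) m(1) b y(3)]
  have "2 * int m * fdeg y = 2 * int m * fdeg x"
    using arg_cong[OF t, of fdeg] tx ty e0 fe by (simp add: fdeg_mult)
  then show ?thesis using m(1) by simp
qed

lemma ex_orbit_bound:
  assumes r: "ring_aut R \<sigma>" and x: "x \<in> R"
  shows "\<exists>b. \<forall>j. deg_le ((\<sigma> ^^ j) x) b"
proof -
  obtain m where m: "m > 0" "(\<sigma> ^^ m) x = x" using locally_finite[OF r x] by (auto simp: periodic_def)
  have mod: "(\<sigma> ^^ j) x = (\<sigma> ^^ (j mod m)) x" for j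
  proof -
    have "(\<sigma> ^^ j) x = (\<sigma> ^^ (j mod m)) ((\<sigma> ^^ (m * (j div m))) x)"
      by (metis funpow_add comp_apply mod_mult_div_eq)
    then show ?thesis using fixed_multiple(1)[OF m(2)] by simp
  qed
  define b where "b = Max ((\<lambda>j. fdeg ((\<sigma> ^^ j) x)) ` {..<m})"
  have "fdeg ((\<sigma> ^^ j) x) \<le> b" for j
    unfolding mod[of j] b_def using m(1) by (intro Max_ge) auto
  then show ?thesis by (auto simp: deg_le_def)
qed

end

section \<open>Infinitely many twisted conjugacy classes\<close>

text \<open>The relation is twisted conjugacy with the factor \<open>\<phi> (inv z)\<close> moved to
  the other side, so that no inverses occur when the family is constructed.\<close>

lemma R_infinity_property_if_infinite_family:
  fixes Gr (structure)
  assumes "group Gr"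
    and ex: "\<And>\<phi>. \<phi> \<in> iso Gr Gr \<Longrightarrow> \<exists>Y :: nat \<Rightarrow> _. range Y \<subseteq> carrier Gr \<and>
      (\<forall>i j. \<forall>z \<in> carrier Gr. Y j \<otimes> \<phi> z = z \<otimes> Y i \<longrightarrow> i = j)"
  shows "R_infinity_property Gr"
  unfolding R_infinity_property_def
proof
  interpret group Gr by fact
  fix \<phi> assume phi: "\<phi> \<in> iso Gr Gr"
  then have h: "\<phi> \<in> hom Gr Gr" by (simp add: iso_def)
  interpret group_hom Gr Gr \<phi> by unfold_locales (rule h)
  obtain Y :: "nat \<Rightarrow> _" where Y: "range Y \<subseteq> carrier Gr"
    and inj: "\<And>i j z. z \<in> carrier Gr \<Longrightarrow> Y j \<otimes> \<phi> z = z \<otimes> Y i \<Longrightarrow> i = j"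
    using ex[OF phi] by blast
  have eq: "equiv (carrier Gr) (twisted_conj Gr \<phi>)" by (rule equiv_twisted_conj[OF phi])
  have Yc: "Y i \<in> carrier Gr" for i using Y by auto
  have "inj (\<lambda>i. twisted_conj Gr \<phi> `` {Y i})"
  proof (rule injI)
    fix i j assume "twisted_conj Gr \<phi> `` {Y i} = twisted_conj Gr \<phi> `` {Y j}"
    then have "(Y i, Y j) \<in> twisted_conj Gr \<phi>" using eq Yc by (meson eq_equiv_class)
    then obtain z where z: "z \<in> carrier Gr" "Y j = z \<otimes> Y i \<otimes> \<phi> (inv z)"
      by (auto simp: twisted_conj_def)
    have "Y j \<otimes> \<phi> z = z \<otimes> Y i \<otimes> (\<phi> (inv z) \<otimes> \<phi> z)"
      using z Yc[of i] by (simp add: m_assoc del: hom_inv)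
    also have "\<phi> (inv z) \<otimes> \<phi> z = \<one>" using z by simp
    finally have "Y j \<otimes> \<phi> z = z \<otimes> Y i" using z Yc[of i] by simp
    then show "i = j" using inj z by blast
  qed
  moreover have "range (\<lambda>i. twisted_conj Gr \<phi> `` {Y i}) \<subseteq> carrier Gr // twisted_conj Gr \<phi>"
    using Yc by (auto intro: quotientI)
  ultimately have "infinite (carrier Gr // twisted_conj Gr \<phi>)"
    using finite_imageD finite_subset infinite_UNIV_nat by blast
  then show "reidemeister_number Gr \<phi> = \<infinity>" by (simp add: reidemeister_number_def)
qed

context rational_subring_matrices
begin

text \<open>Right multiplication of the test matrices by \<open>h\<close> absorbs the conjugating
  matrix \<open>g\<close>, so that only the ring automorphism, possibly with the contragredient, is
  left in the relation.\<close>

lemma twisted_family: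
  assumes a: "matrix_aut_transpose R euclid_deg n p G \<phi>"
  shows "\<exists>Y :: nat \<Rightarrow> _. range Y \<subseteq> G \<and> (\<forall>i j. \<forall>z \<in> G. Y j * \<phi> z = z * Y i \<longrightarrow> i = j)"
proof -
  interpret A: matrix_aut_transpose R euclid_deg n p G \<phi> by (rule a)
  obtain \<rho> g h where r: "ring_aut R \<rho>" and gh: "g \<in> RM" "h \<in> RM" "g * h = 1\<^sub>m n" "h * g = 1\<^sub>m n"
    and alt: "(\<forall>A \<in> G. \<exists>\<chi>. R_unit \<chi> \<and> \<phi> A * g = \<chi> \<cdot>\<^sub>m (g * map_mat \<rho> A)) \<or>
     (\<forall>A \<in> G. \<exists>\<chi>. R_unit \<chi> \<and> \<phi> A * (g * transpose_mat (map_mat \<rho> A)) = \<chi> \<cdot>\<^sub>m g)"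
    using A.semilinear_or_contragredient by blast
  note gc = RM_carrier[OF gh(1)] and hc = RM_carrier[OF gh(2)]
  note assoc = assoc_mult_mat[of _ n n _ n _ n]
  define u where "u = det g"
  have uh: "u * det h = 1" unfolding u_def using det_mult[OF gc hc] gh(3) by simp
  have u: "R_unit u" unfolding u_def by (rule R_unitI[OF det_RM[OF gh(1)] det_RM[OF gh(2)] uh[unfolded u_def]])
  have uR: "u \<in> R" using u by (simp add: R_unit_def)
  obtain s where s: "s \<in> R" "\<rho> s = s" "s \<noteq> 0" "fdeg s > 0" using ex_fixed_nonconstant[OF r] by blast
  have sk: "s ^ k \<in> R" "\<rho> (s ^ k) = s ^ k" "s ^ k \<noteq> 0" "fdeg (s ^ k) = int k * fdeg s" for k
    using s aut_power[OF r s(1)] by (simp_all add: fdeg_power)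
  \<comment> \<open>The exponent exceeds the absolute value of \<open>b\<close>, and
    \<open>fdeg s\<close> is at least 1, so the power of \<open>s\<close> outgrows the orbit of the
    corner entry.\<close>
  have big: "b < 2 * fdeg (s ^ (i + nat \<bar>b\<bar> + 1)) \<and> 0 < fdeg (s ^ (i + nat \<bar>b\<bar> + 1))" for b i
  proof -
    let ?k = "i + nat \<bar>b\<bar> + 1"
    have "int ?k * 1 \<le> int ?k * fdeg s" using s(4) by (intro mult_left_mono) auto
    moreover have "K * 1 \<le> P \<Longrightarrow> \<bar>b\<bar> + 1 \<le> K \<Longrightarrow> b < 2 * P \<and> 0 < P" for K P :: int by linarith
    ultimately show ?thesis unfolding sk(4) by simp
  qed
  have cancel: "i = j" if "fdeg (s ^ (i + k)) = fdeg (s ^ (j + k))" for i j k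
    using that s(4) unfolding sk(4) by simp
  have hg: "M * h * (g * N) = M * N" if "M \<in> carrier_mat n n" "N \<in> carrier_mat n n" for M N
  proof -
    have "M * h * (g * N) = M * (h * (g * N))"
      by (rule assoc[OF that(1) hc mult_carrier_mat[OF gc that(2)]])
    also have "h * (g * N) = h * g * N" by (rule assoc[OF hc gc that(2), symmetric])
    finally show ?thesis using gh(4) that by simp
  qed
  have inG: "M * h \<in> G" if "M \<in> RM" "det M = u" for M
  proof (rule A.SL_G)
    show "M * h \<in> RM" using that gh by (intro mult_RM)
    show "det (M * h) = 1" using det_mult[OF RM_carrier[OF that(1)] hc] that uh by simp
  qed
  have inv: "\<exists>z' \<in> RM. z * z' = 1\<^sub>m n" if "z \<in> G" for z using A.G_inv[OF that] A.G_RM by blast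
  from alt show ?thesis
  proof
    assume std: "\<forall>A \<in> G. \<exists>\<chi>. R_unit \<chi> \<and> \<phi> A * g = \<chi> \<cdot>\<^sub>m (g * map_mat \<rho> A)"
    obtain b where b: "\<And>j. deg_le ((\<rho> ^^ j) u) b" using ex_orbit_bound[OF r uR] by blast
    define k where "k = nat \<bar>b\<bar> + 1"
    define Y where "Y i = twist_block (s ^ (i + k)) u * h" for i
    have xR: "twist_block (s ^ i) u \<in> RM" for i using sk uR by (intro block_mat_RM) auto
    have inj: "i = j" if z: "z \<in> G" and eq: "Y j * \<phi> z = z * Y i" for i j z
    proof -
      let ?x = "s ^ (i + k)" and ?y = "s ^ (j + k)"
      obtain z' where z': "z' \<in> RM" "z * z' = 1\<^sub>m n" using inv[OF z] by blast
      obtain \<chi> where c: "R_unit \<chi>" "\<phi> z * g = \<chi> \<cdot>\<^sub>m (g * map_mat \<rho> z)" using std z by blast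
      note zc = A.G_carrier[OF z] A.G_carrier[OF A.phi_G[OF z]]
      have mz: "map_mat \<rho> z \<in> carrier_mat n n" using zc by simp
      \<comment> \<open>Multiplying by \<open>g\<close> on the right cancels \<open>h\<close> on
        both sides and leaves a relation twisted by \<open>\<rho>\<close> alone.\<close>
      have "z * twist_block ?x u = z * (Y i * g)"
        unfolding Y_def using hg[of "twist_block ?x u" "1\<^sub>m n"] gc by simp
      also have "\<dots> = Y j * \<phi> z * g"
        unfolding eq by (rule assoc[symmetric, OF zc(1) _ gc]) (simp add: Y_def mult_carrier_mat[OF block_mat_carrier hc])
      also have "\<dots> = Y j * (\<phi> z * g)"
        by (rule assoc[OF _ zc(2) gc]) (simp add: Y_def mult_carrier_mat[OF block_mat_carrier hc])
      also have "\<dots> = \<chi> \<cdot>\<^sub>m (Y j * (g * map_mat \<rho> z))"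
        unfolding c(2) using mult_smult_distrib[OF _ mult_carrier_mat[OF gc mz], of "Y j" n \<chi>]
        by (simp add: Y_def mult_carrier_mat[OF block_mat_carrier hc])
      also have "Y j * (g * map_mat \<rho> z) = twist_block ?y u * map_mat \<rho> z"
        unfolding Y_def by (rule hg[OF block_mat_carrier mz])
      finally have "\<chi> \<cdot>\<^sub>m (twist_block ?y u * map_mat \<rho> z) = z * twist_block ?x u" ..
      from fdeg_eq_if_twisted[OF r sk(1,2) sk(1,2) u c(1) A.G_RM[OF z] z' this sk(3) _ _ sk(3) _ _ b]
      have "fdeg ?x = fdeg ?y" using big[of b i] big[of b j] unfolding k_def by (simp add: add.assoc)
      then show ?thesis by (rule cancel)
    qed
    have YG: "Y i \<in> G" for i unfolding Y_def by (intro inG xR det_block_mat[OF n3])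
    show ?thesis
    proof (intro exI[of _ Y] conjI allI ballI impI)
      show "range Y \<subseteq> G" using YG by auto
      show "i = j" if "z \<in> G" "Y j * \<phi> z = z * Y i" for i j z using that by (rule inj)
    qed
  next
    assume std: "\<forall>A \<in> G. \<exists>\<chi>. R_unit \<chi> \<and> \<phi> A * (g * transpose_mat (map_mat \<rho> A)) = \<chi> \<cdot>\<^sub>m g"
    have r2: "ring_aut R (\<rho> ^^ 2)" by (rule ring_aut_funpow[OF r])
    have ru: "R_unit (\<rho> u)" by (rule aut_R_unit(1)[OF r u])
    \<comment> \<open>The corner entry of \<open>E i * E' i\<close>: \<open>u\<close> comes from
      \<open>E i\<close> and \<open>1 / \<rho> u\<close> from \<open>E' i\<close>.\<close>
    define \<nu> where "\<nu> = u * (1 / \<rho> u)"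
    have nu: "R_unit \<nu>" unfolding \<nu>_def using ru by (intro R_unit_mult u) (auto simp: R_unit_def)
    then have nuR: "\<nu> \<in> R" by (simp add: R_unit_def)
    obtain b where b: "\<And>j. deg_le (((\<rho> ^^ 2) ^^ j) \<nu>) b" using ex_orbit_bound[OF r2 nuR] by blast
    define k where "k = nat \<bar>b\<bar> + 1"
    define E where "E i = block_mat n 1 (s ^ (i + k)) 0 1 u" for i
    \<comment> \<open>The inverse transpose of the image of \<open>E i\<close> under
      \<open>\<rho>\<close>, as \<open>TE\<close> records.\<close>
    define E' where "E' i = block_mat n 1 0 (- (s ^ (i + k))) 1 (1 / \<rho> u)" for i
    define Y where "Y i = E i * h" for i
    have Ec: "E i \<in> carrier_mat n n" "E' i \<in> carrier_mat n n" for i by (simp_all add: E_def E'_def)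
    have Yc: "Y i \<in> carrier_mat n n" for i unfolding Y_def by (rule mult_carrier_mat[OF Ec(1) hc])
    have ER: "E i \<in> RM" for i unfolding E_def using sk uR by (intro block_mat_RM) auto
    have TE: "transpose_mat (map_mat \<rho> (E i)) * E' i = 1\<^sub>m n" for i
    proof -
      have "map_mat \<rho> (E i) = block_mat n 1 (s ^ (i + k)) 0 1 (\<rho> u)"
        unfolding E_def using map_block_mat[of \<rho> n] autD(2,3)[OF r] sk by simp
      then show ?thesis
        unfolding E'_def using ru block_mat_one by (simp add: transpose_block_mat block_mat_mult[OF n3] R_unit_def)
    qed
    have EE: "E i * E' i = twist_block (s ^ (i + k)) \<nu>" for i
      unfolding E_def E'_def \<nu>_def by (simp add: block_mat_mult[OF n3])
    have inj: "i = j" if z: "z \<in> G" and eq: "Y j * \<phi> z = z * Y i" for i j z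
    proof -
      let ?x = "s ^ (i + k)" and ?y = "s ^ (j + k)"
      obtain z' where z': "z' \<in> RM" "z * z' = 1\<^sub>m n" using inv[OF z] by blast
      define W where "W = transpose_mat (map_mat \<rho> z)"
      define Z2 where "Z2 = map_mat (\<rho> ^^ 2) z"
      define Tx where "Tx = transpose_mat (map_mat \<rho> (E i))"
      define Ty where "Ty = transpose_mat (map_mat \<rho> (E j))"
      obtain \<chi> where c: "R_unit \<chi>" "\<phi> z * (g * W) = \<chi> \<cdot>\<^sub>m g" using std z unfolding W_def by blast
      have cR: "\<chi> \<in> R" using c by (simp add: R_unit_def)
      have rc: "R_unit (\<rho> \<chi>)" by (rule aut_R_unit(1)[OF r c(1)])
      note zc = A.G_carrier[OF z] A.G_carrier[OF A.phi_G[OF z]]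
      have car: "W \<in> carrier_mat n n" "Z2 \<in> carrier_mat n n" "Tx \<in> carrier_mat n n" "Ty \<in> carrier_mat n n"
        using zc Ec by (auto simp: W_def Z2_def Tx_def Ty_def)
      have zW: "z * E i * W \<in> carrier_mat n n" "z * E i \<in> carrier_mat n n" "Z2 * Tx \<in> carrier_mat n n"
        "W * E' j \<in> carrier_mat n n" "E i * W \<in> carrier_mat n n"
        using zc Ec car by (auto intro!: mult_carrier_mat)
      \<comment> \<open>First use of the relation, multiplied on the right by \<open>g * W\<close>
        so that the inverse transpose of \<open>z\<close> disappears.\<close>
      have "z * E i * W = z * (E i * W)" by (rule assoc[OF zc(1) Ec(1) car(1)])
      also have "E i * W = Y i * (g * W)" unfolding Y_def by (rule hg[symmetric, OF Ec(1) car(1)])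
      also have "z * (Y i * (g * W)) = z * Y i * (g * W)"
        by (rule assoc[symmetric, OF zc(1) Yc mult_carrier_mat[OF gc car(1)]])
      also have "\<dots> = Y j * (\<phi> z * (g * W))"
        unfolding eq[symmetric] by (rule assoc[OF Yc zc(2) mult_carrier_mat[OF gc car(1)]])
      also have "\<dots> = \<chi> \<cdot>\<^sub>m (Y j * g)" unfolding c(2) by (rule mult_smult_distrib[OF Yc gc])
      also have "Y j * g = E j"
        unfolding Y_def using hg[OF Ec(1) one_carrier_mat] gc right_mult_one_mat[OF Ec(1)] by simp
      finally have E1: "z * E i * W = \<chi> \<cdot>\<^sub>m E j" .
      have WR: "W \<in> RM" using map_RM[OF r A.G_RM[OF z]] by (auto simp: W_def RM_def)
      have mW: "map_mat \<rho> W = transpose_mat Z2"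
        unfolding W_def Z2_def using zc by (intro eq_matI) (auto simp: numeral_2_eq_2)
      \<comment> \<open>Second use: applying \<open>\<rho>\<close> and transposing brings in
        \<open>\<rho>\<^sup>2\<close>.\<close>
      have "map_mat \<rho> (z * E i * W) = map_mat \<rho> (\<chi> \<cdot>\<^sub>m E j)" unfolding E1 ..
      then have "map_mat \<rho> z * map_mat \<rho> (E i) * transpose_mat Z2 = \<rho> \<chi> \<cdot>\<^sub>m map_mat \<rho> (E j)"
        unfolding map_mult[OF r mult_RM[OF A.G_RM[OF z] ER] WR] map_mult[OF r A.G_RM[OF z] ER]
          map_smult[OF r cR ER] mW .
      then have "transpose_mat (map_mat \<rho> z * map_mat \<rho> (E i) * transpose_mat Z2) =
        transpose_mat (\<rho> \<chi> \<cdot>\<^sub>m map_mat \<rho> (E j))" by simp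
      moreover have "transpose_mat (map_mat \<rho> z * map_mat \<rho> (E i) * transpose_mat Z2) = Z2 * (Tx * W)"
        using zc Ec car
        by (simp add: transpose_mult[of _ n n _ n] W_def Tx_def mult_carrier_mat[of _ n n _ n])
      moreover have "transpose_mat (\<rho> \<chi> \<cdot>\<^sub>m map_mat \<rho> (E j)) = \<rho> \<chi> \<cdot>\<^sub>m Ty"
        unfolding Ty_def by (intro eq_matI) auto
      ultimately have E2: "Z2 * (Tx * W) = \<rho> \<chi> \<cdot>\<^sub>m Ty" by simp
      let ?w = "1 / \<rho> \<chi>"
      \<comment> \<open>From here \<open>E2\<close> is inverted: a right inverse of a square matrix
        is also a left inverse, so the factors may be rearranged into \<open>E3\<close>.\<close>
      have w: "?w * \<rho> \<chi> = 1" using rc by (simp add: R_unit_def)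
      have "Z2 * Tx * (W * E' j) = Z2 * (Tx * W) * E' j"
        using car Ec by (simp add: assoc)
      also have "\<dots> = \<rho> \<chi> \<cdot>\<^sub>m (Ty * E' j)" unfolding E2 by (rule mult_smult_assoc_mat[OF car(4) Ec(2)])
      finally have "Z2 * Tx * (W * E' j) = \<rho> \<chi> \<cdot>\<^sub>m 1\<^sub>m n" unfolding Ty_def TE .
      then have "Z2 * Tx * (?w \<cdot>\<^sub>m (W * E' j)) = ?w \<cdot>\<^sub>m (\<rho> \<chi> \<cdot>\<^sub>m 1\<^sub>m n)"
        using mult_smult_distrib[OF zW(3,4), of ?w] by simp
      also have "\<dots> = 1\<^sub>m n" using w by (intro eq_matI) auto
      finally have "(?w \<cdot>\<^sub>m (W * E' j)) * (Z2 * Tx) = 1\<^sub>m n"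
        by (rule mat_mult_left_right_inverse[OF zW(3) smult_carrier_mat[OF zW(4)]])
      then have q: "?w \<cdot>\<^sub>m (W * E' j * (Z2 * Tx)) = 1\<^sub>m n"
        using mult_smult_assoc_mat[OF zW(4,3), of ?w] by simp
      have "W * E' j * (Z2 * Tx) = \<rho> \<chi> \<cdot>\<^sub>m (?w \<cdot>\<^sub>m (W * E' j * (Z2 * Tx)))"
        using w rc by (intro eq_matI) (auto simp: R_unit_def)
      then have "W * E' j * (Z2 * Tx) = \<rho> \<chi> \<cdot>\<^sub>m 1\<^sub>m n" unfolding q .
      then have "W * E' j * (Z2 * Tx) * E' i = \<rho> \<chi> \<cdot>\<^sub>m E' i"
        using mult_smult_assoc_mat[OF one_carrier_mat Ec(2)] left_mult_one_mat[OF Ec(2)] by simp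
      moreover have "W * E' j * (Z2 * Tx) * E' i = W * E' j * Z2"
      proof -
        have "W * E' j * (Z2 * Tx) * E' i = W * E' j * (Z2 * (Tx * E' i))"
          using zW(4) car Ec by (simp add: assoc mult_carrier_mat[of _ n n _ n])
        then show ?thesis unfolding Tx_def TE using car by simp
      qed
      \<comment> \<open>Together with \<open>E1\<close> this eliminates \<open>W\<close> and relates
        \<open>z\<close> to its image under \<open>\<rho>\<^sup>2\<close> through the products
        \<open>E i * E' i\<close>.\<close>
      ultimately have E3: "W * E' j * Z2 = \<rho> \<chi> \<cdot>\<^sub>m E' i" by simp
      have "\<chi> \<cdot>\<^sub>m (E j * E' j * Z2) = (\<chi> \<cdot>\<^sub>m E j) * (E' j * Z2)"
        using car Ec mult_smult_assoc_mat[OF Ec(1) mult_carrier_mat[OF Ec(2) car(2)]]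
        by (simp add: assoc)
      also have "\<dots> = z * E i * (W * E' j * Z2)"
        unfolding E1[symmetric] assoc[OF zW(2) car(1) mult_carrier_mat[OF Ec(2) car(2)]]
          assoc[OF car(1) Ec(2) car(2)] ..
      also have "\<dots> = \<rho> \<chi> \<cdot>\<^sub>m (z * E i * E' i)"
        unfolding E3 by (rule mult_smult_distrib[OF zW(2) Ec(2)])
      also have "z * E i * E' i = z * twist_block ?x \<nu>"
        unfolding EE[symmetric] by (rule assoc[OF zc(1) Ec])
      finally have E4: "\<chi> \<cdot>\<^sub>m (twist_block ?y \<nu> * Z2) = \<rho> \<chi> \<cdot>\<^sub>m (z * twist_block ?x \<nu>)" unfolding EE .
      have "(?w * \<chi>) \<cdot>\<^sub>m (twist_block ?y \<nu> * Z2) = ?w \<cdot>\<^sub>m (\<chi> \<cdot>\<^sub>m (twist_block ?y \<nu> * Z2))"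
        by (intro eq_matI) auto
      also have "\<dots> = z * twist_block ?x \<nu>" unfolding E4 using w by (intro eq_matI) (auto simp: R_unit_def)
      finally have rel: "(?w * \<chi>) \<cdot>\<^sub>m (twist_block ?y \<nu> * map_mat (\<rho> ^^ 2) z) = z * twist_block ?x \<nu>" unfolding Z2_def .
      have wc: "R_unit (?w * \<chi>)" using rc by (intro R_unit_mult c(1)) (auto simp: R_unit_def)
      have fixed: "(\<rho> ^^ 2) ?x = ?x" "(\<rho> ^^ 2) ?y = ?y" using sk(2) by (simp_all add: numeral_2_eq_2)
      from fdeg_eq_if_twisted[OF r2 sk(1) fixed(1) sk(1) fixed(2) nu wc A.G_RM[OF z] z' rel sk(3) _ _ sk(3) _ _ b]
      have "fdeg ?x = fdeg ?y" using big[of b i] big[of b j] unfolding k_def by (simp add: add.assoc)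
      then show ?thesis by (rule cancel)
    qed
    have YG: "Y i \<in> G" for i
      unfolding Y_def by (rule inG[OF ER]) (simp add: E_def det_block_mat[OF n3])
    show ?thesis
    proof (intro exI[of _ Y] conjI allI ballI impI)
      show "range Y \<subseteq> G" using YG by auto
      show "i = j" if "z \<in> G" "Y j * \<phi> z = z * Y i" for i j z using that by (rule inj)
    qed
  qed
qed

lemma R_infinity_matrix_group:
  fixes Gr :: "('k poly fract mat, 'm) monoid_scheme"
  assumes g: "group Gr" and RM: "carrier Gr \<subseteq> RM" and SL: "\<And>A. A \<in> RM \<Longrightarrow> det A = 1 \<Longrightarrow> A \<in> carrier Gr"
    and mult: "monoid.mult Gr = (*)" and one: "one Gr = 1\<^sub>m n"
    and mtrace: "\<And>A. A \<in> carrier Gr \<Longrightarrow> transpose_mat A \<in> carrier Gr"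
  shows "R_infinity_property Gr"
proof (rule R_infinity_property_if_infinite_family[OF g])
  interpret group Gr by (rule g)
  fix \<phi> assume phi: "\<phi> \<in> iso Gr Gr"
  have "matrix_aut_transpose R euclid_deg n p (carrier Gr) \<phi>"
  proof (unfold_locales, goal_cases)
    case (3 A B) then show ?case using m_closed[of A B] by (simp add: mult)
  next
    case (4 A)
    then show ?case
      using inv_closed[of A] r_inv[of A] l_inv[of A] unfolding mult one by blast
  next
    case 5 then show ?case using phi by (simp add: iso_def)
  next
    case (6 A B)
    then show ?case using phi by (auto simp: iso_def hom_def mult)
  qed (use RM SL mtrace in auto)
  from twisted_family[OF this] show "\<exists>Y :: nat \<Rightarrow> _. range Y \<subseteq> carrier Gr \<and>
      (\<forall>i j. \<forall>z \<in> carrier Gr. Y j \<otimes>\<^bsub>Gr\<^esub> \<phi> z = z \<otimes>\<^bsub>Gr\<^esub> Y i \<longrightarrow> i = j)"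
    unfolding mult .
qed

section \<open>The general and the special linear group\<close>

lemma carrier_Mat_over: "carrier (Mat_over n R) = RM"
  by (auto simp: Mat_over_def RM_def elements_mat_subset_iff)

lemma transpose_RM: "A \<in> RM \<Longrightarrow> transpose_mat A \<in> RM"
  by (auto simp: RM_def)

lemma R_infinity_GL_SL:
  assumes "subring R (ring_of_type_algebra :: 'k poly fract ring)"
  shows "R_infinity_property (GL n R)" "R_infinity_property (SL n R)"
proof -
  have SLc: "carrier (SL n R) = {A \<in> RM. det A = 1}"
    by (auto simp: SL_def carrier_Mat_over)
  have SLm: "monoid.mult (SL n R) = (*)" "one (SL n R) = 1\<^sub>m n"
    by (simp_all add: SL_def Mat_over_def)
  have GLc: "carrier (GL n R) = {A \<in> RM. \<exists>B \<in> RM. B * A = 1\<^sub>m n \<and> A * B = 1\<^sub>m n}"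
    unfolding GL_def units_of_def Units_def partial_object.simps carrier_Mat_over
    by (simp add: Mat_over_def)
  have GLm: "monoid.mult (GL n R) = (*)" "one (GL n R) = 1\<^sub>m n"
    by (simp_all add: GL_def units_of_def Mat_over_def)
  interpret S: group "SL n R" by (rule group_SL[OF assms])
  show "R_infinity_property (SL n R)"
    by (rule R_infinity_matrix_group[OF group_SL[OF assms] _ _ SLm])
      (auto simp: SLc transpose_RM det_transpose[OF RM_carrier])
  show "R_infinity_property (GL n R)"
  proof (rule R_infinity_matrix_group[OF group_GL[OF assms] _ _ GLm])
    show "carrier (GL n R) \<subseteq> RM" by (auto simp: GLc)
    fix A assume "A \<in> RM" "det A = 1"
    then have A: "A \<in> carrier (SL n R)" by (simp add: SLc)
    show "A \<in> carrier (GL n R)"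
      using A S.inv_closed[OF A] S.r_inv[OF A] S.l_inv[OF A] unfolding SLm GLc SLc by blast
  next
    fix A assume "A \<in> carrier (GL n R)"
    then obtain B where B: "A \<in> RM" "B \<in> RM" "B * A = 1\<^sub>m n" "A * B = 1\<^sub>m n" by (auto simp: GLc)
    have "transpose_mat B * transpose_mat A = 1\<^sub>m n" "transpose_mat A * transpose_mat B = 1\<^sub>m n"
      unfolding transpose_mult[OF RM_carrier[OF B(1)] RM_carrier[OF B(2)], symmetric]
        transpose_mult[OF RM_carrier[OF B(2)] RM_carrier[OF B(1)], symmetric] B(3,4) by simp_all
    then show "transpose_mat A \<in> carrier (GL n R)" using B transpose_RM by (auto simp: GLc)
  qed
qed

end

text \<open>\<open>x\<close> generates a finite-dimensional, hence finite, extension of the finite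
  field \<open>Fp\<close>, so two of its powers coincide.\<close>

lemma finite_algebraic_root_of_unity:
  fixes x :: "'k :: field"
  assumes "algebraic_closure (ring_of_type_algebra :: 'k ring) Fp" and fin: "finite Fp" and x: "x \<noteq> 0"
  shows "\<exists>m>0. x ^ m = 1"
proof -
  let ?L = "ring_of_type_algebra :: 'k ring"
  interpret algebraic_closure ?L Fp by fact
  have L: "carrier ?L = UNIV" "monoid.mult ?L = (*)" "one ?L = 1"
    by (simp_all add: ring_of_type_algebra_def)
  define E where "E = finite_extension Fp [x]"
  have xc: "set [x] \<subseteq> carrier ?L" by (simp add: L)
  have fd: "finite_dimension Fp E"
    unfolding E_def
    using finite_extension_finite_dimension(1)[OF subfield_axioms xc] algebraic_extension xc by auto
  then obtain Us where Us: "set Us \<subseteq> carrier ?L" "E = Span Fp Us"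
    using exists_base subfield_axioms by blast
  have "E \<subseteq> (\<lambda>Ks. combine Ks Us) ` {Ks. set Ks \<subseteq> Fp \<and> length Ks = length Us}"
    unfolding Us(2) Span_eq_combine_set_length_version[OF subfield_axioms Us(1)] by auto
  then have finE: "finite E"
    using finite_lists_length_eq[OF fin] by (rule finite_subset[OF _ finite_imageI])
  have sub: "subring E ?L"
    unfolding E_def by (rule finite_extension_is_subring[OF subfieldE(1)[OF subfield_axioms] xc])
  have xE: "x \<in> E"
    unfolding E_def using finite_extension_mem[OF subfieldE(1)[OF subfield_axioms] xc] by simp
  have "x ^ i \<in> E" for i
    by (induction i) (use subring_of_typeD(2,4)[OF sub] xE in auto)
  then have "range (\<lambda>i. x ^ i) \<subseteq> E" by auto
  then have "finite (range (\<lambda>i. x ^ i))" using finE by (rule finite_subset)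
  then have "\<not> inj (\<lambda>i. x ^ i)" using finite_imageD by fastforce
  then obtain i j where "i \<noteq> j" "x ^ i = x ^ j" by (auto simp: inj_def)
  then obtain i j where ij: "i < j" "x ^ i = x ^ j" by (metis linorder_neqE_nat)
  have "x ^ i * x ^ (j - i) = x ^ j" using ij(1) by (simp flip: power_add)
  then have "x ^ i * x ^ (j - i) = x ^ i * 1" using ij(2) by simp
  then have "x ^ (j - i) = 1" using x by simp
  then show ?thesis using ij by (intro exI[of _ "j - i"]) auto
qed

text \<open>The images of the natural numbers stay in the finite set \<open>S\<close>, so two of
  them coincide and the characteristic is positive.\<close>

lemma prime_CHAR_if_finite_subring:
  assumes sub: "subring S (ring_of_type_algebra :: 'k :: field ring)" and fin: "finite S"
  shows "prime CHAR('k)"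
proof -
  have "of_nat i \<in> S" for i
    by (induction i) (use subring_of_typeD(1,2,5)[OF sub] in auto)
  then have "range (of_nat :: nat \<Rightarrow> 'k) \<subseteq> S" by auto
  then have "finite (range (of_nat :: nat \<Rightarrow> 'k))" using fin by (rule finite_subset)
  then have "\<not> inj (of_nat :: nat \<Rightarrow> 'k)" using finite_imageD by fastforce
  then obtain i j :: nat where "i \<noteq> j" "of_nat i = (of_nat j :: 'k)" by (auto simp: inj_def)
  then obtain i j :: nat where ij: "i < j" "of_nat i = (of_nat j :: 'k)" by (metis linorder_neqE_nat)
  then have "of_nat (j - i) = (0 :: 'k)" by (simp add: of_nat_diff)
  then have "CHAR('k) > 0" using ij CHAR_pos_iff[where ?'a = 'k] zero_less_diff by blast
  then show ?thesis by (rule prime_CHAR_semidom)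
qed

theorem theorem1p1: 
  fixes p n :: nat
    and Fp F :: "'k :: field set"
    and R :: "'k poly fract set"
  assumes "prime p"
    and "algebraic_closure (ring_of_type_algebra :: 'k ring) Fp" and "card Fp = p"
    and "n \<ge> 3"
    and "subfield F (ring_of_type_algebra :: 'k ring)"
    and "subdomain R (ring_of_type_algebra :: 'k poly fract ring)"
    and "polys_over F \<subseteq> R" and "R \<subset> ratfuns_over F"
  shows "R_infinity_property (GL n R) \<and> R_infinity_property (SL n R)"
proof -
  let ?L = "ring_of_type_algebra :: 'k ring"
  interpret C: algebraic_closure ?L Fp by fact
  \<comment> \<open>An infinite set has \<open>card\<close> equal to 0, which is not prime.\<close>
  have fin: "finite Fp" using assms(1,3) by (metis card.infinite not_prime_0)
  have q: "prime CHAR('k)"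
    by (rule prime_CHAR_if_finite_subring[OF subfieldE(1)[OF C.subfield_axioms] fin])
  have FS: "subring F ?L" using assms(5) by (rule subfieldE(1))
  have RS: "subring R (ring_of_type_algebra :: 'k poly fract ring)"
    using assms(6) by (auto simp: subdomain_def subcring_def)
  note FD = subring_of_typeD[OF FS] and RD = subring_of_typeD[OF RS]
  have inv: "inverse x \<in> F" if x: "x \<in> F" for x
  proof (cases "x = 0")
    case True then show ?thesis using x by simp
  next
    case False
    have "x \<in> F - {\<zero>\<^bsub>?L\<^esub>}" using x False by (simp add: ring_of_type_algebra_def)
    from C.subfield_m_inv(1,2)[OF assms(5) this]
    have "inv\<^bsub>?L\<^esub> x \<in> F" "x * inv\<^bsub>?L\<^esub> x = 1" by (simp_all add: ring_of_type_algebra_def)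
    moreover from this have "inv\<^bsub>?L\<^esub> x = inverse x" using False by (simp add: field_simps)
    ultimately show ?thesis by simp
  qed
  \<comment> \<open>The characteristic of the large field serves as the prime of the locale.\<close>
  interpret rational_subring_matrices F R "CHAR('k)" n
  proof (unfold_locales, goal_cases)
    case (7 x) then show ?case using finite_algebraic_root_of_unity[OF assms(2) fin] by blast
  qed (use FD RD inv q assms in auto)
  show ?thesis using R_infinity_GL_SL[OF RS] by blast
qed

end
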